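(* Let $(E,\tau,M,\rho)$ be a Lie algebroid. Let $p,q\in\mathbb Z$, $P\in A^p(M,E)$ and $Q\in A^q(M,E)$. There exists a unique element of $A^{p+q-1}(M,E)$, called the Schouten-Nijenhuis bracket of $P$ and $Q$ and denoted by $[P,Q]$, such that the interior product $i([P,Q])$, considered as a graded endomorphism of degree $-(p+q-1)$ of the exterior algebra $\Omega(M,E)$, is given by $$i\bigl([P,Q]\bigr)=\bigl[[i(P),d_\rho],i(Q)\bigr],$$ the brackets in the right hand side being graded brackets of graded endomorphisms of $\Omega(M,E)$.
   Context: A Lie algebroid $(E,\tau,M,\rho)$ is a smooth real vector bundle $\tau:E\to M$ of finite rank over a smooth manifold, with a real Lie algebra bracket $\{\ ,\ \}$ on its smooth sections and a smooth vector bundle map $\rho:E\to TM$ over $\mathrm{id}_M$ (anchor) such that $\{s_1,fs_2\}=f\{s_1,s_2\}+(\mathcal L(\rho\circ s_1)f)s_2$. $A^p(M,E)$ and $\Omega^p(M,E)$ are the spaces of smooth sections of $\bigwedge^pE$ and $\bigwedge^pE^*$ (both $C^\infty(M,\mathbb R)$ for $p=0$, $\{0\}$ for $p<0$); $A(M,E)=\bigoplus_pA^p(M,E)$, $\Omega(M,E)=\bigoplus_p\Omega^p(M,E)$, graded algebras for $\wedge$. Interior product: $i(f)\eta=f\eta$ for $f\in C^\infty(M,\mathbb R)$; for $V\in A^1(M,E)$, $(i(V)\eta)(V_1,\dots,V_{r-1})=\eta(V,V_1,\dots,V_{r-1})$ for $\eta\in\Omega^r(M,E)$, $r\ge1$,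 and $i(V)=0$ on $\Omega^0(M,E)$; $i(V_1\wedge\cdots\wedge V_p)=i(V_1)\circ\cdots\circ i(V_p)$, extended by linearity. For $P\in A^p(M,E)$, $i(P)$ has degree $-p$. $d_\rho$ is the degree $1$ endomorphism of $\Omega(M,E)$ given by $\langle d_\rho f,V\rangle=\mathcal L(\rho\circ V)f$ and, for $\eta\in\Omega^p(M,E)$, $p\ge1$, $V_0,\dots,V_p\in A^1(M,E)$, $$d_\rho\eta(V_0,\dots,V_p)=\sum_{i=0}^p(-1)^i\mathcal L(\rho\circ V_i)\bigl(\eta(V_0,\dots,\widehat{V_i},\dots,V_p)\bigr)+\sum_{0\le i<j\le p}(-1)^{i+j}\eta(\{V_i,V_j\},V_0,\dots,\widehat{V_i},\dots,\widehat{V_j},\dots,V_p).$$ Graded bracket: $[F,G]=F\circ G-(-1)^{d_1d_2}G\circ F$ for graded endomorphisms $F,G$ of degrees $d_1,d_2$. *)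

theory Defs
  imports "HOL-Analysis.Analysis"
begin

section \<open>Smooth maps and manifolds\<close>

text \<open>
  Local models are finite-dimensional real inner product spaces. The class
  \<^class>\<open>euclidean_space\<close> is not used because it excludes dimension 0 (a Lie algebroid over
  a point is a Lie algebra, and bundles may have rank 0).
\<close>

definition finite_dim :: "'a::real_vector set \<Rightarrow> bool" where
  "finite_dim S \<longleftrightarrow> (\<exists>B. finite B \<and> span B = S)"

primrec Ck_on :: "nat \<Rightarrow> 'a::real_normed_vector set \<Rightarrow> ('a \<Rightarrow> 'b::real_normed_vector) \<Rightarrow> bool" where
  "Ck_on 0 S f \<longleftrightarrow> continuous_on S f"
| "Ck_on (Suc k) S f \<longleftrightarrow> (\<forall>x\<in>S. f differentiable (at x)) \<and>
     (\<forall>v. Ck_on k S (\<lambda>x. frechet_derivative f (at x) v))"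

text \<open>Only meaningful for open \<open>S\<close> in a finite-dimensional space.\<close>

definition smooth_on :: "'a::real_normed_vector set \<Rightarrow> ('a \<Rightarrow> 'b::real_normed_vector) \<Rightarrow> bool" where
  "smooth_on S f \<longleftrightarrow> (\<forall>k. Ck_on k S f)"

text \<open>A chart is a pair \<open>(U, c)\<close>; the values of \<open>c\<close> outside its domain \<open>U\<close> are irrelevant.\<close>

type_synonym ('m, 'b) chart = "'m set \<times> ('m \<Rightarrow> 'b)"

text \<open>
  The manifold \<open>M\<close> is the type \<open>'m\<close>, with smooth structure given by an atlas (not necessarily
  maximal).
\<close>

locale smooth_manifold =
  fixes A :: "('m::{t2_space, second_countable_topology}, 'b::real_inner) chart set"
  assumes model_finite_dim: "finite_dim (UNIV :: 'b set)"
    and charts_cover: "(\<Union>(U, c)\<in>A. U) = UNIV"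
    and chart: "(U, c) \<in> A \<Longrightarrow>
      open U \<and> open (c ` U) \<and> homeomorphism U (c ` U) c (inv_into U c)"
    and transition: "(U, c) \<in> A \<Longrightarrow> (V, d) \<in> A \<Longrightarrow>
      smooth_on (c ` (U \<inter> V)) (d \<circ> inv_into U c)"

text \<open>Smoothness of \<open>f\<close> on the open set \<open>W\<close> of the manifold with atlas \<open>A\<close>.\<close>

definition smooth_fun ::
    "('m, 'b::real_normed_vector) chart set \<Rightarrow> 'm set \<Rightarrow> ('m \<Rightarrow> 'a::real_normed_vector) \<Rightarrow> bool" where
  "smooth_fun A W f \<longleftrightarrow> (\<forall>(U, c)\<in>A. smooth_on (c ` (U \<inter> W)) (f \<circ> inv_into U c))"

section \<open>Vector bundles\<close>

text \<open>
  A trivialisation \<open>(U, \<phi>)\<close> restricts on each fibre over \<open>U\<close> to a linear isomorphism onto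
  the typical fibre \<open>'c\<close>; it stands for the map from the part of the total space over \<open>U\<close> to
  \<open>U \<times> 'c\<close> sending \<open>e\<close> to \<open>(proj e, \<phi> e)\<close>. The topology and smooth structure of the total
  space are those for which these maps are diffeomorphisms.
\<close>

record ('m, 'e, 'c) vbundle =
  total :: "'e set"
  proj :: "'e \<Rightarrow> 'm"
  vadd :: "'e \<Rightarrow> 'e \<Rightarrow> 'e"
  vscale :: "real \<Rightarrow> 'e \<Rightarrow> 'e"
  vzero :: "'m \<Rightarrow> 'e"
  trivs :: "('m set \<times> ('e \<Rightarrow> 'c)) set"

definition fibre :: "('m, 'e, 'c) vbundle \<Rightarrow> 'm \<Rightarrow> 'e set" where
  "fibre E x = {e \<in> total E. proj E e = x}"

definition local_section ::
    "('m, 'e, 'c) vbundle \<Rightarrow> ('e \<Rightarrow> 'c) \<Rightarrow> 'c \<Rightarrow> 'm \<Rightarrow> 'e" where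
  "local_section E \<phi> w x = inv_into (fibre E x) \<phi> w"

text \<open>
  The real vector space axioms in each fibre follow from closedness under the operations and
  the linear bijections onto \<open>'c\<close>.
\<close>

locale vector_bundle = smooth_manifold A
  for A :: "('m::{t2_space, second_countable_topology}, 'b::real_inner) chart set" +
  fixes E :: "('m, 'e, 'c::real_inner) vbundle"
  assumes fibre_finite_dim: "finite_dim (UNIV :: 'c set)"
    and vzero_closed: "vzero E x \<in> fibre E x"
    and vadd_closed: "u \<in> fibre E x \<Longrightarrow> v \<in> fibre E x \<Longrightarrow> vadd E u v \<in> fibre E x"
    and vscale_closed: "u \<in> fibre E x \<Longrightarrow> vscale E a u \<in> fibre E x"
    and trivs_cover: "(\<Union>(U, \<phi>)\<in>trivs E. U) = UNIV"
    and triv_open: "(U, \<phi>) \<in> trivs E \<Longrightarrow> open U"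
    and triv_bij: "(U, \<phi>) \<in> trivs E \<Longrightarrow> x \<in> U \<Longrightarrow> bij_betw \<phi> (fibre E x) UNIV"
    and triv_zero: "(U, \<phi>) \<in> trivs E \<Longrightarrow> x \<in> U \<Longrightarrow> \<phi> (vzero E x) = 0"
    and triv_add: "(U, \<phi>) \<in> trivs E \<Longrightarrow> x \<in> U \<Longrightarrow> u \<in> fibre E x \<Longrightarrow> v \<in> fibre E x \<Longrightarrow>
      \<phi> (vadd E u v) = \<phi> u + \<phi> v"
    and triv_scale: "(U, \<phi>) \<in> trivs E \<Longrightarrow> x \<in> U \<Longrightarrow> u \<in> fibre E x \<Longrightarrow>
      \<phi> (vscale E a u) = a *\<^sub>R \<phi> u"
    and triv_transition: "(U, \<phi>) \<in> trivs E \<Longrightarrow> (V, \<psi>) \<in> trivs E \<Longrightarrow>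
      smooth_fun A (U \<inter> V) (\<lambda>x. \<psi> (local_section E \<phi> w x))"

definition sections ::
    "('m, 'b::real_normed_vector) chart set \<Rightarrow> ('m, 'e, 'c::real_normed_vector) vbundle \<Rightarrow>
     ('m \<Rightarrow> 'e) set" where
  "sections A E =
     {s. (\<forall>x. s x \<in> fibre E x) \<and> (\<forall>(U, \<phi>)\<in>trivs E. smooth_fun A U (\<lambda>x. \<phi> (s x)))}"

definition sec_add :: "('m, 'e, 'c) vbundle \<Rightarrow> ('m \<Rightarrow> 'e) \<Rightarrow> ('m \<Rightarrow> 'e) \<Rightarrow> 'm \<Rightarrow> 'e" where
  "sec_add E s t = (\<lambda>x. vadd E (s x) (t x))"

definition sec_scale :: "('m, 'e, 'c) vbundle \<Rightarrow> ('m \<Rightarrow> real) \<Rightarrow> ('m \<Rightarrow> 'e) \<Rightarrow> 'm \<Rightarrow> 'e" where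
  "sec_scale E f s = (\<lambda>x. vscale E (f x) (s x))"

text \<open>
  Smooth vector bundle maps over the identity. By linearity, smoothness in trivialisations
  amounts to smoothness of the images of the constant local sections.
\<close>

definition bundle_map ::
    "('m, 'b::real_normed_vector) chart set \<Rightarrow> ('m, 'e, 'c) vbundle \<Rightarrow>
     ('m, 'e2, 'd::real_normed_vector) vbundle \<Rightarrow> ('e \<Rightarrow> 'e2) \<Rightarrow> bool" where
  "bundle_map A E F h \<longleftrightarrow>
     (\<forall>x. \<forall>u\<in>fibre E x. h u \<in> fibre F x \<and>
        (\<forall>v\<in>fibre E x. h (vadd E u v) = vadd F (h u) (h v)) \<and>
        (\<forall>a. h (vscale E a u) = vscale F a (h u))) \<and>
     (\<forall>(U, \<phi>)\<in>trivs E. \<forall>(V, \<psi>)\<in>trivs F. \<forall>w.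
        smooth_fun A (U \<inter> V) (\<lambda>x. \<psi> (h (local_section E \<phi> w x))))"

section \<open>The tangent bundle\<close>

text \<open>
  A tangent vector at \<open>x\<close> is the family of its representatives in the charts around \<open>x\<close>,
  which are related by the derivatives of the transition maps. Entries for other indices are
  set to 0, so that a tangent vector is determined by any one of its representatives.
\<close>

definition tangent_space ::
    "('m, 'b::real_normed_vector) chart set \<Rightarrow> 'm \<Rightarrow> (('m, 'b) chart \<Rightarrow> 'b) set" where
  "tangent_space A x = {\<zeta>.
     (\<forall>c. c \<notin> A \<or> x \<notin> fst c \<longrightarrow> \<zeta> c = 0) \<and>
     (\<forall>(U, c)\<in>A. \<forall>(V, d)\<in>A. x \<in> U \<longrightarrow> x \<in> V \<longrightarrow>
        \<zeta> (V, d) = frechet_derivative (d \<circ> inv_into U c) (at (c x)) (\<zeta> (U, c)))}"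

type_synonym ('m, 'b) tvec = "'m \<times> (('m, 'b) chart \<Rightarrow> 'b)"

definition tangent_bundle ::
    "('m, 'b::real_normed_vector) chart set \<Rightarrow> ('m, ('m, 'b) tvec, 'b) vbundle" where
  "tangent_bundle A =
     \<lparr>total = {(x, \<zeta>). \<zeta> \<in> tangent_space A x},
      proj = fst,
      vadd = (\<lambda>(x, \<zeta>) (y, \<xi>). (x, \<lambda>c. \<zeta> c + \<xi> c)),
      vscale = (\<lambda>a (x, \<zeta>). (x, \<lambda>c. a *\<^sub>R \<zeta> c)),
      vzero = (\<lambda>x. (x, \<lambda>c. 0)),
      trivs = {(fst c, \<lambda>v. snd v c) | c. c \<in> A}\<rparr>"

text \<open>
  Derivative of the function \<open>f\<close> along the vector field \<open>X\<close>. The value does not depend on the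
  chart used, by the chain rule.
\<close>

definition lie_deriv ::
    "('m, 'b::real_normed_vector) chart set \<Rightarrow> ('m \<Rightarrow> ('m, 'b) tvec) \<Rightarrow> ('m \<Rightarrow> real) \<Rightarrow> 'm \<Rightarrow> real" where
  "lie_deriv A X f x =
     (let c = (SOME c. c \<in> A \<and> x \<in> fst c)
      in frechet_derivative (f \<circ> inv_into (fst c) (snd c)) (at (snd c x)) (snd (X x) c))"

section \<open>Lie algebroids\<close>

text \<open>The last three assumptions are antisymmetry, Jacobi and Leibniz.\<close>

locale lie_algebroid = vector_bundle A E
  for A :: "('m::{t2_space, second_countable_topology}, 'b::real_inner) chart set"
    and E :: "('m, 'e, 'c::real_inner) vbundle" +
  fixes br :: "('m \<Rightarrow> 'e) \<Rightarrow> ('m \<Rightarrow> 'e) \<Rightarrow> ('m \<Rightarrow> 'e)"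
    and \<rho> :: "'e \<Rightarrow> ('m, 'b) tvec"
  assumes anchor: "bundle_map A E (tangent_bundle A) \<rho>"
    and br_closed: "s \<in> sections A E \<Longrightarrow> t \<in> sections A E \<Longrightarrow> br s t \<in> sections A E"
    and br_add_left: "s \<in> sections A E \<Longrightarrow> s' \<in> sections A E \<Longrightarrow> t \<in> sections A E \<Longrightarrow>
      br (sec_add E s s') t = sec_add E (br s t) (br s' t)"
    and br_add_right: "s \<in> sections A E \<Longrightarrow> t \<in> sections A E \<Longrightarrow> t' \<in> sections A E \<Longrightarrow>
      br s (sec_add E t t') = sec_add E (br s t) (br s t')"
    and br_scale_left: "s \<in> sections A E \<Longrightarrow> t \<in> sections A E \<Longrightarrow>
      br (sec_scale E (\<lambda>_. a) s) t = sec_scale E (\<lambda>_. a) (br s t)"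
    and br_scale_right: "s \<in> sections A E \<Longrightarrow> t \<in> sections A E \<Longrightarrow>
      br s (sec_scale E (\<lambda>_. a) t) = sec_scale E (\<lambda>_. a) (br s t)"
    and br_antisym: "s \<in> sections A E \<Longrightarrow> t \<in> sections A E \<Longrightarrow>
      br s t = sec_scale E (\<lambda>_. - 1) (br t s)"
    and br_jacobi: "s \<in> sections A E \<Longrightarrow> t \<in> sections A E \<Longrightarrow> u \<in> sections A E \<Longrightarrow>
      sec_add E (br s (br t u)) (sec_add E (br t (br u s)) (br u (br s t))) = vzero E"
    and br_leibniz: "s \<in> sections A E \<Longrightarrow> t \<in> sections A E \<Longrightarrow> smooth_fun A UNIV f \<Longrightarrow>
      br s (sec_scale E f t) =
        sec_add E (sec_scale E f (br s t)) (sec_scale E (lie_deriv A (\<rho> \<circ> s) f) t)"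

section \<open>Forms\<close>

text \<open>
  An element of the exterior algebra of the dual of a fibre is a sum of alternating multilinear
  forms of various degrees. It is represented by a single function on lists of vectors, whose
  degree \<open>p\<close> component is its restriction to the lists of length \<open>p\<close> (the scalar of degree 0
  being the value at the empty list), and which is 0 on lists not contained in the fibre.
\<close>

definition ext_forms :: "('m, 'e, 'c) vbundle \<Rightarrow> 'm \<Rightarrow> ('e list \<Rightarrow> real) set" where
  "ext_forms E x = {\<alpha>.
     (\<forall>vs. \<not> set vs \<subseteq> fibre E x \<longrightarrow> \<alpha> vs = 0) \<and>
     (\<forall>us u v ws. set us \<union> {u, v} \<union> set ws \<subseteq> fibre E x \<longrightarrow>
        \<alpha> (us @ vadd E u v # ws) = \<alpha> (us @ u # ws) + \<alpha> (us @ v # ws)) \<and>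
     (\<forall>us u a ws. set us \<union> {u} \<union> set ws \<subseteq> fibre E x \<longrightarrow>
        \<alpha> (us @ vscale E a u # ws) = a * \<alpha> (us @ u # ws)) \<and>
     (\<forall>us v vs ws. \<alpha> (us @ v # vs @ v # ws) = 0) \<and>
     (\<exists>N. \<forall>vs. N < length vs \<longrightarrow> \<alpha> vs = 0)}"

text \<open>The graded algebra of forms, the direct sum over all degrees.\<close>

definition forms ::
    "('m, 'b::real_normed_vector) chart set \<Rightarrow> ('m, 'e, 'c) vbundle \<Rightarrow> ('m \<Rightarrow> 'e list \<Rightarrow> real) set" where
  "forms A E = {\<eta>.
     (\<forall>x. \<eta> x \<in> ext_forms E x) \<and>
     (\<exists>N. \<forall>x vs. N < length vs \<longrightarrow> \<eta> x vs = 0) \<and>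
     (\<forall>(U, \<phi>)\<in>trivs E. \<forall>ws.
        smooth_fun A U (\<lambda>x. \<eta> x (map (\<lambda>w. local_section E \<phi> w x) ws)))}"

section \<open>Multivectors and the interior product\<close>

text \<open>
  Since fibres are finite-dimensional, the exterior algebra of a fibre is canonically embedded
  in the dual of \<^const>\<open>ext_forms\<close>, the product of \<open>v\<^sub>1, \<dots>, v\<^sub>p\<close> being sent to evaluation at
  \<open>(v\<^sub>1, \<dots>, v\<^sub>p)\<close>; the product of the empty list is the unit 1.
\<close>

definition wedge :: "('m, 'e, 'c) vbundle \<Rightarrow> 'm \<Rightarrow> 'e list \<Rightarrow> ('e list \<Rightarrow> real) \<Rightarrow> real" where
  "wedge E x vs = (\<lambda>\<alpha>. if \<alpha> \<in> ext_forms E x then \<alpha> vs else 0)"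

text \<open>
  Smooth sections of the \<open>p\<close>-th exterior power, for any integer \<open>p\<close>: over each trivialising
  open set they are finite combinations, with smooth coefficients, of products of \<open>p\<close> constant
  local sections. Only the zero section qualifies if \<open>p < 0\<close>.
\<close>

definition multivectors ::
    "('m, 'b::real_normed_vector) chart set \<Rightarrow> ('m, 'e, 'c) vbundle \<Rightarrow> int \<Rightarrow>
     ('m \<Rightarrow> ('e list \<Rightarrow> real) \<Rightarrow> real) set" where
  "multivectors A E p = {P. \<forall>(U, \<phi>)\<in>trivs E. \<exists>ts.
     (\<forall>(f, ws)\<in>set ts. smooth_fun A U f \<and> int (length ws) = p) \<and>
     (\<forall>x\<in>U. P x =
        (\<lambda>\<alpha>. \<Sum>(f, ws)\<leftarrow>ts. f x * wedge E x (map (\<lambda>w. local_section E \<phi> w x) ws) \<alpha>))}"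

text \<open>Interior product by a vector field.\<close>

definition contract :: "('m \<Rightarrow> 'e) \<Rightarrow> ('m \<Rightarrow> 'e list \<Rightarrow> real) \<Rightarrow> 'm \<Rightarrow> 'e list \<Rightarrow> real" where
  "contract V \<eta> = (\<lambda>x ws. \<eta> x (V x # ws))"

text \<open>
  Interior product by a multivector. It is linear in the multivector, and the lemma
  \<open>interior_product_wedge\<close> below says that the product of \<open>V\<^sub>1, \<dots>, V\<^sub>p\<close> acts as the
  composition of the contractions with \<open>V\<^sub>1, \<dots>, V\<^sub>p\<close>; this is the source of the reversal.
\<close>

definition interior_product ::
    "('m \<Rightarrow> ('e list \<Rightarrow> real) \<Rightarrow> real) \<Rightarrow> ('m \<Rightarrow> 'e list \<Rightarrow> real) \<Rightarrow> 'm \<Rightarrow> 'e list \<Rightarrow> real" where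
  "interior_product P \<eta> = (\<lambda>x ws. P x (\<lambda>vs. \<eta> x (rev vs @ ws)))"

lemma ext_forms_rev_append:
  assumes "\<alpha> \<in> ext_forms E x"
  shows "(\<lambda>vs. \<alpha> (rev vs @ ws)) \<in> ext_forms E x"
proof -
  note \<alpha> = assms[unfolded ext_forms_def mem_Collect_eq]
  note supp = \<alpha>[THEN conjunct1, rule_format]
  note add = \<alpha>[THEN conjunct2, THEN conjunct1, rule_format]
  note scale = \<alpha>[THEN conjunct2, THEN conjunct2, THEN conjunct1, rule_format]
  note alt = \<alpha>[THEN conjunct2, THEN conjunct2, THEN conjunct2, THEN conjunct1, rule_format]
  from \<alpha>[THEN conjunct2, THEN conjunct2, THEN conjunct2, THEN conjunct2]
  obtain N where N: "\<And>vs. N < length vs \<Longrightarrow> \<alpha> vs = 0" by iprover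
  show ?thesis
  proof (cases "set ws \<subseteq> fibre E x")
    case True
    have 1: "\<alpha> (rev vs @ ws) = 0" if "\<not> set vs \<subseteq> fibre E x" for vs
      by (rule supp) (use that in simp)
    have 2: "\<alpha> (rev (us @ vadd E u v # zs) @ ws) =
        \<alpha> (rev (us @ u # zs) @ ws) + \<alpha> (rev (us @ v # zs) @ ws)"
      if "set us \<union> {u, v} \<union> set zs \<subseteq> fibre E x" for us u v zs
      using add[of "rev zs" u v "rev us @ ws"] that True by simp
    have 3: "\<alpha> (rev (us @ vscale E a u # zs) @ ws) = a * \<alpha> (rev (us @ u # zs) @ ws)"
      if "set us \<union> {u} \<union> set zs \<subseteq> fibre E x" for us u a zs
      using scale[of "rev zs" u "rev us @ ws" a] that True by simp
    have 4: "\<alpha> (rev (us @ v # vs @ v # zs) @ ws) = 0" for us v vs zs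
      using alt[of "rev zs" v "rev vs" "rev us @ ws"] by simp
    have 5: "\<alpha> (rev vs @ ws) = 0" if "N < length vs" for vs
      by (rule N) (use that in simp)
    show ?thesis unfolding ext_forms_def mem_Collect_eq
      by (intro conjI allI impI exI[of _ N]) (erule 1 2 3 5 | rule 4)+
  next
    case False
    have "\<alpha> (rev vs @ ws) = 0" for vs by (rule supp) (use False in simp)
    then show ?thesis by (simp add: ext_forms_def)
  qed
qed

lemma interior_product_wedge:
  assumes "\<eta> \<in> forms A E"
  shows "interior_product (\<lambda>x. wedge E x (map (\<lambda>V. V x) Vs)) \<eta> = foldr contract Vs \<eta>"
proof (intro ext)
  fix x ws
  have "foldr contract Vs \<eta> x ws = \<eta> x (rev (map (\<lambda>V. V x) Vs) @ ws)"
    by (induction Vs arbitrary: ws) (simp_all add: contract_def)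
  moreover have "\<eta> x \<in> ext_forms E x"
    using assms by (simp add: forms_def)
  then have "(\<lambda>vs. \<eta> x (rev vs @ ws)) \<in> ext_forms E x"
    by (rule ext_forms_rev_append)
  ultimately show "interior_product (\<lambda>x. wedge E x (map (\<lambda>V. V x) Vs)) \<eta> x ws =
      foldr contract Vs \<eta> x ws"
    by (simp add: interior_product_def wedge_def)
qed

section \<open>The differential and graded brackets\<close>

definition omit :: "nat \<Rightarrow> 'a list \<Rightarrow> 'a list" where
  "omit i xs = take i xs @ drop (Suc i) xs"

text \<open>
  The value at \<open>x\<close> of the differential of \<open>\<eta>\<close> on the sections \<open>Vs\<close>. For a list of length
  \<open>p + 1\<close> only the degree \<open>p\<close> component of \<open>\<eta>\<close> enters; for \<open>p = 0\<close> the second sum is empty,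
  and for the empty list both sums are.
\<close>

definition d_formula ::
    "('m, 'b::real_normed_vector) chart set \<Rightarrow> (('m \<Rightarrow> 'e) \<Rightarrow> ('m \<Rightarrow> 'e) \<Rightarrow> ('m \<Rightarrow> 'e)) \<Rightarrow>
     ('e \<Rightarrow> ('m, 'b) tvec) \<Rightarrow> ('m \<Rightarrow> 'e list \<Rightarrow> real) \<Rightarrow> ('m \<Rightarrow> 'e) list \<Rightarrow> 'm \<Rightarrow> real" where
  "d_formula A br \<rho> \<eta> Vs x =
     (\<Sum>i<length Vs. (-1) ^ i *
        lie_deriv A (\<rho> \<circ> Vs ! i) (\<lambda>y. \<eta> y (map (\<lambda>V. V y) (omit i Vs))) x) +
     (\<Sum>j<length Vs. \<Sum>i<j. (-1) ^ (i + j) *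
        \<eta> x (map (\<lambda>V. V x) (br (Vs ! i) (Vs ! j) # omit i (omit j Vs))))"

definition d_rho ::
    "('m, 'b::real_normed_vector) chart set \<Rightarrow> ('m, 'e, 'c::real_normed_vector) vbundle \<Rightarrow>
     (('m \<Rightarrow> 'e) \<Rightarrow> ('m \<Rightarrow> 'e) \<Rightarrow> ('m \<Rightarrow> 'e)) \<Rightarrow> ('e \<Rightarrow> ('m, 'b) tvec) \<Rightarrow>
     ('m \<Rightarrow> 'e list \<Rightarrow> real) \<Rightarrow> 'm \<Rightarrow> 'e list \<Rightarrow> real" where
  "d_rho A E br \<rho> \<eta> = (THE \<omega>. \<omega> \<in> forms A E \<and>
     (\<forall>Vs x. set Vs \<subseteq> sections A E \<longrightarrow> \<omega> x (map (\<lambda>V. V x) Vs) = d_formula A br \<rho> \<eta> Vs x))"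

text \<open>
  Graded bracket of endomorphisms \<open>F\<close> and \<open>G\<close>; their degrees \<open>k\<close> and \<open>l\<close> are explicit
  arguments, since they are not determined by the maps (the zero map has every degree).
\<close>

definition graded_bracket ::
    "int \<Rightarrow> (('m \<Rightarrow> 'e list \<Rightarrow> real) \<Rightarrow> 'm \<Rightarrow> 'e list \<Rightarrow> real) \<Rightarrow>
     int \<Rightarrow> (('m \<Rightarrow> 'e list \<Rightarrow> real) \<Rightarrow> 'm \<Rightarrow> 'e list \<Rightarrow> real) \<Rightarrow>
     ('m \<Rightarrow> 'e list \<Rightarrow> real) \<Rightarrow> 'm \<Rightarrow> 'e list \<Rightarrow> real" where
  "graded_bracket k F l G \<eta> = (\<lambda>x vs. F (G \<eta>) x vs - (-1) powi (k * l) * G (F \<eta>) x vs)"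

end

theory Submission
  imports Defs
begin

text \<open>
  The right-hand side \<open>[[i(P), d], i(Q)]\<close> is local in \<open>P\<close> and \<open>Q\<close>, so near a point both may be
  replaced by sums of products of globally defined functions and sections, using bump functions.
  The interior products of these are compositions of multiplications by functions and contractions
  with sections. Since interior products commute in the graded sense, the graded Leibniz rule
  reduces the claim to these generators, where it follows from \<open>[[i(V), d], i(W)] = i({V, W})\<close>,
  \<open>[[i(V), d], f] = \<L>(V) f\<close>, \<open>[[f, d], i(W)] = - \<L>(W) f\<close> and \<open>[[f, d], g] = 0\<close>. A multivector at \<open>x\<close>
  is determined by its interior products, because every form on the fibre over \<open>x\<close> extends to a
  smooth form; hence the local solutions are unique and fit together.
\<close>

section \<open>Calculus of smooth maps\<close>

text \<open>Two definitions resist a purely local argument. The differential is a \<open>THE\<close>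
  over a formula in global sections, so nothing is known of it until that formula is shown to be
  multilinear over functions and alternating; this is done by rewriting it recursively through
  Cartan's relation, and afterwards operator identities are asserted on forms only. Multivectors
  need one finite sum with smooth coefficients over the whole of each trivialising set, while the
  local computation yields unrelated sums near different points. Instead of joining these by a
  partition of unity, a reference fibre is fixed, the bracket is evaluated on forms carried over
  from that fibre by the trivialisation, and the resulting functions, defined on the whole set,
  serve as coefficients. Products of frame vectors are in general linearly dependent as functionals
  on alternating forms, so a finite family of test forms takes the place of a dual basis. Forms are
  not split by degree; degrees enter only through the integers in the signs and the lengths of
  products.\<close>

lemma Ck_on_subset: "Ck_on k S f \<Longrightarrow> T \<subseteq> S \<Longrightarrow> Ck_on k T f"
  by (induction k arbitrary: f) (auto intro: continuous_on_subset)

lemma Ck_on_cong: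
  assumes "open S" "\<And>x. x \<in> S \<Longrightarrow> f x = g x" "Ck_on k S f"
  shows "Ck_on k S g"
  using assms(2,3)
proof (induction k arbitrary: f g)
  case 0
  then show ?case by (simp cong: continuous_on_cong)
next
  case (Suc k)
  have g: "g differentiable (at x)" if "x \<in> S" for x
    using Suc.prems that assms(1) unfolding differentiable_def Ck_on.simps
    by (meson has_derivative_transform_within_open)
  have "Ck_on k S (\<lambda>x. frechet_derivative g (at x) v)" for v
  proof (rule Suc.IH)
    show "Ck_on k S (\<lambda>x. frechet_derivative f (at x) v)" using Suc.prems by simp
    show "frechet_derivative f (at x) v = frechet_derivative g (at x) v" if "x \<in> S" for x
      using frechet_derivative_transform_within_open[of f x S g] Suc.prems that assms(1) by auto
  qed
  with g show ?case by simp
qed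

lemma Ck_on_local:
  assumes "open S" "\<And>x. x \<in> S \<Longrightarrow> \<exists>T. open T \<and> x \<in> T \<and> T \<subseteq> S \<and> Ck_on k T f"
  shows "Ck_on k S f"
  using assms(2)
proof (induction k arbitrary: f)
  case 0
  have "isCont f x" if x: "x \<in> S" for x
  proof -
    obtain T where "open T" "x \<in> T" "continuous_on T f" using 0[OF x] by auto
    then show ?thesis by (simp add: continuous_on_eq_continuous_at)
  qed
  then show ?case by (simp add: continuous_at_imp_continuous_on)
next
  case (Suc k)
  have "Ck_on k S (\<lambda>x. frechet_derivative f (at x) v)" for v
  proof (rule Suc.IH)
    fix x assume "x \<in> S"
    from Suc.prems[OF this]
    obtain T where "open T" "x \<in> T" "T \<subseteq> S" "Ck_on (Suc k) T f" by blast
    then show "\<exists>T. open T \<and> x \<in> T \<and> T \<subseteq> S \<and> Ck_on k T (\<lambda>x. frechet_derivative f (at x) v)"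
      by (intro exI[of _ T]) simp
  qed
  moreover have "f differentiable (at x)" if x: "x \<in> S" for x
  proof -
    obtain T where "x \<in> T" "Ck_on (Suc k) T f" using Suc.prems[OF x] by blast
    then show ?thesis by simp
  qed
  ultimately show ?case by simp
qed

text \<open>Lets the later inductions work with the explicit derivative from the product or chain
  rule in place of the chosen \<open>frechet_derivative\<close>.\<close>

lemma Ck_on_SucI:
  assumes "open S" "\<And>x. x \<in> S \<Longrightarrow> (f has_derivative f' x) (at x)" "\<And>v. Ck_on k S (\<lambda>x. f' x v)"
  shows "Ck_on (Suc k) S f"
proof -
  have "Ck_on k S (\<lambda>x. frechet_derivative f (at x) v)" for v
    by (rule Ck_on_cong[OF assms(1) _ assms(3)[of v]]) (metis assms(2) frechet_derivative_at)
  then show ?thesis using assms(2) by (auto simp: differentiable_def)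
qed

lemma Ck_on_SucD:
  "Ck_on (Suc k) S f \<Longrightarrow> x \<in> S \<Longrightarrow> (f has_derivative frechet_derivative f (at x)) (at x)"
  by (simp add: frechet_derivative_works)

lemma Ck_on_Suc_imp: "Ck_on (Suc k) S f \<Longrightarrow> Ck_on k S f"
proof (induction k arbitrary: f)
  case 0
  then show ?case
    by (auto intro!: continuous_at_imp_continuous_on differentiable_imp_continuous_within)
next
  case (Suc k)
  then show ?case by (metis Ck_on.simps(2))
qed

lemma Ck_on_const: "Ck_on k S (\<lambda>x. c)"
  by (induction k arbitrary: c) auto

lemma Ck_on_linear:
  assumes "open S" "bounded_linear h" "Ck_on k S f"
  shows "Ck_on k S (\<lambda>x. h (f x))"
  using assms(3)
proof (induction k arbitrary: f)
  case 0
  then show ?case using bounded_linear.continuous_on[OF assms(2)] by simp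
next
  case (Suc k)
  show ?case
  proof (rule Ck_on_SucI[OF assms(1)])
    show "((\<lambda>x. h (f x)) has_derivative (\<lambda>v. h (frechet_derivative f (at x) v))) (at x)"
      if "x \<in> S" for x
      by (rule bounded_linear.has_derivative[OF assms(2) Ck_on_SucD[OF Suc.prems that]])
    show "Ck_on k S (\<lambda>x. h (frechet_derivative f (at x) v))" for v
      by (rule Suc.IH) (use Suc.prems in simp)
  qed
qed

lemma Ck_on_add:
  assumes "open S" "Ck_on k S f" "Ck_on k S g"
  shows "Ck_on k S (\<lambda>x. f x + g x)"
  using assms(2,3)
proof (induction k arbitrary: f g)
  case 0
  then show ?case by (simp add: continuous_on_add)
next
  case (Suc k)
  show ?case
  proof (rule Ck_on_SucI[OF assms(1)])
    show "((\<lambda>x. f x + g x) has_derivative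
        (\<lambda>v. frechet_derivative f (at x) v + frechet_derivative g (at x) v)) (at x)"
      if "x \<in> S" for x
      by (rule has_derivative_add[OF Ck_on_SucD[OF Suc.prems(1) that] Ck_on_SucD[OF Suc.prems(2) that]])
    show "Ck_on k S (\<lambda>x. frechet_derivative f (at x) v + frechet_derivative g (at x) v)" for v
      by (rule Suc.IH) (use Suc.prems in simp_all)
  qed
qed

lemma Ck_on_bilinear:
  assumes "open S" "bounded_bilinear h" "Ck_on k S f" "Ck_on k S g"
  shows "Ck_on k S (\<lambda>x. h (f x) (g x))"
  using assms(3,4)
proof (induction k arbitrary: f g)
  case 0
  then show ?case using bounded_bilinear.continuous_on[OF assms(2)] by auto
next
  case (Suc k)
  show ?case
  proof (rule Ck_on_SucI[OF assms(1)])
    show "((\<lambda>x. h (f x) (g x)) has_derivative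
        (\<lambda>v. h (f x) (frechet_derivative g (at x) v) + h (frechet_derivative f (at x) v) (g x))) (at x)"
      if "x \<in> S" for x
      by (rule bounded_bilinear.FDERIV[OF assms(2) Ck_on_SucD[OF Suc.prems(1) that]
            Ck_on_SucD[OF Suc.prems(2) that]])
    have "Ck_on k S f" "Ck_on k S g"
      using Suc.prems by (auto intro: Ck_on_Suc_imp simp del: Ck_on.simps)
    with Suc.prems show "Ck_on k S (\<lambda>x. h (f x) (frechet_derivative g (at x) v) +
        h (frechet_derivative f (at x) v) (g x))" for v
      by (intro Ck_on_add assms(1) Suc.IH) simp_all
  qed
qed

text \<open>The function \<open>g n\<close> stands for an n-th derivative. The claim is kept for
  every \<open>n\<close> because differentiating \<open>g n\<close> after \<open>F\<close> brings in
  \<open>g (Suc n)\<close>, so the induction on \<open>k\<close> has to move along the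
  sequence.\<close>

lemma Ck_on_compose_real:
  fixes F :: "'a::real_normed_vector \<Rightarrow> real"
  assumes "open S" "\<And>n t. t \<in> T \<Longrightarrow> (g n has_real_derivative g (Suc n) t) (at t)"
    and "Ck_on k S F" "F ` S \<subseteq> T"
  shows "Ck_on k S (\<lambda>x. g n (F x))"
  using assms(3)
proof (induction k arbitrary: n)
  case 0
  have "continuous_on (F ` S) (g n)"
    by (meson DERIV_continuous assms(2,4) continuous_at_imp_continuous_on subsetD)
  then show ?case using 0 continuous_on_compose2[of "F ` S" "g n" S F] by simp
next
  case (Suc k)
  show ?case
  proof (rule Ck_on_SucI[OF assms(1)])
    show "((\<lambda>x. g n (F x)) has_derivative (\<lambda>v. frechet_derivative F (at x) v * g (Suc n) (F x))) (at x)"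
      if "x \<in> S" for x
      by (rule has_derivative_eq_rhs, rule DERIV_compose_FDERIV[OF assms(2) Ck_on_SucD[OF Suc.prems that]])
        (use assms(4) that in auto)
    show "Ck_on k S (\<lambda>x. frechet_derivative F (at x) v * g (Suc n) (F x))" for v
      by (rule Ck_on_bilinear[OF assms(1) bounded_bilinear_mult])
        (use Suc.prems in \<open>auto intro: Suc.IH Ck_on_Suc_imp simp del: Ck_on.simps(2)\<close>, simp)
  qed
qed

lemma smooth_on_subset: "smooth_on S f \<Longrightarrow> T \<subseteq> S \<Longrightarrow> smooth_on T f"
  unfolding smooth_on_def using Ck_on_subset by blast

lemma smooth_on_cong:
  "open S \<Longrightarrow> (\<And>x. x \<in> S \<Longrightarrow> f x = g x) \<Longrightarrow> smooth_on S f \<Longrightarrow> smooth_on S g"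
  unfolding smooth_on_def using Ck_on_cong by blast

lemma smooth_on_local:
  "open S \<Longrightarrow> (\<And>x. x \<in> S \<Longrightarrow> \<exists>T. open T \<and> x \<in> T \<and> T \<subseteq> S \<and> smooth_on T f) \<Longrightarrow> smooth_on S f"
  unfolding smooth_on_def by (meson Ck_on_local)

lemma smooth_on_const: "smooth_on S (\<lambda>x. c)"
  by (simp add: smooth_on_def Ck_on_const)

lemma smooth_on_linear:
  "open S \<Longrightarrow> bounded_linear h \<Longrightarrow> smooth_on S f \<Longrightarrow> smooth_on S (\<lambda>x. h (f x))"
  by (simp add: smooth_on_def Ck_on_linear)

lemma smooth_on_add:
  "open S \<Longrightarrow> smooth_on S f \<Longrightarrow> smooth_on S g \<Longrightarrow> smooth_on S (\<lambda>x. f x + g x)"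
  by (simp add: smooth_on_def Ck_on_add)

lemma smooth_on_bilinear:
  "open S \<Longrightarrow> bounded_bilinear h \<Longrightarrow> smooth_on S f \<Longrightarrow> smooth_on S g \<Longrightarrow>
    smooth_on S (\<lambda>x. h (f x) (g x))"
  by (simp add: smooth_on_def Ck_on_bilinear)

lemma smooth_on_imp_differentiable: "smooth_on S f \<Longrightarrow> x \<in> S \<Longrightarrow> f differentiable (at x)"
  unfolding smooth_on_def by (metis Ck_on.simps(2))

lemma smooth_on_frechet_derivative:
  "smooth_on S f \<Longrightarrow> smooth_on S (\<lambda>x. frechet_derivative f (at x) v)"
  unfolding smooth_on_def by (metis Ck_on.simps(2))

text \<open>A witness sequence of successive derivatives, the input of
  \<open>Ck_on_compose_real\<close>; smoothness on the line becomes exhibiting a class closed under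
  differentiation.\<close>

definition smooth_real_on :: "real set \<Rightarrow> (real \<Rightarrow> real) \<Rightarrow> bool" where
  "smooth_real_on T g \<longleftrightarrow> (\<exists>G. G (0::nat) = g \<and>
     (\<forall>n. \<forall>t\<in>T. (G n has_real_derivative G (Suc n) t) (at t)))"

lemma smooth_on_compose_real:
  assumes "open S" "smooth_real_on T g" "smooth_on S F" "F ` S \<subseteq> T"
  shows "smooth_on S (\<lambda>x. g (F x))"
proof -
  obtain G where G: "G (0::nat) = g" "\<And>n t. t \<in> T \<Longrightarrow> (G n has_real_derivative G (Suc n) t) (at t)"
    using assms(2) by (auto simp: smooth_real_on_def)
  have "Ck_on k S (\<lambda>x. G 0 (F x))" for k
    using Ck_on_compose_real[of S T G k F 0] G(2) assms by (simp add: smooth_on_def)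
  then show ?thesis by (simp add: smooth_on_def G(1))
qed

section \<open>Bump functions on the line\<close>

lemma smooth_real_on_inverse: "smooth_real_on {0<..} inverse"
proof -
  \<comment> \<open>The n-th derivative of 1/t.\<close>
  define G where "G n t = (-1) ^ n * fact n * inverse t ^ Suc n" for n and t :: real
  have "(G n has_real_derivative G (Suc n) t) (at t)" if "t > 0" for n t
    unfolding G_def
    by (rule DERIV_cong[OF DERIV_cmult[OF DERIV_power_Suc[OF DERIV_inverse]]])
      (use that in \<open>simp_all add: algebra_simps\<close>)
  moreover have "G 0 = inverse" by (simp add: G_def fun_eq_iff)
  ultimately show ?thesis unfolding smooth_real_on_def by auto
qed

text \<open>With \<open>p = 1\<close> this is the classical smooth function that is flat at 0.
  Polynomials in 1/t are included because differentiation produces them as factors, so the family is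
  closed under it.\<close>

definition flat :: "real poly \<Rightarrow> real \<Rightarrow> real" where
  "flat p t = (if t > 0 then poly p (inverse t) * exp (- inverse t) else 0)"

lemma poly_exp_tendsto_0: "((\<lambda>t::real. poly p t * exp (- t)) \<longlongrightarrow> 0) at_top"
proof -
  have "((\<lambda>t. coeff p i * (t ^ i / exp t)) \<longlongrightarrow> 0) at_top" for i
    by (rule tendsto_mult_right_zero) (rule tendsto_power_div_exp_0)
  then have "((\<lambda>t. \<Sum>i\<le>degree p. coeff p i * (t ^ i / exp t)) \<longlongrightarrow> 0) at_top"
    using tendsto_sum[where a = "\<lambda>_. 0" and I = "{..degree p}"] by fastforce
  then show ?thesis
    by (simp add: poly_altdef sum_distrib_right exp_minus divide_inverse mult.assoc)
qed

text \<open>For positive t both factors contribute 1/t^2 by the chain rule, whence the factor X^2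
  (\<open>[:0, 0, 1:]\<close>) and \<open>p - pderiv p\<close>. At 0 the difference quotient from
  the right is again a polynomial in 1/t times the exponential, with \<open>pCons 0 p\<close> for X
  p, and decays.\<close>

lemma flat_deriv:
  "(flat p has_real_derivative flat ([:0, 0, 1:] * (p - pderiv p)) t) (at t)"
proof -
  consider "t > 0" | "t < 0" | "t = 0" by linarith
  then show ?thesis
  proof cases
    case 1
    have "((\<lambda>t. poly p (inverse t) * exp (- inverse t)) has_real_derivative
        flat ([:0, 0, 1:] * (p - pderiv p)) t) (at t)"
      using 1 by (auto intro!: derivative_eq_intros simp: flat_def field_simps power2_eq_square)
    then show ?thesis
      by (rule has_field_derivative_transform_within_open[of _ _ _ "{0<..}"]) (use 1 in \<open>auto simp: flat_def\<close>)
  next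
    case 2
    have "((\<lambda>t. 0) has_real_derivative flat ([:0, 0, 1:] * (p - pderiv p)) t) (at t)"
      using 2 by (simp add: flat_def)
    then show ?thesis
      by (rule has_field_derivative_transform_within_open[of _ _ _ "{..<0}"]) (use 2 in \<open>auto simp: flat_def\<close>)
  next
    case 3
    have "((\<lambda>h. flat p h / h) \<longlongrightarrow> 0) (at_right 0)"
    proof (rule Lim_transform_eventually)
      have "((\<lambda>h::real. poly (pCons 0 p) (inverse h) * exp (- inverse h)) \<longlongrightarrow> 0) (at_right 0)"
        by (rule filterlim_compose[OF poly_exp_tendsto_0 filterlim_inverse_at_top_right])
      then show "((\<lambda>h::real. poly (pCons 0 p) (inverse h) * exp (- inverse h)) \<longlongrightarrow> 0) (at_right 0)" .
      show "\<forall>\<^sub>F h in at_right 0. poly (pCons 0 p) (inverse h) * exp (- inverse h) = flat p h / h"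
        by (auto simp: eventually_at_filter flat_def divide_inverse)
    qed
    moreover have "((\<lambda>h. flat p h / h) \<longlongrightarrow> 0) (at_left 0)"
      by (rule Lim_transform_eventually[OF tendsto_const])
        (auto simp: eventually_at_filter flat_def)
    ultimately have "((\<lambda>h. flat p h / h) \<longlongrightarrow> 0) (at 0)"
      by (simp add: filterlim_split_at)
    then show ?thesis using 3 by (simp add: DERIV_def flat_def)
  qed
qed

lemma smooth_real_on_flat: "smooth_real_on UNIV (flat p)"
proof -
  define G where "G n = flat (((\<lambda>p. [:0, 0, 1:] * (p - pderiv p)) ^^ n) p)" for n
  have "G 0 = flat p" "\<And>n t. (G n has_real_derivative G (Suc n) t) (at t)"
    using flat_deriv by (simp_all add: G_def)
  then show ?thesis unfolding smooth_real_on_def by blast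
qed

lemma flat_1: "flat 1 t = (if t > 0 then exp (- inverse t) else 0)"
  by (simp add: flat_def)

text \<open>The quotient is 1 where \<open>F \<le> a\<close> and 0 where \<open>F \<ge> b\<close>.
  As \<open>a < b\<close>, at each point one of the two summands of the denominator is
  positive.\<close>

lemma bump_on:
  fixes F :: "'a::real_normed_vector \<Rightarrow> real"
  assumes "open S" "smooth_on S F" "a < b"
  shows "smooth_on S (\<lambda>x. flat 1 (b - F x) * inverse (flat 1 (b - F x) + flat 1 (F x - a)))"
proof -
  have neg: "bounded_linear (uminus :: real \<Rightarrow> real)"
    by (simp add: bounded_linear_minus bounded_linear_ident)
  have c: "smooth_on S (\<lambda>x. c + - F x)" "smooth_on S (\<lambda>x. F x + c)" for c
    by (intro smooth_on_add smooth_on_const assms smooth_on_linear[OF assms(1) neg])+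
  have 1: "smooth_on S (\<lambda>x. flat 1 (b - F x))"
    using smooth_on_compose_real[OF assms(1) smooth_real_on_flat c(1)] by simp
  have 2: "smooth_on S (\<lambda>x. flat 1 (F x - a))"
    using smooth_on_compose_real[OF assms(1) smooth_real_on_flat c(2)[of "- a"]] by simp
  have "smooth_on S (\<lambda>x. inverse (flat 1 (b - F x) + flat 1 (F x - a)))"
    by (rule smooth_on_compose_real[OF assms(1) smooth_real_on_inverse smooth_on_add[OF assms(1) 1 2]])
      (use assms(3) in \<open>auto simp: flat_1 add_pos_pos\<close>)
  then show ?thesis by (rule smooth_on_bilinear[OF assms(1) bounded_bilinear_mult 1])
qed

section \<open>Finite-dimensional inner product spaces\<close>

text \<open>An orthogonal spanning set gives the coordinates as inner products, so their continuity
  comes for free.\<close>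

lemma finite_dim_coordinates:
  assumes "finite_dim (UNIV :: 'a::real_inner set)"
  shows "\<exists>(B :: 'a set) co. finite B \<and> (\<forall>b. bounded_linear (co b)) \<and> (\<forall>w. w = (\<Sum>b\<in>B. co b w *\<^sub>R b))"
proof -
  obtain B0 :: "'a set" where "finite B0" "span B0 = UNIV"
    using assms by (auto simp: finite_dim_def)
  then obtain B :: "'a set" where B: "finite B" "span B = UNIV" "pairwise orthogonal B"
    using basis_orthogonal[of B0] by auto
  define co where "co b w = (w \<bullet> b) / (b \<bullet> b)" for b w :: 'a
  have bl: "bounded_linear (co b)" for b
    unfolding co_def divide_inverse
    by (intro bounded_linear_intros)
  have "w = (\<Sum>b\<in>B. co b w *\<^sub>R b)" for w
  proof -
    obtain u where w: "w = (\<Sum>b\<in>B. u b *\<^sub>R b)"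
      using B(1,2) span_finite by blast
    have "w \<bullet> b = u b * (b \<bullet> b)" if b: "b \<in> B" for b
    proof -
      have "w \<bullet> b = (\<Sum>b'\<in>B. u b' * (b' \<bullet> b))" by (simp add: w inner_sum_left)
      also have "\<dots> = (\<Sum>b'\<in>B. if b' = b then u b * (b \<bullet> b) else 0)"
        using B(3) b by (intro sum.cong) (auto simp: pairwise_def orthogonal_def)
      finally show ?thesis using B(1) b by simp
    qed
    \<comment> \<open>The set may contain 0; there the two coefficients can differ, but both terms
      vanish.\<close>
    then have "co b w *\<^sub>R b = u b *\<^sub>R b" if "b \<in> B" for b
      using that by (cases "b = 0") (simp_all add: co_def)
    then have "(\<Sum>b\<in>B. co b w *\<^sub>R b) = (\<Sum>b\<in>B. u b *\<^sub>R b)" by (rule sum.cong[OF refl])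
    with w show ?thesis by (rule trans[OF _ sym])
  qed
  with B(1) bl show ?thesis by (intro exI[of _ B] exI[of _ co] conjI allI)
qed

lemma compact_finite_combinations:
  fixes B :: "'a::real_normed_vector set"
  assumes "finite B"
  shows "compact {\<Sum>b\<in>B. u b *\<^sub>R b | u. \<forall>b\<in>B. \<bar>u b\<bar> \<le> M}"
  using assms
proof (induction B)
  case (insert b B)
  let ?K = "{\<Sum>b\<in>B. u b *\<^sub>R b | u. \<forall>b\<in>B. \<bar>u b\<bar> \<le> M}"
  have "compact ((\<lambda>(t, z). t *\<^sub>R b + z) ` ({-M..M} \<times> ?K))"
    by (intro compact_continuous_image compact_Times insert.IH)
      (auto intro!: continuous_intros simp: case_prod_unfold)
  also have "(\<lambda>(t, z). t *\<^sub>R b + z) ` ({-M..M} \<times> ?K) =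
      {\<Sum>b\<in>insert b B. u b *\<^sub>R b | u. \<forall>b\<in>insert b B. \<bar>u b\<bar> \<le> M}" (is "?L = ?R")
  proof (intro equalityI subsetI)
    fix y assume "y \<in> ?L"
    then obtain t u where y: "t \<in> {-M..M}" "\<forall>b\<in>B. \<bar>u b\<bar> \<le> M" "y = t *\<^sub>R b + (\<Sum>b\<in>B. u b *\<^sub>R b)" by auto
    have "(\<Sum>c\<in>B. (u(b := t)) c *\<^sub>R c) = (\<Sum>b\<in>B. u b *\<^sub>R b)"
      by (intro sum.cong) (use insert.hyps in auto)
    then have "y = (\<Sum>c\<in>insert b B. (u(b := t)) c *\<^sub>R c)" using y insert.hyps by simp
    then show "y \<in> ?R" using y by (intro CollectI exI[of _ "u(b := t)"]) auto
  next
    fix y assume "y \<in> ?R"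
    then obtain u where u: "\<forall>b\<in>insert b B. \<bar>u b\<bar> \<le> M" "y = (\<Sum>b\<in>insert b B. u b *\<^sub>R b)" by auto
    then show "y \<in> ?L"
      using insert.hyps by (intro image_eqI[of _ _ "(u b, \<Sum>b\<in>B. u b *\<^sub>R b)"]) auto
  qed
  finally show ?case .
qed simp

text \<open>Coordinates are bounded on the ball, so it is a closed subset of a compact set of
  bounded combinations. Compactness is what makes the supports of bump functions closed in
  M.\<close>

lemma compact_cball_finite_dim:
  fixes a :: "'a::real_inner"
  assumes "finite_dim (UNIV :: 'a set)"
  shows "compact (cball a r)"
proof -
  obtain B :: "'a set" and co where B: "finite B" "\<forall>b. bounded_linear (co b)"
    "\<forall>w. w = (\<Sum>b\<in>B. co b w *\<^sub>R b)" using finite_dim_coordinates[OF assms] by auto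
  have "\<forall>b. \<exists>K. \<forall>w. \<bar>co b w\<bar> \<le> norm w * K"
    using B(2) bounded_linear.bounded by fastforce
  then obtain M where M: "\<And>b w. \<bar>co b w\<bar> \<le> norm w * M b" by (auto dest!: choice)
  \<comment> \<open>Bounds every coordinate on the ball at once; \<open>\<bar>r\<bar>\<close> covers
    a negative radius.\<close>
  define N where "N = (norm a + \<bar>r\<bar>) * (\<Sum>b\<in>B. \<bar>M b\<bar>)"
  have co_le: "\<bar>co b w\<bar> \<le> N" if "w \<in> cball a r" "b \<in> B" for w b
  proof -
    have "norm w \<le> norm a + \<bar>r\<bar>"
      using that(1) norm_triangle_ineq2[of w a] by (simp add: dist_norm norm_minus_commute)
    moreover have "\<bar>M b\<bar> \<le> (\<Sum>b\<in>B. \<bar>M b\<bar>)" using that(2) B(1) by (intro member_le_sum) auto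
    ultimately have "norm w * \<bar>M b\<bar> \<le> N" unfolding N_def by (intro mult_mono) auto
    moreover have "norm w * M b \<le> norm w * \<bar>M b\<bar>" by (intro mult_left_mono) auto
    ultimately show ?thesis using M[of b w] by linarith
  qed
  have "cball a r \<subseteq> {\<Sum>b\<in>B. u b *\<^sub>R b | u. \<forall>b\<in>B. \<bar>u b\<bar> \<le> N}"
  proof (intro subsetI CollectI)
    fix w assume "w \<in> cball a r"
    with co_le have "\<forall>b\<in>B. \<bar>co b w\<bar> \<le> N" by simp
    with B(3)[rule_format, of w] show "\<exists>u. w = (\<Sum>b\<in>B. u b *\<^sub>R b) \<and> (\<forall>b\<in>B. \<bar>u b\<bar> \<le> N)"
      by (intro exI[of _ "\<lambda>b. co b w"] conjI)
  qed
  then have "cball a r = {\<Sum>b\<in>B. u b *\<^sub>R b | u. \<forall>b\<in>B. \<bar>u b\<bar> \<le> N} \<inter> cball a r" by blast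
  then show ?thesis
    using compact_Int_closed[OF compact_finite_combinations[OF B(1), of N] closed_cball[of a r]] by simp
qed

section \<open>Smooth functions on manifolds\<close>

text \<open>One choice per type of coordinate functionals, so that local frames can be used without
  carrying a basis along. Only the expansion property is recorded: \<open>frame\<close> spans, but
  its elements may be linearly dependent.\<close>

definition coords :: "'a::real_inner set \<times> ('a \<Rightarrow> 'a \<Rightarrow> real)" where
  "coords = (SOME p. finite (fst p) \<and> (\<forall>b. bounded_linear (snd p b)) \<and>
     (\<forall>w. w = (\<Sum>b\<in>fst p. snd p b w *\<^sub>R b)))"

definition frame :: "'a::real_inner set" where "frame = fst coords"

definition coord :: "'a::real_inner \<Rightarrow> 'a \<Rightarrow> real" where "coord = snd coords"

lemma coords_frame:
  assumes "finite_dim (UNIV :: 'a::real_inner set)"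
  shows finite_frame: "finite (frame :: 'a set)"
    and bounded_linear_coord: "bounded_linear (coord (b :: 'a))"
    and sum_coord: "(\<Sum>b\<in>frame. coord b w *\<^sub>R b) = (w :: 'a)"
proof -
  have "\<exists>p :: 'a set \<times> ('a \<Rightarrow> 'a \<Rightarrow> real). finite (fst p) \<and> (\<forall>b. bounded_linear (snd p b)) \<and>
     (\<forall>w. w = (\<Sum>b\<in>fst p. snd p b w *\<^sub>R b))"
    using finite_dim_coordinates[OF assms] by simp
  from someI_ex[OF this]
  have *: "finite (frame :: 'a set)" "\<forall>b. bounded_linear (coord (b :: 'a))"
    "\<forall>w. w = (\<Sum>b\<in>frame. coord (b :: 'a) w *\<^sub>R b)"
    unfolding frame_def coord_def coords_def by auto
  show "finite (frame :: 'a set)" "bounded_linear (coord (b :: 'a))" using * by simp_all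
  show "(\<Sum>b\<in>frame. coord b w *\<^sub>R b) = (w :: 'a)" by (rule sym) (rule *(3)[rule_format])
qed

lemma linear_sum_coord:
  assumes "finite_dim (UNIV :: 'a::real_inner set)" "linear L"
  shows "L w = (\<Sum>b\<in>frame. coord b w *\<^sub>R L (b :: 'a))"
proof -
  have "L w = L (\<Sum>b\<in>frame. coord b w *\<^sub>R b)" by (simp add: sum_coord[OF assms(1)])
  then show ?thesis by (simp add: linear_sum[OF assms(2)] linear_scale[OF assms(2)])
qed

context smooth_manifold
begin

abbreviation "smooth f \<equiv> smooth_fun A UNIV f"

lemma inv_chart:
  assumes "(U, c) \<in> A" "x \<in> U"
  shows "inv_into U c (c x) = x"
  using chart[OF assms(1)] assms(2) by (simp add: homeomorphism_def)

lemma open_chart_image: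
  assumes "(U, c) \<in> A" "open W"
  shows "open (c ` (U \<inter> W))"
proof -
  note c = chart[OF assms(1)]
  have "openin (top_of_set U) (U \<inter> W)" using assms(2) by (simp add: openin_open_Int)
  then have "openin (top_of_set (c ` U)) (c ` (U \<inter> W))"
    using homeomorphism_imp_open_map c by blast
  then show ?thesis using c openin_open_trans by blast
qed

lemma chart_at: obtains U c where "(U, c) \<in> A" "x \<in> U"
proof -
  have "x \<in> (\<Union>(U, c)\<in>A. U)" unfolding charts_cover by simp
  then show thesis by (auto intro: that)
qed

lemma smooth_fun_subset: "smooth_fun A W f \<Longrightarrow> W' \<subseteq> W \<Longrightarrow> smooth_fun A W' f"
  unfolding smooth_fun_def by (fastforce elim!: smooth_on_subset)

lemma smooth_fun_cong:
  assumes "open W" "\<And>x. x \<in> W \<Longrightarrow> f x = g x" "smooth_fun A W f"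
  shows "smooth_fun A W g"
  unfolding smooth_fun_def
proof safe
  fix U c assume c: "(U, c) \<in> A"
  show "smooth_on (c ` (U \<inter> W)) (g \<circ> inv_into U c)"
    by (rule smooth_on_cong[of _ "f \<circ> inv_into U c"])
      (use assms c in \<open>auto simp: open_chart_image inv_chart smooth_fun_def\<close>)
qed

lemma smooth_fun_local:
  assumes "open W"
    and "\<And>x. x \<in> W \<Longrightarrow> \<exists>T. open T \<and> x \<in> T \<and> T \<subseteq> W \<and> smooth_fun A T f"
  shows "smooth_fun A W f"
  unfolding smooth_fun_def
proof safe
  fix U c assume c: "(U, c) \<in> A"
  show "smooth_on (c ` (U \<inter> W)) (f \<circ> inv_into U c)"
  proof (rule smooth_on_local)
    show "open (c ` (U \<inter> W))" using open_chart_image c assms(1) by blast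
    fix z assume "z \<in> c ` (U \<inter> W)"
    then obtain x where x: "x \<in> U" "x \<in> W" "z = c x" by blast
    from assms(2)[OF x(2)] obtain T where T: "open T" "x \<in> T" "T \<subseteq> W" "smooth_fun A T f" by blast
    show "\<exists>T. open T \<and> z \<in> T \<and> T \<subseteq> c ` (U \<inter> W) \<and> smooth_on T (f \<circ> inv_into U c)"
      by (rule exI[of _ "c ` (U \<inter> T)"])
        (use T x c open_chart_image[OF c T(1)] in \<open>auto simp: smooth_fun_def\<close>)
  qed
qed

lemma smooth_fun_const: "smooth_fun A W (\<lambda>x. k)"
  by (auto simp: smooth_fun_def o_def smooth_on_const)

lemma smooth_fun_add:
  assumes "open W" "smooth_fun A W f" "smooth_fun A W g"
  shows "smooth_fun A W (\<lambda>x. f x + g x)"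
  using assms unfolding smooth_fun_def o_def
  by (auto intro!: smooth_on_add open_chart_image)

lemma smooth_fun_bilinear:
  assumes "open W" "bounded_bilinear h" "smooth_fun A W f" "smooth_fun A W g"
  shows "smooth_fun A W (\<lambda>x. h (f x) (g x))"
  using assms(3,4) unfolding smooth_fun_def o_def
  by (auto intro!: smooth_on_bilinear[OF open_chart_image[OF _ assms(1)] assms(2)])

lemma smooth_fun_linear:
  assumes "open W" "bounded_linear h" "smooth_fun A W f"
  shows "smooth_fun A W (\<lambda>x. h (f x))"
  using assms(3) unfolding smooth_fun_def o_def
  by (auto intro!: smooth_on_linear[OF open_chart_image[OF _ assms(1)] assms(2)])

lemmas smooth_fun_mult = smooth_fun_bilinear[OF _ bounded_bilinear_mult]
lemmas smooth_fun_scaleR = smooth_fun_bilinear[OF _ bounded_bilinear_scaleR]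
lemmas smooth_fun_inner = smooth_fun_bilinear[OF _ bounded_bilinear_inner]

lemma smooth_fun_diff:
  fixes f g :: "'m \<Rightarrow> real"
  assumes "open W" "smooth_fun A W f" "smooth_fun A W g"
  shows "smooth_fun A W (\<lambda>x. f x - g x)"
  using smooth_fun_add[OF assms(1,2) smooth_fun_mult[OF assms(1) smooth_fun_const[of W "-1"] assms(3)]] by simp

lemma smooth_fun_sum:
  assumes "open W" "\<And>i. i \<in> I \<Longrightarrow> smooth_fun A W (f i)"
  shows "smooth_fun A W (\<lambda>x. \<Sum>i\<in>I. f i x)"
  using assms(2)
  by (induction I rule: infinite_finite_induct) (auto intro: smooth_fun_const smooth_fun_add[OF assms(1)])

lemma smooth_fun_sum_list:
  assumes "open W" "\<And>i. i \<in> set is \<Longrightarrow> smooth_fun A W (f i)"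
  shows "smooth_fun A W (\<lambda>x. \<Sum>i\<leftarrow>is. f i x)"
  using assms(2)
  by (induction "is") (auto intro: smooth_fun_const smooth_fun_add[OF assms(1)])

lemma smooth_chart: "(U, c) \<in> A \<Longrightarrow> smooth_fun A U c"
  unfolding smooth_fun_def using transition by blast

lemma smooth_fun_differentiable:
  assumes "smooth_fun A W f" "(U, c) \<in> A" "x \<in> U" "x \<in> W"
  shows "(f \<circ> inv_into U c) differentiable (at (c x))"
  using assms unfolding smooth_fun_def by (auto intro!: smooth_on_imp_differentiable)

text \<open>The support lies in the chart preimage of a closed ball. That set is compact, hence
  closed in the Hausdorff space M, and so extension by zero is smooth: M is covered by the open sets
  \<open>U \<inter> W\<close> and \<open>- K\<close>.\<close>

lemma bump_fun:
  assumes "open W" "x \<in> W"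
  obtains \<beta> K N where "closed K" "K \<subseteq> W" "smooth \<beta>" "\<And>y. y \<notin> K \<Longrightarrow> \<beta> y = (0::real)"
    "open N" "x \<in> N" "N \<subseteq> W" "\<And>y. y \<in> N \<Longrightarrow> \<beta> y = 1"
proof -
  obtain U c where c: "(U, c) \<in> A" "x \<in> U" by (rule chart_at)
  note ch = chart[OF c(1)]
  have "open (c ` (U \<inter> W))" "c x \<in> c ` (U \<inter> W)"
    using open_chart_image[OF c(1) assms(1)] c assms by auto
  then obtain r where r: "r > 0" "cball (c x) r \<subseteq> c ` (U \<inter> W)" by (meson open_contains_cball)
  define K where "K = inv_into U c ` cball (c x) r"
  have KW: "K \<subseteq> U \<inter> W"
    unfolding K_def using r(2) inv_chart[OF c(1)] by (fastforce simp: subset_iff)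
  have "continuous_on (cball (c x) r) (inv_into U c)"
    using ch r(2) by (auto simp: homeomorphism_def intro: continuous_on_subset)
  then have "compact K"
    unfolding K_def using compact_cball_finite_dim[OF model_finite_dim]
    by (rule compact_continuous_image)
  then have closed: "closed K" by (rule compact_imp_closed)
  \<comment> \<open>The squared distance in the chart, since the norm is not smooth at 0.\<close>
  define F where "F y = (c y - c x) \<bullet> (c y - c x)" for y
  \<comment> \<open>Any value strictly between 0 and the square of \<open>r\<close> would do; this
    one makes the bump 1 on the open ball of half the radius.\<close>
  define a where "a = r\<^sup>2 / 4"
  have a: "0 < a" "a < r\<^sup>2" using r(1) by (auto simp: a_def)
  define g where "g t = flat 1 (r\<^sup>2 - t) * inverse (flat 1 (r\<^sup>2 - t) + flat 1 (t - a))" for t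
  define \<beta> where "\<beta> y = (if y \<in> U \<inter> W then g (F y) else 0)" for y
  have oUW: "open (U \<inter> W)" using ch assms(1) by blast
  have cUW: "smooth_fun A (U \<inter> W) (\<lambda>y. c y + - c x)"
    by (intro smooth_fun_add smooth_fun_const oUW smooth_fun_subset[OF smooth_chart[OF c(1)]]) auto
  then have F: "smooth_fun A (U \<inter> W) F"
    using smooth_fun_inner[OF oUW cUW cUW] by (simp add: F_def[abs_def])
  have "smooth_fun A (U \<inter> W) (\<lambda>y. g (F y))"
    unfolding smooth_fun_def
  proof safe
    fix V d assume d: "(V, d) \<in> A"
    have "smooth_on (d ` (V \<inter> (U \<inter> W))) (\<lambda>z. F (inv_into V d z))"
      using F d by (auto simp: smooth_fun_def o_def)
    from bump_on[OF open_chart_image[OF d oUW] this a(2)]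
    show "smooth_on (d ` (V \<inter> (U \<inter> W))) ((\<lambda>y. g (F y)) \<circ> inv_into V d)"
      by (simp add: o_def g_def)
  qed
  then have 1: "smooth_fun A (U \<inter> W) \<beta>"
    by (rule smooth_fun_cong[OF oUW, rotated]) (simp add: \<beta>_def)
  have off: "\<beta> y = 0" if "y \<notin> K" for y
  proof (cases "y \<in> U \<inter> W")
    case True
    have "c y \<notin> cball (c x) r"
    proof
      assume "c y \<in> cball (c x) r"
      then have "inv_into U c (c y) \<in> K" unfolding K_def by blast
      then show False using that True inv_chart[OF c(1)] by auto
    qed
    then have "norm (c y - c x) > r" by (simp add: dist_norm norm_minus_commute)
    then have "F y > r\<^sup>2"
      unfolding F_def power2_norm_eq_inner[symmetric] using r(1) by (intro power_strict_mono) auto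
    then show ?thesis by (simp add: \<beta>_def g_def flat_1)
  qed (auto simp: \<beta>_def)
  have "smooth_fun A (- K) \<beta>"
    by (rule smooth_fun_cong[of _ "\<lambda>_. 0"]) (use closed off smooth_fun_const in auto)
  with 1 have "\<exists>T. open T \<and> y \<in> T \<and> T \<subseteq> UNIV \<and> smooth_fun A T \<beta>" for y
    by (cases "y \<in> K") (use KW oUW closed in \<open>auto intro: exI[of _ "U \<inter> W"] exI[of _ "- K"]\<close>)
  then have smooth: "smooth \<beta>" by (intro smooth_fun_local) auto
  define N where "N = (U \<inter> W) \<inter> F -` {..<a}"
  have cc: "continuous_on (U \<inter> W) c"
    using ch by (auto simp: homeomorphism_def intro: continuous_on_subset)
  have "continuous_on (U \<inter> W) F"
    unfolding F_def[abs_def] by (intro continuous_intros cc)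
  then have N: "open N" unfolding N_def by (intro continuous_open_preimage oUW) auto
  have xN: "x \<in> N" using c assms a by (auto simp: N_def F_def)
  have "\<beta> y = 1" if "y \<in> N" for y
    using that a by (auto simp: N_def \<beta>_def g_def flat_1)
  then show ?thesis
    using that[of K \<beta> N] closed KW smooth off N xN by (auto simp: N_def)
qed

text \<open>The sets \<open>V \<inter> W\<close> and \<open>V - K\<close> cover \<open>V\<close>;
  \<open>h\<close> is a smooth product on one and zero on the other. Functions, sections and forms
  given on a trivialising set are all globalised through this.\<close>

lemma smooth_fun_extend:
  fixes f :: "'m \<Rightarrow> 'z::real_normed_vector"
  assumes "open W" "closed K" "K \<subseteq> W" "smooth \<beta>" "\<And>y. y \<notin> K \<Longrightarrow> \<beta> y = (0::real)"
    and "open V" "smooth_fun A (V \<inter> W) f"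
    and "\<And>y. y \<in> V \<inter> W \<Longrightarrow> h y = \<beta> y *\<^sub>R f y" "\<And>y. y \<in> V - W \<Longrightarrow> h y = 0"
  shows "smooth_fun A V h"
proof (rule smooth_fun_local[OF assms(6)])
  have o: "open (V \<inter> W)" "open (V - K)" using assms by auto
  have 1: "smooth_fun A (V \<inter> W) h"
    by (rule smooth_fun_cong[OF o(1) assms(8)[symmetric] smooth_fun_scaleR[OF o(1) _ assms(7)]])
      (use smooth_fun_subset[OF assms(4)] in auto)
  have 2: "smooth_fun A (V - K) h"
    by (rule smooth_fun_cong[OF o(2) _ smooth_fun_const[of _ 0]]) (use assms in \<open>metis DiffE Diff_iff IntI scale_zero_left\<close>)
  show "\<exists>T. open T \<and> x \<in> T \<and> T \<subseteq> V \<and> smooth_fun A T h" if "x \<in> V" for x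
  proof (cases "x \<in> K")
    case True
    then show ?thesis using o 1 that assms(3) by (intro exI[of _ "V \<inter> W"]) auto
  next
    case False
    then show ?thesis using o 2 that by (intro exI[of _ "V - K"]) auto
  qed
qed

end

section \<open>Sections of vector bundles\<close>

context vector_bundle
begin

abbreviation "\<Gamma> \<equiv> sections A E"
abbreviation "ls \<equiv> local_section E"

lemma triv_at: obtains U \<phi> where "(U, \<phi>) \<in> trivs E" "x \<in> U"
proof -
  have "x \<in> (\<Union>(U, \<phi>)\<in>trivs E. U)" unfolding trivs_cover by simp
  then show thesis by (auto intro: that)
qed

lemma ls_fibre: "(U, \<phi>) \<in> trivs E \<Longrightarrow> x \<in> U \<Longrightarrow> ls \<phi> w x \<in> fibre E x"
  using triv_bij[of U \<phi> x] unfolding local_section_def bij_betw_def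
  by (metis UNIV_I inv_into_into)

lemma triv_ls: "(U, \<phi>) \<in> trivs E \<Longrightarrow> x \<in> U \<Longrightarrow> \<phi> (ls \<phi> w x) = w"
  using triv_bij[of U \<phi> x] unfolding local_section_def bij_betw_def
  by (metis UNIV_I f_inv_into_f)

lemma ls_triv: "(U, \<phi>) \<in> trivs E \<Longrightarrow> x \<in> U \<Longrightarrow> v \<in> fibre E x \<Longrightarrow> ls \<phi> (\<phi> v) x = v"
  using triv_bij[of U \<phi> x] unfolding local_section_def bij_betw_def
  by (metis inv_into_f_f)

lemma fibre_eqI:
  "(U, \<phi>) \<in> trivs E \<Longrightarrow> x \<in> U \<Longrightarrow> u \<in> fibre E x \<Longrightarrow> v \<in> fibre E x \<Longrightarrow> \<phi> u = \<phi> v \<Longrightarrow> u = v"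
  by (metis ls_triv)

lemma ls_add: "(U, \<phi>) \<in> trivs E \<Longrightarrow> x \<in> U \<Longrightarrow> ls \<phi> (v + w) x = vadd E (ls \<phi> v x) (ls \<phi> w x)"
  by (rule fibre_eqI[of U \<phi> x]) (auto simp: ls_fibre vadd_closed triv_ls triv_add)

lemma ls_scale: "(U, \<phi>) \<in> trivs E \<Longrightarrow> x \<in> U \<Longrightarrow> ls \<phi> (a *\<^sub>R w) x = vscale E a (ls \<phi> w x)"
  by (rule fibre_eqI[of U \<phi> x]) (auto simp: ls_fibre vscale_closed triv_ls triv_scale)

text \<open>A linear map out of a fibre is determined by its frame values, with coefficients linear
  in the vector. Applied slot by slot, this carries smoothness from constant local sections, where
  it is assumed, to all sections.\<close>

lemma fibre_expansion:
  fixes L :: "'e \<Rightarrow> 'z::real_vector"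
  assumes "(U, \<phi>) \<in> trivs E" "x \<in> U" "v \<in> fibre E x"
    and "\<And>u v. u \<in> fibre E x \<Longrightarrow> v \<in> fibre E x \<Longrightarrow> L (vadd E u v) = L u + L v"
    and "\<And>u a. u \<in> fibre E x \<Longrightarrow> L (vscale E a u) = a *\<^sub>R L u"
  shows "L v = (\<Sum>b\<in>frame. coord b (\<phi> v) *\<^sub>R L (ls \<phi> b x))"
proof -
  have "linear (\<lambda>w. L (ls \<phi> w x))"
    by (rule linearI) (use assms in \<open>simp_all add: ls_add ls_scale ls_fibre\<close>)
  from linear_sum_coord[OF fibre_finite_dim this, of "\<phi> v"] show ?thesis
    by (simp add: ls_triv[OF assms(1-3)])
qed

lemma sections_fibre: "s \<in> \<Gamma> \<Longrightarrow> s x \<in> fibre E x"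
  by (simp add: sections_def)

lemma sections_smooth: "s \<in> \<Gamma> \<Longrightarrow> (U, \<phi>) \<in> trivs E \<Longrightarrow> smooth_fun A U (\<lambda>x. \<phi> (s x))"
  by (auto simp: sections_def)

text \<open>The bundle axioms give the vector space laws of a fibre only through trivialisations, so
  identities between sections are checked there.\<close>

lemma sec_eqI:
  assumes "\<And>x. s x \<in> fibre E x" "\<And>x. t x \<in> fibre E x"
    and "\<And>U \<phi> x. (U, \<phi>) \<in> trivs E \<Longrightarrow> x \<in> U \<Longrightarrow> \<phi> (s x) = \<phi> (t x)"
  shows "s = t"
proof
  fix x
  obtain U \<phi> where "(U, \<phi>) \<in> trivs E" "x \<in> U" by (rule triv_at)
  then show "s x = t x" using assms fibre_eqI by blast
qed

lemma sec_add_closed: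
  assumes "s \<in> \<Gamma>" "t \<in> \<Gamma>"
  shows "sec_add E s t \<in> \<Gamma>"
proof -
  have "smooth_fun A U (\<lambda>x. \<phi> (sec_add E s t x))" if "(U, \<phi>) \<in> trivs E" for U \<phi>
    by (rule smooth_fun_cong[OF _ _ smooth_fun_add[of U "\<lambda>x. \<phi> (s x)" "\<lambda>x. \<phi> (t x)"]])
      (use that assms in \<open>auto simp: sec_add_def triv_add sections_fibre sections_smooth triv_open\<close>)
  then show ?thesis using assms by (auto simp: sections_def sec_add_def vadd_closed)
qed

lemma sec_scale_closed:
  assumes "smooth f" "s \<in> \<Gamma>"
  shows "sec_scale E f s \<in> \<Gamma>"
proof -
  have "smooth_fun A U (\<lambda>x. \<phi> (sec_scale E f s x))" if "(U, \<phi>) \<in> trivs E" for U \<phi>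
    by (rule smooth_fun_cong[OF _ _ smooth_fun_scaleR[of U f "\<lambda>x. \<phi> (s x)"]])
      (use that assms smooth_fun_subset[OF assms(1)] in
        \<open>auto simp: sec_scale_def triv_scale sections_fibre sections_smooth triv_open\<close>)
  then show ?thesis using assms by (auto simp: sections_def sec_scale_def vscale_closed)
qed

text \<open>Off \<open>U\<close> the value \<open>ls \<phi> w y\<close> has no meaning, hence the
  zero vector; with \<beta> supported in \<open>U\<close> the result is a global section that equals
  the constant local section where \<beta> is 1.\<close>

definition cutoff :: "'m set \<Rightarrow> ('e \<Rightarrow> 'c) \<Rightarrow> ('m \<Rightarrow> real) \<Rightarrow> 'c \<Rightarrow> 'm \<Rightarrow> 'e" where
  "cutoff U \<phi> \<beta> w y = (if y \<in> U then vscale E (\<beta> y) (ls \<phi> w y) else vzero E y)"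

lemma cutoff_section:
  assumes "(U, \<phi>) \<in> trivs E" "closed K" "K \<subseteq> U" "smooth \<beta>" "\<And>y. y \<notin> K \<Longrightarrow> \<beta> y = 0"
  shows "cutoff U \<phi> \<beta> w \<in> \<Gamma>"
proof -
  have "smooth_fun A V (\<lambda>y. \<psi> (cutoff U \<phi> \<beta> w y))" if \<psi>: "(V, \<psi>) \<in> trivs E" for V \<psi>
    by (rule smooth_fun_extend[OF triv_open[OF assms(1)] assms(2-5) triv_open[OF \<psi>],
          of "\<lambda>y. \<psi> (ls \<phi> w y)"])
      (use assms \<psi> triv_transition[OF assms(1) \<psi>] in
        \<open>auto simp: cutoff_def triv_scale[OF \<psi>] ls_fibre triv_zero Int_commute\<close>)
  then show ?thesis
    using assms(1) by (auto simp: sections_def cutoff_def vzero_closed vscale_closed ls_fibre)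
qed

lemma cutoff_eq:
  assumes "(U, \<phi>) \<in> trivs E" "y \<in> U" "\<beta> y = 1"
  shows "cutoff U \<phi> \<beta> w y = ls \<phi> w y"
  by (rule fibre_eqI[OF assms(1,2)])
    (use assms in \<open>auto simp: cutoff_def vscale_closed ls_fibre triv_scale\<close>)

lemma section_through:
  assumes "v \<in> fibre E x"
  obtains V where "V \<in> \<Gamma>" "V x = v"
proof -
  obtain U \<phi> where U: "(U, \<phi>) \<in> trivs E" "x \<in> U" by (rule triv_at)
  obtain \<beta> K N where "closed K" "K \<subseteq> U" "smooth \<beta>" "\<And>y. y \<notin> K \<Longrightarrow> \<beta> y = (0::real)"
    "x \<in> N" "\<And>y. y \<in> N \<Longrightarrow> \<beta> y = 1" by (rule bump_fun[OF triv_open[OF U(1)] U(2)]) blast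
  then have "cutoff U \<phi> \<beta> (\<phi> v) \<in> \<Gamma>" "cutoff U \<phi> \<beta> (\<phi> v) x = v"
    using cutoff_section[OF U(1)] cutoff_eq[OF U] ls_triv[OF U assms] by simp_all
  then show ?thesis by (rule that)
qed

end

section \<open>Lie derivatives of functions\<close>

context smooth_manifold
begin

text \<open>\<open>lie_deriv\<close> selects a chart separately at every point. The transformation
  law of tangent vectors and the chain rule move the computation to a prescribed chart, which
  smoothness and locality arguments need.\<close>

lemma lie_deriv_chart:
  assumes "snd (X x) \<in> tangent_space A x" "smooth f" "(U, c) \<in> A" "x \<in> U"
  shows "lie_deriv A X f x = frechet_derivative (f \<circ> inv_into U c) (at (c x)) (snd (X x) (U, c))"
proof -
  obtain V d where Vd: "(SOME c. c \<in> A \<and> x \<in> fst c) = (V, d)" by fastforce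
  have "\<exists>c. c \<in> A \<and> x \<in> fst c" using assms by auto
  from someI_ex[OF this] have d: "(V, d) \<in> A" "x \<in> V" by (simp_all add: Vd)
  have diff: "(d \<circ> inv_into U c) differentiable at (c x)"
    by (rule smooth_fun_differentiable[OF smooth_chart[OF d(1)] assms(3,4) d(2)])
  have val: "(d \<circ> inv_into U c) (c x) = d x" by (simp add: inv_chart[OF assms(3,4)])
  have difff: "(f \<circ> inv_into V d) differentiable at ((d \<circ> inv_into U c) (c x))"
    unfolding val by (rule smooth_fun_differentiable[OF assms(2) d]) simp
  have "lie_deriv A X f x = frechet_derivative (f \<circ> inv_into V d) (at (d x)) (snd (X x) (V, d))"
    by (simp add: lie_deriv_def Vd)
  also have "snd (X x) (V, d) = frechet_derivative (d \<circ> inv_into U c) (at (c x)) (snd (X x) (U, c))"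
    using assms(1,3,4) d unfolding tangent_space_def by blast
  also have "frechet_derivative (f \<circ> inv_into V d) (at (d x)) \<dots> =
      frechet_derivative ((f \<circ> inv_into V d) \<circ> (d \<circ> inv_into U c)) (at (c x)) (snd (X x) (U, c))"
    unfolding frechet_derivative_compose[OF diff difff] val by simp
  also have "frechet_derivative ((f \<circ> inv_into V d) \<circ> (d \<circ> inv_into U c)) (at (c x)) =
      frechet_derivative (f \<circ> inv_into U c) (at (c x))"
  proof (rule frechet_derivative_transform_within_open)
    show "(f \<circ> inv_into V d) \<circ> (d \<circ> inv_into U c) differentiable at (c x)"
      by (rule differentiable_chain_at[OF diff difff])
    show "open (c ` (U \<inter> V))" using open_chart_image[OF assms(3)] chart[OF d(1)] by blast
    show "c x \<in> c ` (U \<inter> V)" using assms d by blast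
    show "((f \<circ> inv_into V d) \<circ> (d \<circ> inv_into U c)) z = (f \<circ> inv_into U c) z"
      if "z \<in> c ` (U \<inter> V)" for z
      using that by (auto simp: inv_chart[OF assms(3)] inv_chart[OF d(1)])
  qed
  finally show ?thesis .
qed

end

context lie_algebroid
begin

abbreviation LD :: "('m \<Rightarrow> 'e) \<Rightarrow> ('m \<Rightarrow> real) \<Rightarrow> 'm \<Rightarrow> real" where
  "LD V f \<equiv> lie_deriv A (\<rho> \<circ> V) f"

lemma anchor_fibre:
  assumes "u \<in> fibre E x"
  shows "\<rho> u \<in> fibre (tangent_bundle A) x"
    and "v \<in> fibre E x \<Longrightarrow> snd (\<rho> (vadd E u v)) c = snd (\<rho> u) c + snd (\<rho> v) c"
    and "snd (\<rho> (vscale E a u)) c = a *\<^sub>R snd (\<rho> u) c"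
  using anchor assms
  by (auto simp: bundle_map_def tangent_bundle_def case_prod_unfold)

lemma anchor_tangent: "u \<in> fibre E x \<Longrightarrow> snd (\<rho> u) \<in> tangent_space A x"
  using anchor_fibre(1)[of u x] by (auto simp: fibre_def tangent_bundle_def)

lemma LD_chart:
  assumes "V \<in> \<Gamma>" "smooth f" "(U, c) \<in> A" "x \<in> U"
  shows "LD V f x = frechet_derivative (f \<circ> inv_into U c) (at (c x)) (snd (\<rho> (V x)) (U, c))"
  using lie_deriv_chart[of "\<rho> \<circ> V" x f U c] assms anchor_tangent[OF sections_fibre[OF assms(1)]]
  by simp

text \<open>A bundle map is required to be smooth on constant local sections only, so
  \<open>V\<close> is expanded in the local frame first.\<close>

lemma smooth_anchor_section:
  assumes "V \<in> \<Gamma>" "(U, c) \<in> A"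
  shows "smooth_fun A U (\<lambda>x. snd (\<rho> (V x)) (U, c))"
proof (rule smooth_fun_local)
  show oU: "open U" using chart[OF assms(2)] by blast
  fix x assume "x \<in> U"
  obtain W \<phi> where W: "(W, \<phi>) \<in> trivs E" "x \<in> W" by (rule triv_at)
  have o: "open (W \<inter> U)" using oU triv_open[OF W(1)] by blast
  have "(U, \<lambda>v. snd v (U, c)) \<in> trivs (tangent_bundle A)"
    using assms(2) by (force simp: tangent_bundle_def)
  then have "smooth_fun A (W \<inter> U) (\<lambda>x. snd (\<rho> (ls \<phi> b x)) (U, c))" for b
    using anchor W(1) unfolding bundle_map_def by fast
  moreover have "smooth_fun A (W \<inter> U) (\<lambda>x. coord b (\<phi> (V x)))" for b
    by (rule smooth_fun_linear[OF o bounded_linear_coord[OF fibre_finite_dim]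
          smooth_fun_subset[OF sections_smooth[OF assms(1) W(1)]]]) auto
  ultimately have "smooth_fun A (W \<inter> U)
      (\<lambda>x. \<Sum>b\<in>frame. coord b (\<phi> (V x)) *\<^sub>R snd (\<rho> (ls \<phi> b x)) (U, c))"
    by (intro smooth_fun_sum o smooth_fun_scaleR)
  then have "smooth_fun A (W \<inter> U) (\<lambda>x. snd (\<rho> (V x)) (U, c))"
  proof (rule smooth_fun_cong[OF o, rotated])
    fix y assume "y \<in> W \<inter> U"
    then show "(\<Sum>b\<in>frame. coord b (\<phi> (V y)) *\<^sub>R snd (\<rho> (ls \<phi> b y)) (U, c)) = snd (\<rho> (V y)) (U, c)"
      by (intro fibre_expansion[symmetric, OF W(1)]) (auto simp: sections_fibre[OF assms(1)] anchor_fibre)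
  qed
  then show "\<exists>T. open T \<and> x \<in> T \<and> T \<subseteq> U \<and> smooth_fun A T (\<lambda>x. snd (\<rho> (V x)) (U, c))"
    using o W(2) \<open>x \<in> U\<close> by (intro exI[of _ "W \<inter> U"]) auto
qed

text \<open>\<open>smooth_on\<close> speaks of derivatives in fixed directions, while here the
  direction varies with the point; expanding it in coordinates leaves finitely many fixed directions
  with smooth coefficients.\<close>

lemma LD_smooth:
  assumes "V \<in> \<Gamma>" "smooth f"
  shows "smooth (LD V f)"
  unfolding smooth_fun_def
proof safe
  fix U c assume c: "(U, c) \<in> A"
  let ?f = "f \<circ> inv_into U c" and ?v = "(\<lambda>x. snd (\<rho> (V x)) (U, c)) \<circ> inv_into U c"
  have o: "open (c ` U)" using chart[OF c] by blast
  have f: "smooth_on (c ` U) ?f" using assms(2) c by (auto simp: smooth_fun_def)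
  have "smooth_on (c ` U) ?v"
    using smooth_anchor_section[OF assms(1) c] c by (auto simp: smooth_fun_def)
  then have 1: "smooth_on (c ` U) (\<lambda>z. coord b (?v z))" for b
    by (rule smooth_on_linear[OF o bounded_linear_coord[OF model_finite_dim]])
  have "smooth_on (c ` U) (\<lambda>z. \<Sum>b\<in>I. coord b (?v z) * frechet_derivative ?f (at z) b)" for I
  proof (induction I rule: infinite_finite_induct)
    case (insert b I)
    have "smooth_on (c ` U) (\<lambda>z. coord b (?v z) * frechet_derivative ?f (at z) b +
        (\<Sum>b\<in>I. coord b (?v z) * frechet_derivative ?f (at z) b))"
      by (intro smooth_on_add[OF o] smooth_on_bilinear[OF o bounded_bilinear_mult] 1
          smooth_on_frechet_derivative f insert.IH)
    then show ?case by (simp only: sum.insert[OF insert.hyps])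
  qed (simp_all add: smooth_on_const)
  then have "smooth_on (c ` U) (\<lambda>z. \<Sum>b\<in>frame. coord b (?v z) * frechet_derivative ?f (at z) b)" .
  then have "smooth_on (c ` U) (LD V f \<circ> inv_into U c)"
  proof (rule smooth_on_cong[OF o, rotated])
    fix z assume "z \<in> c ` U"
    then obtain x where x: "x \<in> U" "z = c x" by blast
    have "linear (frechet_derivative ?f (at z))"
      by (rule linear_frechet_derivative) (use smooth_on_imp_differentiable[OF f] x in blast)
    from linear_sum_coord[OF model_finite_dim this, of "?v z"]
    show "(\<Sum>b\<in>frame. coord b (?v z) * frechet_derivative ?f (at z) b) = (LD V f \<circ> inv_into U c) z"
      using LD_chart[OF assms c x(1)] by (simp add: x inv_chart[OF c])
  qed
  then show "smooth_on (c ` (U \<inter> UNIV)) (LD V f \<circ> inv_into U c)" by simp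
qed

lemma LD_cong:
  assumes "V \<in> \<Gamma>" "smooth f" "smooth g" "open N" "x \<in> N" "\<And>y. y \<in> N \<Longrightarrow> f y = g y"
  shows "LD V f x = LD V g x"
proof -
  obtain U c where c: "(U, c) \<in> A" "x \<in> U" by (rule chart_at)
  have "frechet_derivative (f \<circ> inv_into U c) (at (c x)) = frechet_derivative (g \<circ> inv_into U c) (at (c x))"
    by (rule frechet_derivative_transform_within_open[of _ _ "c ` (U \<inter> N)"])
      (use c assms smooth_fun_differentiable[OF assms(2) c] open_chart_image[OF c(1) assms(4)] in
        \<open>auto simp: inv_chart\<close>)
  then show ?thesis using LD_chart c assms by simp
qed

lemma LD_const: assumes "V \<in> \<Gamma>" shows "LD V (\<lambda>_. k) x = 0"
proof -
  obtain U c where c: "(U, c) \<in> A" "x \<in> U" by (rule chart_at)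
  show ?thesis using LD_chart[OF assms smooth_fun_const c] by (simp add: o_def)
qed

lemma LD_add:
  assumes "V \<in> \<Gamma>" "smooth f" "smooth g"
  shows "LD V (\<lambda>y. f y + g y) x = LD V f x + LD V g x"
proof -
  obtain U c where c: "(U, c) \<in> A" "x \<in> U" by (rule chart_at)
  have fg: "smooth (\<lambda>y. f y + g y)" using assms by (intro smooth_fun_add) auto
  note d = smooth_fun_differentiable[OF _ c, of UNIV, simplified, unfolded frechet_derivative_works]
  show ?thesis
    using frechet_derivative_at[OF has_derivative_add[OF d[OF assms(2)] d[OF assms(3)]], symmetric]
    unfolding LD_chart[OF assms(1) fg c] LD_chart[OF assms(1,2) c] LD_chart[OF assms(1,3) c]
    by (simp add: o_def)
qed

lemma LD_mult:
  assumes "V \<in> \<Gamma>" "smooth f" "smooth g"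
  shows "LD V (\<lambda>y. f y * g y) x = f x * LD V g x + LD V f x * g x"
proof -
  obtain U c where c: "(U, c) \<in> A" "x \<in> U" by (rule chart_at)
  have fg: "smooth (\<lambda>y. f y * g y)" using assms by (intro smooth_fun_mult) auto
  note d = smooth_fun_differentiable[OF _ c, of UNIV, simplified, unfolded frechet_derivative_works]
  show ?thesis
    using frechet_derivative_at[OF has_derivative_mult[OF d[OF assms(2)] d[OF assms(3)]], symmetric]
    unfolding LD_chart[OF assms(1) fg c] LD_chart[OF assms(1,2) c] LD_chart[OF assms(1,3) c]
    by (simp add: o_def inv_chart[OF c])
qed

lemma LD_sec_add:
  assumes "V \<in> \<Gamma>" "W \<in> \<Gamma>" "smooth f"
  shows "LD (sec_add E V W) f x = LD V f x + LD W f x"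
proof -
  obtain U c where c: "(U, c) \<in> A" "x \<in> U" by (rule chart_at)
  have "linear (frechet_derivative (f \<circ> inv_into U c) (at (c x)))"
    using smooth_fun_differentiable[OF assms(3) c] by (intro linear_frechet_derivative) auto
  then show ?thesis
    using LD_chart[OF _ assms(3) c] assms sec_add_closed[OF assms(1,2)] anchor_fibre(2)[OF sections_fibre sections_fibre]
    by (simp add: sec_add_def linear_add)
qed

lemma LD_sec_scale:
  assumes "V \<in> \<Gamma>" "smooth g" "smooth f"
  shows "LD (sec_scale E g V) f x = g x * LD V f x"
proof -
  obtain U c where c: "(U, c) \<in> A" "x \<in> U" by (rule chart_at)
  have "linear (frechet_derivative (f \<circ> inv_into U c) (at (c x)))"
    using smooth_fun_differentiable[OF assms(3) c] by (intro linear_frechet_derivative) auto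
  then show ?thesis
    using LD_chart[OF _ assms(3) c] assms sec_scale_closed[OF assms(2,1)] anchor_fibre(3)[OF sections_fibre]
    by (simp add: sec_scale_def linear_scale)
qed

end

section \<open>Forms\<close>

context vector_bundle
begin

lemma ext_formsD:
  assumes "\<alpha> \<in> ext_forms E x"
  shows ext_supp: "\<not> set vs \<subseteq> fibre E x \<Longrightarrow> \<alpha> vs = 0"
    and ext_add: "set us \<union> {u, v} \<union> set ws \<subseteq> fibre E x \<Longrightarrow>
        \<alpha> (us @ vadd E u v # ws) = \<alpha> (us @ u # ws) + \<alpha> (us @ v # ws)"
    and ext_scale: "set us \<union> {u} \<union> set ws \<subseteq> fibre E x \<Longrightarrow>
        \<alpha> (us @ vscale E a u # ws) = a * \<alpha> (us @ u # ws)"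
    and ext_alt: "\<alpha> (us @ v # vs @ v # ws) = 0"
  using assms by (simp_all add: ext_forms_def)

lemma ext_formsI:
  assumes "\<And>vs. \<not> set vs \<subseteq> fibre E x \<Longrightarrow> \<alpha> vs = 0"
    and "\<And>us u v ws. set us \<union> {u, v} \<union> set ws \<subseteq> fibre E x \<Longrightarrow>
        \<alpha> (us @ vadd E u v # ws) = \<alpha> (us @ u # ws) + \<alpha> (us @ v # ws)"
    and "\<And>us u a ws. set us \<union> {u} \<union> set ws \<subseteq> fibre E x \<Longrightarrow>
        \<alpha> (us @ vscale E a u # ws) = a * \<alpha> (us @ u # ws)"
    and "\<And>us v vs ws. set us \<union> {v} \<union> set vs \<union> set ws \<subseteq> fibre E x \<Longrightarrow>
        \<alpha> (us @ v # vs @ v # ws) = 0"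
    and "\<And>vs. N < length vs \<Longrightarrow> \<alpha> vs = 0"
  shows "\<alpha> \<in> ext_forms E x"
proof -
  have alt: "\<alpha> (us @ v # vs @ v # ws) = 0" for us v vs ws
    using assms(4)[of us v vs ws] assms(1)[of "us @ v # vs @ v # ws"] by fastforce
  show ?thesis unfolding ext_forms_def mem_Collect_eq
    by (intro conjI allI impI exI[of _ N]) (erule assms(1,2,3,5) | rule alt)+
qed

lemma ext_forms_bounded:
  assumes "\<alpha> \<in> ext_forms E x"
  obtains N where "\<And>vs. N < length vs \<Longrightarrow> \<alpha> vs = 0"
  using assms unfolding ext_forms_def by blast

lemma ext_zero: "(\<lambda>vs. 0) \<in> ext_forms E x"
  by (simp add: ext_forms_def)

lemma ext_combine:
  assumes "\<alpha> \<in> ext_forms E x" "\<beta> \<in> ext_forms E x"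
  shows "(\<lambda>vs. a * \<alpha> vs + b * \<beta> vs) \<in> ext_forms E x"
proof -
  obtain N M where "\<And>vs. N < length vs \<Longrightarrow> \<alpha> vs = 0" "\<And>vs. M < length vs \<Longrightarrow> \<beta> vs = 0"
    using assms by (metis ext_forms_bounded)
  then show ?thesis
    by (intro ext_formsI[of _ _ "max N M"])
      (use assms in \<open>simp_all add: ext_supp ext_add ext_scale ext_alt algebra_simps\<close>)
qed

text \<open>Polarisation: expand the vanishing value with the sum of \<open>u\<close> and
  \<open>v\<close> in both slots. Off the fibre both sides vanish by the support condition.\<close>

lemma ext_swap:
  assumes "\<alpha> \<in> ext_forms E x"
  shows "\<alpha> (us @ u # vs @ v # ws) = - \<alpha> (us @ v # vs @ u # ws)"
proof (cases "set us \<union> {u, v} \<union> set vs \<union> set ws \<subseteq> fibre E x")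
  case True
  then have uv: "vadd E u v \<in> fibre E x" by (simp add: vadd_closed)
  have "0 = \<alpha> (us @ vadd E u v # vs @ vadd E u v # ws)" by (rule ext_alt[OF assms, symmetric])
  also have "\<dots> = \<alpha> (us @ u # vs @ u # ws) + \<alpha> (us @ u # vs @ v # ws) +
      (\<alpha> (us @ v # vs @ u # ws) + \<alpha> (us @ v # vs @ v # ws))"
    using True uv ext_add[OF assms, of us u v "vs @ vadd E u v # ws"]
      ext_add[OF assms, of "us @ u # vs" u v ws] ext_add[OF assms, of "us @ v # vs" u v ws] by simp
  finally show ?thesis by (simp only: ext_alt[OF assms])
next
  case False
  then have "\<not> set (us @ u # vs @ v # ws) \<subseteq> fibre E x" "\<not> set (us @ v # vs @ u # ws) \<subseteq> fibre E x"
    by auto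
  then show ?thesis using ext_supp[OF assms] by simp
qed

lemma ext_move:
  assumes "\<alpha> \<in> ext_forms E x"
  shows "\<alpha> (us @ v # ws) = (- 1) ^ length us * \<alpha> (v # us @ ws)"
proof (induction us arbitrary: ws rule: rev_induct)
  case (snoc u us)
  then show ?case using ext_swap[OF assms, of us u "[]" v ws] by simp
qed simp

lemma formsD:
  assumes "\<eta> \<in> forms A E"
  shows forms_ext: "\<eta> x \<in> ext_forms E x"
    and forms_ls: "(U, \<phi>) \<in> trivs E \<Longrightarrow> smooth_fun A U (\<lambda>x. \<eta> x (map (\<lambda>w. ls \<phi> w x) ws))"
  using assms by (auto simp: forms_def)

lemma forms_bounded:
  assumes "\<eta> \<in> forms A E"
  obtains N where "\<And>x vs. N < length vs \<Longrightarrow> \<eta> x vs = 0"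
  using assms unfolding forms_def by blast

lemma formsI:
  assumes "\<And>x. \<eta> x \<in> ext_forms E x" "\<And>x vs. N < length vs \<Longrightarrow> \<eta> x vs = 0"
    and "\<And>U \<phi> ws. (U, \<phi>) \<in> trivs E \<Longrightarrow> smooth_fun A U (\<lambda>x. \<eta> x (map (\<lambda>w. ls \<phi> w x) ws))"
  shows "\<eta> \<in> forms A E"
  using assms unfolding forms_def by blast

text \<open>Covers restrictions of global sections and constant local sections alike, since both
  occur together as arguments of a form.\<close>

definition local_sec :: "('e \<Rightarrow> 'c) \<Rightarrow> 'm set \<Rightarrow> ('m \<Rightarrow> 'e) \<Rightarrow> bool" where
  "local_sec \<phi> W u \<longleftrightarrow> (\<forall>y\<in>W. u y \<in> fibre E y) \<and> smooth_fun A W (\<lambda>y. \<phi> (u y))"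

lemma local_sec_section: "(U, \<phi>) \<in> trivs E \<Longrightarrow> W \<subseteq> U \<Longrightarrow> V \<in> \<Gamma> \<Longrightarrow> local_sec \<phi> W V"
  by (auto simp: local_sec_def sections_fibre intro: smooth_fun_subset sections_smooth)

lemma local_sec_ls:
  assumes "(U, \<phi>) \<in> trivs E" "open W" "W \<subseteq> U"
  shows "local_sec \<phi> W (ls \<phi> w)"
proof -
  have "smooth_fun A W (\<lambda>y. \<phi> (ls \<phi> w y))"
    by (rule smooth_fun_cong[OF assms(2) _ smooth_fun_const[of _ w]]) (use assms(3) in \<open>auto simp: subset_iff triv_ls[OF assms(1)]\<close>)
  then show ?thesis using assms ls_fibre by (auto simp: local_sec_def)
qed

lemma forms_smooth_local:
  assumes "(U, \<phi>) \<in> trivs E" "open W" "W \<subseteq> U" "\<eta> \<in> forms A E" "\<And>u. u \<in> set us \<Longrightarrow> local_sec \<phi> W u"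
  shows "smooth_fun A W (\<lambda>y. \<eta> y (map (\<lambda>u. u y) us))"
proof -
  \<comment> \<open>Arguments are replaced by frame vectors from the left; \<open>ws\<close>
    collects those already replaced, and membership in \<open>forms\<close> settles the end of the
    induction.\<close>
  have "smooth_fun A W (\<lambda>y. \<eta> y (map (\<lambda>w. ls \<phi> w y) ws @ map (\<lambda>u. u y) us))" for ws
    using assms(5)
  proof (induction us arbitrary: ws)
    case Nil
    then show ?case using forms_ls[OF assms(4,1)] assms(3) by (auto intro: smooth_fun_subset)
  next
    case (Cons u us)
    have u: "\<And>y. y \<in> W \<Longrightarrow> u y \<in> fibre E y" "smooth_fun A W (\<lambda>y. \<phi> (u y))"
      using Cons.prems[of u] by (simp_all add: local_sec_def)
    have co: "smooth_fun A W (\<lambda>y. coord b (\<phi> (u y)))" for b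
      by (rule smooth_fun_linear[OF assms(2) bounded_linear_coord[OF fibre_finite_dim] u(2)])
    have "smooth_fun A W (\<lambda>y. \<Sum>b\<in>frame. coord b (\<phi> (u y)) *
        \<eta> y (map (\<lambda>w. ls \<phi> w y) (ws @ [b]) @ map (\<lambda>u. u y) us))"
      by (intro smooth_fun_sum smooth_fun_mult assms(2) co Cons.IH) (use Cons.prems in simp)
    then show ?case
    proof (rule smooth_fun_cong[OF assms(2), rotated])
      fix y assume y: "y \<in> W"
      with assms(3) have yU: "y \<in> U" by blast
      have 1: "set (map (\<lambda>w. ls \<phi> w y) ws) \<subseteq> fibre E y" using ls_fibre[OF assms(1) yU] by auto
      have 2: "set (map (\<lambda>u. u y) us) \<subseteq> fibre E y" using Cons.prems y by (auto simp: local_sec_def)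
      have "\<eta> y (map (\<lambda>w. ls \<phi> w y) ws @ u y # map (\<lambda>u. u y) us) =
        (\<Sum>b\<in>frame. coord b (\<phi> (u y)) *\<^sub>R
            \<eta> y (map (\<lambda>w. ls \<phi> w y) ws @ ls \<phi> b y # map (\<lambda>u. u y) us))"
        by (rule fibre_expansion[OF assms(1) yU u(1)[OF y]])
          (use 1 2 in \<open>simp_all add: ext_add[OF forms_ext[OF assms(4)]] ext_scale[OF forms_ext[OF assms(4)]]\<close>)
      then show "(\<Sum>b\<in>frame. coord b (\<phi> (u y)) *
        \<eta> y (map (\<lambda>w. ls \<phi> w y) (ws @ [b]) @ map (\<lambda>u. u y) us)) =
        \<eta> y (map (\<lambda>w. ls \<phi> w y) ws @ map (\<lambda>u. u y) (u # us))" by simp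
    qed
  qed
  from this[of "[]"] show ?thesis by simp
qed

lemma forms_smooth:
  assumes "\<eta> \<in> forms A E" "set Vs \<subseteq> \<Gamma>"
  shows "smooth (\<lambda>y. \<eta> y (map (\<lambda>V. V y) Vs))"
proof (rule smooth_fun_local)
  fix x
  obtain U \<phi> where U: "(U, \<phi>) \<in> trivs E" "x \<in> U" by (rule triv_at)
  have "smooth_fun A U (\<lambda>y. \<eta> y (map (\<lambda>V. V y) Vs))"
    by (rule forms_smooth_local[OF U(1) triv_open[OF U(1)] subset_refl assms(1)])
      (use local_sec_section[OF U(1) subset_refl] assms(2) in blast)
  then show "\<exists>T. open T \<and> x \<in> T \<and> T \<subseteq> UNIV \<and> smooth_fun A T (\<lambda>y. \<eta> y (map (\<lambda>V. V y) Vs))"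
    using U triv_open by blast
qed simp

lemma sections_through:
  assumes "set vs \<subseteq> fibre E x"
  obtains Vs where "set Vs \<subseteq> \<Gamma>" "map (\<lambda>V. V x) Vs = vs"
  using assms
proof (induction vs arbitrary: thesis)
  case (Cons v vs)
  obtain Vs where "set Vs \<subseteq> \<Gamma>" "map (\<lambda>V. V x) Vs = vs"
    using Cons.IH Cons.prems(2) by auto
  moreover obtain V where "V \<in> \<Gamma>" "V x = v" using section_through Cons.prems(2) by auto
  ultimately show ?case using Cons.prems(1)[of "V # Vs"] by simp
qed simp

lemma forms_eqI:
  assumes "\<omega> \<in> forms A E" "\<omega>' \<in> forms A E"
    and "\<And>Vs x. set Vs \<subseteq> \<Gamma> \<Longrightarrow> \<omega> x (map (\<lambda>V. V x) Vs) = \<omega>' x (map (\<lambda>V. V x) Vs)"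
  shows "\<omega> = \<omega>'"
proof (intro ext)
  fix x vs
  show "\<omega> x vs = \<omega>' x vs"
  proof (cases "set vs \<subseteq> fibre E x")
    case True
    then obtain Vs where "set Vs \<subseteq> \<Gamma>" "map (\<lambda>V. V x) Vs = vs" by (rule sections_through)
    then show ?thesis using assms(3) by blast
  next
    case False
    then show ?thesis using assms by (simp add: ext_supp[OF forms_ext])
  qed
qed

lemma forms_combine:
  assumes "\<eta> \<in> forms A E" "\<omega> \<in> forms A E" "smooth f" "smooth g"
  shows "(\<lambda>x vs. f x * \<eta> x vs + g x * \<omega> x vs) \<in> forms A E"
proof -
  obtain N M where "\<And>x vs. N < length vs \<Longrightarrow> \<eta> x vs = 0" "\<And>x vs. M < length vs \<Longrightarrow> \<omega> x vs = 0"
    using assms by (metis forms_bounded)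
  then have "f x * \<eta> x vs + g x * \<omega> x vs = 0" if "max N M < length vs" for x vs using that by simp
  moreover have "(\<lambda>vs. f x * \<eta> x vs + g x * \<omega> x vs) \<in> ext_forms E x" for x
    by (intro ext_combine forms_ext assms)
  moreover have "smooth_fun A U (\<lambda>x. f x * \<eta> x (map (\<lambda>w. ls \<phi> w x) ws) + g x * \<omega> x (map (\<lambda>w. ls \<phi> w x) ws))"
    if "(U, \<phi>) \<in> trivs E" for U \<phi> ws
    using that triv_open[OF that] assms
    by (intro smooth_fun_add smooth_fun_mult) (auto intro: forms_ls smooth_fun_subset)
  ultimately show ?thesis by (intro formsI[of _ "max N M"]) auto
qed

lemma forms_zero: "(\<lambda>x vs. 0) \<in> forms A E"
  by (rule formsI[of _ 0]) (simp_all add: ext_zero smooth_fun_const)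

lemma forms_scale: "\<eta> \<in> forms A E \<Longrightarrow> smooth f \<Longrightarrow> (\<lambda>x vs. f x * \<eta> x vs) \<in> forms A E"
  using forms_combine[of \<eta> "\<lambda>x vs. 0" f "\<lambda>_. 0"] by (simp add: forms_zero smooth_fun_const)

lemma forms_add: "\<eta> \<in> forms A E \<Longrightarrow> \<omega> \<in> forms A E \<Longrightarrow> (\<lambda>x vs. \<eta> x vs + \<omega> x vs) \<in> forms A E"
  using forms_combine[of \<eta> \<omega> "\<lambda>_. 1" "\<lambda>_. 1"] by (simp add: smooth_fun_const)

lemma forms_diff: 
  "\<eta> \<in> forms A E \<Longrightarrow> \<omega> \<in> forms A E \<Longrightarrow> (\<lambda>x vs. \<eta> x vs - c * \<omega> x vs) \<in> forms A E"
  using forms_combine[of \<eta> \<omega> "\<lambda>_. 1" "\<lambda>_. - c"] by (simp add: smooth_fun_const)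

lemma forms_contract:
  assumes "\<eta> \<in> forms A E" "V \<in> \<Gamma>"
  shows "contract V \<eta> \<in> forms A E"
proof -
  obtain N where N: "\<And>x vs. N < length vs \<Longrightarrow> \<eta> x vs = 0" using assms by (metis forms_bounded)
  note e = forms_ext[OF assms(1)]
  have "contract V \<eta> x \<in> ext_forms E x" for x
    unfolding contract_def
    by (rule ext_formsI[of _ _ N])
      (use sections_fibre[OF assms(2)] ext_add[OF e[of x], of "V x # us" for us]
        ext_alt[OF e[of x], of "V x # us" for us] ext_scale[OF e[of x], of "V x # us" for us]
        in \<open>auto simp: ext_supp[OF e] N\<close>)
  moreover have "smooth_fun A U (\<lambda>x. contract V \<eta> x (map (\<lambda>w. ls \<phi> w x) ws))"
    if U: "(U, \<phi>) \<in> trivs E" for U \<phi> ws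
  proof -
    have "smooth_fun A U (\<lambda>x. \<eta> x (map (\<lambda>u. u x) (V # map (ls \<phi>) ws)))"
      by (rule forms_smooth_local[OF U triv_open[OF U] subset_refl assms(1)])
        (use local_sec_section[OF U subset_refl assms(2)] local_sec_ls[OF U triv_open[OF U]] in auto)
    then show ?thesis by (simp add: contract_def o_def)
  qed
  ultimately show ?thesis by (intro formsI[of _ N]) (auto simp: contract_def N)
qed

section \<open>Forms from tensorial maps on sections\<close>

lemma tensor_vanishes:
  assumes "\<And>us u v ws. set us \<subseteq> \<Gamma> \<Longrightarrow> u \<in> \<Gamma> \<Longrightarrow> v \<in> \<Gamma> \<Longrightarrow> set ws \<subseteq> \<Gamma> \<Longrightarrow>
      \<Phi> (us @ sec_add E u v # ws) x = \<Phi> (us @ u # ws) x + \<Phi> (us @ v # ws) x"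
    and "\<And>us u f ws. set us \<subseteq> \<Gamma> \<Longrightarrow> u \<in> \<Gamma> \<Longrightarrow> smooth f \<Longrightarrow> set ws \<subseteq> \<Gamma> \<Longrightarrow>
      \<Phi> (us @ sec_scale E f u # ws) x = f x * \<Phi> (us @ u # ws) x"
    and "set us \<subseteq> \<Gamma>" "set ws \<subseteq> \<Gamma>" "V \<in> \<Gamma>" "V x = vzero E x"
  shows "\<Phi> (us @ V # ws) x = (0::real)"
proof -
  txt \<open>
    With a bump function \<open>\<beta>\<close> and the coordinates \<open>V\<^sub>b\<close> of \<open>V\<close> in the local frame \<open>e\<^sub>b\<close>, the identity
    \<open>V = (1 - \<beta>\<^sup>2) V + (\<Sum>b. (\<beta> V\<^sub>b) (\<beta> e\<^sub>b))\<close> holds globally, and all coefficients vanish at \<open>x\<close>.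
  \<close>
  obtain U \<phi> where U: "(U, \<phi>) \<in> trivs E" "x \<in> U" by (rule triv_at)
  obtain \<beta> K N where K: "closed K" "K \<subseteq> U" "smooth \<beta>" "\<And>y. y \<notin> K \<Longrightarrow> \<beta> y = (0::real)"
    "x \<in> N" "\<And>y. y \<in> N \<Longrightarrow> \<beta> y = 1" by (rule bump_fun[OF triv_open[OF U(1)] U(2)]) blast
  have cutS: "cutoff U \<phi> \<beta> b \<in> \<Gamma>" for b using cutoff_section[OF U(1) K(1-4)] by blast
  define g where "g b y = (if y \<in> U then \<beta> y * coord b (\<phi> (V y)) else 0)" for b y
  have g: "smooth (g b)" for b
  proof (rule smooth_fun_extend[OF triv_open[OF U(1)] K(1-4) open_UNIV])
    show "smooth_fun A (UNIV \<inter> U) (\<lambda>y. coord b (\<phi> (V y)))"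
      using smooth_fun_linear[OF triv_open[OF U(1)] bounded_linear_coord[OF fibre_finite_dim]
          sections_smooth[OF assms(5) U(1)]] by simp
  qed (auto simp: g_def)
  have gx: "g b x = 0" for b
    using bounded_linear_coord[OF fibre_finite_dim, of b] U assms(6)
    by (simp add: g_def triv_zero linear_0 bounded_linear.linear)
  define h where "h y = 1 - \<beta> y * \<beta> y" for y
  have "smooth (\<lambda>y. 1 + (-1) * (\<beta> y * \<beta> y))"
    by (intro smooth_fun_add smooth_fun_mult smooth_fun_const K open_UNIV)
  then have h: "smooth h" by (simp add: h_def[abs_def])
  obtain bs :: "'c list" where bs: "set bs = frame" "distinct bs"
    using finite_frame[OF fibre_finite_dim] finite_distinct_list by blast
  let ?t = "\<lambda>b. sec_scale E (g b) (cutoff U \<phi> \<beta> b)"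
  have tS: "?t b \<in> \<Gamma>" for b by (rule sec_scale_closed[OF g cutS])
  \<comment> \<open>\<Phi> is only known to respect binary sums, so the expansion of
    \<open>V\<close> is built by folding and \<Phi> is seen to vanish at every stage.\<close>
  define sm where "sm cs = foldr (\<lambda>b. sec_add E (?t b)) cs (sec_scale E h V)" for cs
  have smS: "sm cs \<in> \<Gamma>" for cs
    by (induction cs) (simp_all add: sm_def sec_scale_closed h assms(5) sec_add_closed tS)
  have "\<Phi> (us @ sm cs # ws) x = 0" for cs
  proof (induction cs)
    case Nil
    have "h x = 0" using K(5,6) by (simp add: h_def)
    then show ?case using assms(2)[OF assms(3) assms(5) h assms(4)] by (simp add: sm_def)
  next
    case (Cons b cs)
    have "\<Phi> (us @ sm (b # cs) # ws) x = \<Phi> (us @ ?t b # ws) x + \<Phi> (us @ sm cs # ws) x"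
      using assms(1)[OF assms(3) tS smS assms(4)] by (simp add: sm_def)
    then show ?case using Cons assms(2)[OF assms(3) cutS g assms(4)] gx by simp
  qed
  moreover have "sm bs = V"
  proof
    fix y
    show "sm bs y = V y"
    proof (cases "y \<in> U")
      case True
      let ?c = "\<lambda>b. (\<beta> y * coord b (\<phi> (V y))) *\<^sub>R \<beta> y *\<^sub>R b"
      have "\<phi> (sm cs y) = (\<Sum>b\<leftarrow>cs. ?c b) + h y *\<^sub>R \<phi> (V y)" for cs
      proof (induction cs)
        case Nil
        then show ?case
          using U(1) True sections_fibre[OF assms(5)] by (simp add: sm_def sec_scale_def triv_scale)
      next
        case (Cons b cs)
        have "\<phi> (sm (b # cs) y) = \<phi> (?t b y) + \<phi> (sm cs y)"
          using triv_add[OF U(1) True sections_fibre[OF tS] sections_fibre[OF smS]]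
          by (simp add: sm_def sec_add_def)
        also have "\<phi> (?t b y) = ?c b"
          using triv_scale[OF U(1) True] True ls_fibre[OF U(1) True] sections_fibre[OF cutS]
          by (simp add: sec_scale_def g_def cutoff_def vscale_closed triv_ls[OF U(1)])
        finally show ?case by (simp add: Cons)
      qed
      also have "(\<Sum>b\<leftarrow>bs. ?c b) = (\<Sum>b\<in>frame. (\<beta> y * \<beta> y) *\<^sub>R coord b (\<phi> (V y)) *\<^sub>R b)"
        using bs by (simp add: sum_list_distinct_conv_sum_set ac_simps)
      also have "\<dots> = (\<beta> y * \<beta> y) *\<^sub>R \<phi> (V y)"
        using sum_coord[OF fibre_finite_dim] by (simp flip: scaleR_sum_right scaleR_scaleR)
      also have "\<dots> + h y *\<^sub>R \<phi> (V y) = \<phi> (V y)" by (simp add: h_def scaleR_diff_left)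
      finally show ?thesis using fibre_eqI[OF U(1) True] sections_fibre smS assms(5) by blast
    next
      case False
      have \<beta>y: "\<beta> y = 0" using K(2,4) False by blast
      \<comment> \<open>Here \<open>h\<close> is 1 and all other terms are zero vectors; \<phi> says
        nothing off \<open>U\<close>, hence another trivialisation.\<close>
      obtain W \<psi> where W: "(W, \<psi>) \<in> trivs E" "y \<in> W" by (rule triv_at)
      have "\<psi> (sm cs y) = \<psi> (V y)" for cs
      proof (induction cs)
        case Nil
        then show ?case using triv_scale[OF W sections_fibre[OF assms(5)]] \<beta>y
          by (simp add: sm_def sec_scale_def h_def)
      next
        case (Cons b cs)
        have "\<psi> (sm (b # cs) y) = \<psi> (?t b y) + \<psi> (sm cs y)"
          using triv_add[OF W sections_fibre[OF tS] sections_fibre[OF smS]]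
          by (simp add: sm_def sec_add_def)
        then show ?case
          using Cons False triv_scale[OF W sections_fibre[OF cutS]] by (simp add: sec_scale_def g_def)
      qed
      then show ?thesis using fibre_eqI[OF W] sections_fibre smS assms(5) by blast
    qed
  qed
  ultimately show ?thesis by metis
qed

text \<open>The tensoriality criterion: by \<open>tensor_vanishes\<close> the value at
  \<open>x\<close> depends only on the values of the sections at \<open>x\<close>, and every fibre
  vector lies on a global section. It supplies the existence part of the description of
  \<open>d_rho\<close>.\<close>

lemma form_of_tensor:
  assumes add: "\<And>us u v ws x. set us \<subseteq> \<Gamma> \<Longrightarrow> u \<in> \<Gamma> \<Longrightarrow> v \<in> \<Gamma> \<Longrightarrow> set ws \<subseteq> \<Gamma> \<Longrightarrow>
      \<Phi> (us @ sec_add E u v # ws) x = \<Phi> (us @ u # ws) x + (\<Phi> (us @ v # ws) x :: real)"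
    and scale: "\<And>us u f ws x. set us \<subseteq> \<Gamma> \<Longrightarrow> u \<in> \<Gamma> \<Longrightarrow> smooth f \<Longrightarrow> set ws \<subseteq> \<Gamma> \<Longrightarrow>
      \<Phi> (us @ sec_scale E f u # ws) x = f x * \<Phi> (us @ u # ws) x"
    and alt: "\<And>us v vs ws x. set us \<subseteq> \<Gamma> \<Longrightarrow> v \<in> \<Gamma> \<Longrightarrow> set vs \<subseteq> \<Gamma> \<Longrightarrow> set ws \<subseteq> \<Gamma> \<Longrightarrow>
      \<Phi> (us @ v # vs @ v # ws) x = 0"
    and smooth: "\<And>Vs. set Vs \<subseteq> \<Gamma> \<Longrightarrow> smooth (\<Phi> Vs)"
    and bound: "\<And>Vs x. set Vs \<subseteq> \<Gamma> \<Longrightarrow> N < length Vs \<Longrightarrow> \<Phi> Vs x = 0"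
  obtains \<omega> where "\<omega> \<in> forms A E" "\<And>Vs x. set Vs \<subseteq> \<Gamma> \<Longrightarrow> \<omega> x (map (\<lambda>V. V x) Vs) = \<Phi> Vs x"
proof -
  have eq1: "\<Phi> (us @ V # ws) x = \<Phi> (us @ W # ws) x"
    if "V x = W x" "V \<in> \<Gamma>" "W \<in> \<Gamma>" "set us \<subseteq> \<Gamma>" "set ws \<subseteq> \<Gamma>" for V W us ws x
  proof -
    let ?D = "sec_add E V (sec_scale E (\<lambda>_. -1) W)"
    have mS: "sec_scale E (\<lambda>_. -1) W \<in> \<Gamma>" by (rule sec_scale_closed[OF smooth_fun_const that(3)])
    obtain U \<phi> where U: "(U, \<phi>) \<in> trivs E" "x \<in> U" by (rule triv_at)
    have "?D x = vzero E x"
      by (rule fibre_eqI[OF U])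
        (use that sections_fibre[OF that(3), of x] U in
          \<open>simp_all add: sec_add_def sec_scale_def vzero_closed vadd_closed vscale_closed triv_add triv_zero triv_scale\<close>)
    then have "\<Phi> (us @ ?D # ws) x = 0"
      by (intro tensor_vanishes add scale that sec_add_closed mS)
    then show ?thesis using add[OF that(4,2) mS that(5)] scale[OF that(4,3) smooth_fun_const that(5)] by simp
  qed
  \<comment> \<open>The sections are exchanged one at a time; \<open>us\<close> holds those already
    exchanged.\<close>
  have eqs: "\<Phi> (us @ Vs) x = \<Phi> (us @ Ws) x"
    if "map (\<lambda>V. V x) Vs = map (\<lambda>V. V x) Ws" "set us \<subseteq> \<Gamma>" "set Vs \<subseteq> \<Gamma>" "set Ws \<subseteq> \<Gamma>" for us Vs Ws x
    using that
  proof (induction Vs arbitrary: us Ws)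
    case (Cons V Vs)
    then obtain W Ws' where W: "Ws = W # Ws'" by (cases Ws) auto
    have "\<Phi> (us @ V # Vs) x = \<Phi> (us @ W # Vs) x" using Cons.prems W by (intro eq1) auto
    also have "\<dots> = \<Phi> ((us @ [W]) @ Ws') x"
      using Cons.IH[of Ws' "us @ [W]"] Cons.prems W by simp
    finally show ?case by (simp add: W)
  qed simp
  define \<omega> where "\<omega> x vs = (if set vs \<subseteq> fibre E x
    then \<Phi> (SOME Vs. set Vs \<subseteq> \<Gamma> \<and> map (\<lambda>V. V x) Vs = vs) x else 0)" for x vs
  have \<omega>: "\<omega> x (map (\<lambda>V. V x) Vs) = \<Phi> Vs x" if "set Vs \<subseteq> \<Gamma>" for Vs x
  proof -
    let ?W = "SOME Ws. set Ws \<subseteq> \<Gamma> \<and> map (\<lambda>V. V x) Ws = map (\<lambda>V. V x) Vs"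
    have "set ?W \<subseteq> \<Gamma> \<and> map (\<lambda>V. V x) ?W = map (\<lambda>V. V x) Vs"
      by (rule someI[of _ Vs]) (use that in simp)
    then have "\<Phi> ?W x = \<Phi> Vs x" using eqs[of x ?W Vs "[]"] that by simp
    moreover have "set (map (\<lambda>V. V x) Vs) \<subseteq> fibre E x" using that sections_fibre by auto
    ultimately show ?thesis by (simp add: \<omega>_def)
  qed
  have "\<omega> x \<in> ext_forms E x" for x
  proof (rule ext_formsI[of _ _ N])
    show "\<omega> x vs = 0" if "\<not> set vs \<subseteq> fibre E x" for vs using that by (simp add: \<omega>_def)
  next
    fix us u v ws assume *: "set us \<union> {u, v} \<union> set ws \<subseteq> fibre E x"
    obtain Us Ws where Us: "set Us \<subseteq> \<Gamma>" "map (\<lambda>V. V x) Us = us" "set Ws \<subseteq> \<Gamma>" "map (\<lambda>V. V x) Ws = ws"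
      using * sections_through[of us x] sections_through[of ws x] by (metis Un_subset_iff)
    obtain U V where UV: "U \<in> \<Gamma>" "U x = u" "V \<in> \<Gamma>" "V x = v"
      using * section_through[of u x] section_through[of v x] by (metis Un_subset_iff insert_subset)
    show "\<omega> x (us @ vadd E u v # ws) = \<omega> x (us @ u # ws) + \<omega> x (us @ v # ws)"
      using \<omega>[of "Us @ sec_add E U V # Ws" x] \<omega>[of "Us @ U # Ws" x] \<omega>[of "Us @ V # Ws" x]
        add[OF Us(1) UV(1,3) Us(3)] Us UV sec_add_closed[OF UV(1,3)] by (simp add: sec_add_def)
  next
    fix us u a ws assume *: "set us \<union> {u} \<union> set ws \<subseteq> fibre E x"
    obtain Us Ws where Us: "set Us \<subseteq> \<Gamma>" "map (\<lambda>V. V x) Us = us" "set Ws \<subseteq> \<Gamma>" "map (\<lambda>V. V x) Ws = ws"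
      using * sections_through[of us x] sections_through[of ws x] by (metis Un_subset_iff)
    obtain U where U: "U \<in> \<Gamma>" "U x = u"
      using * section_through[of u x] by (metis Un_subset_iff insert_subset)
    show "\<omega> x (us @ vscale E a u # ws) = a * \<omega> x (us @ u # ws)"
      using \<omega>[of "Us @ sec_scale E (\<lambda>_. a) U # Ws" x] \<omega>[of "Us @ U # Ws" x]
        scale[OF Us(1) U(1) smooth_fun_const Us(3), of a] Us U
        sec_scale_closed[OF smooth_fun_const U(1), of a] by (simp add: sec_scale_def)
  next
    fix us v vs ws assume *: "set us \<union> {v} \<union> set vs \<union> set ws \<subseteq> fibre E x"
    obtain Us Ws Vs where Us: "set Us \<subseteq> \<Gamma>" "map (\<lambda>V. V x) Us = us" "set Ws \<subseteq> \<Gamma>" "map (\<lambda>V. V x) Ws = ws"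
      "set Vs \<subseteq> \<Gamma>" "map (\<lambda>V. V x) Vs = vs"
      using * sections_through[of us x] sections_through[of ws x] sections_through[of vs x]
      by (metis Un_subset_iff)
    obtain V where V: "V \<in> \<Gamma>" "V x = v"
      using * section_through[of v x] by (metis Un_subset_iff insert_subset)
    show "\<omega> x (us @ v # vs @ v # ws) = 0"
      using \<omega>[of "Us @ V # Vs @ V # Ws" x] alt[OF Us(1) V(1) Us(5,3)] Us V by simp
  next
    fix vs :: "'e list" assume "N < length vs"
    show "\<omega> x vs = 0"
    proof (cases "set vs \<subseteq> fibre E x")
      case True
      then obtain Vs where "set Vs \<subseteq> \<Gamma>" "map (\<lambda>V. V x) Vs = vs" by (rule sections_through)
      then show ?thesis using \<omega>[of Vs x] bound[of Vs x] \<open>N < length vs\<close> by auto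
    qed (simp add: \<omega>_def)
  qed
  moreover have "\<omega> x vs = 0" if "N < length vs" for x vs
  proof (cases "set vs \<subseteq> fibre E x")
    case True
    then obtain Vs where "set Vs \<subseteq> \<Gamma>" "map (\<lambda>V. V x) Vs = vs" by (rule sections_through)
    then show ?thesis using \<omega>[of Vs x] bound[of Vs x] that by auto
  qed (simp add: \<omega>_def)
  moreover have "smooth_fun A U (\<lambda>x. \<omega> x (map (\<lambda>w. ls \<phi> w x) ws))"
    if U: "(U, \<phi>) \<in> trivs E" for U \<phi> ws
  proof (rule smooth_fun_local[OF triv_open[OF U]])
    fix x assume x: "x \<in> U"
    obtain \<beta> K M where K: "closed K" "K \<subseteq> U" "smooth \<beta>" "\<And>y. y \<notin> K \<Longrightarrow> \<beta> y = (0::real)"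
      "open M" "x \<in> M" "M \<subseteq> U" "\<And>y. y \<in> M \<Longrightarrow> \<beta> y = 1"
      by (rule bump_fun[OF triv_open[OF U] x]) blast
    \<comment> \<open>Near \<open>x\<close> the constant local sections coincide with global ones,
      to which the smoothness of \<Phi> applies.\<close>
    have cutS: "set (map (cutoff U \<phi> \<beta>) ws) \<subseteq> \<Gamma>" using cutoff_section[OF U K(1-4)] by auto
    have "smooth_fun A M (\<Phi> (map (cutoff U \<phi> \<beta>) ws))" using smooth[OF cutS] smooth_fun_subset by blast
    moreover have "\<Phi> (map (cutoff U \<phi> \<beta>) ws) y = \<omega> y (map (\<lambda>w. ls \<phi> w y) ws)" if "y \<in> M" for y
      using \<omega>[OF cutS, of y] cutoff_eq[OF U, of y \<beta>] K(7,8) that by (simp add: o_def subset_iff)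
    ultimately have "smooth_fun A M (\<lambda>y. \<omega> y (map (\<lambda>w. ls \<phi> w y) ws))"
      by (rule smooth_fun_cong[OF K(5), rotated])
    then show "\<exists>T. open T \<and> x \<in> T \<and> T \<subseteq> U \<and> smooth_fun A T (\<lambda>x. \<omega> x (map (\<lambda>w. ls \<phi> w x) ws))"
      using K by blast
  qed
  ultimately have "\<omega> \<in> forms A E" by (rule formsI)
  then show ?thesis using \<omega> by (rule that)
qed

section \<open>Extension of a form from one fibre\<close>

text \<open>The form over \<open>z\<close> with the same coefficients as \<alpha> in the
  trivialisation \<phi>.\<close>

definition transport :: "('e \<Rightarrow> 'c) \<Rightarrow> 'm \<Rightarrow> 'm \<Rightarrow> ('e list \<Rightarrow> real) \<Rightarrow> 'e list \<Rightarrow> real" where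
  "transport \<phi> x z \<alpha> vs =
     (if set vs \<subseteq> fibre E z then \<alpha> (map (\<lambda>v. ls \<phi> (\<phi> v) x) vs) else 0)"

lemma transport_ls:
  assumes "(U, \<phi>) \<in> trivs E" "z \<in> U"
  shows "transport \<phi> x z \<alpha> (map (\<lambda>w. ls \<phi> w z) ws) = \<alpha> (map (\<lambda>w. ls \<phi> w x) ws)"
proof -
  have "set (map (\<lambda>w. ls \<phi> w z) ws) \<subseteq> fibre E z" using ls_fibre[OF assms] by auto
  then show ?thesis by (simp add: transport_def triv_ls[OF assms] o_def)
qed

lemma transport_ext:
  assumes "(U, \<phi>) \<in> trivs E" "x \<in> U" "z \<in> U" "\<alpha> \<in> ext_forms E x"
  shows "transport \<phi> x z \<alpha> \<in> ext_forms E z"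
proof -
  obtain N where N: "\<And>vs. N < length vs \<Longrightarrow> \<alpha> vs = 0" using assms(4) by (rule ext_forms_bounded) blast
  let ?t = "\<lambda>v. ls \<phi> (\<phi> v) x"
  have t: "set (map ?t vs) \<subseteq> fibre E x" for vs using ls_fibre[OF assms(1,2)] by auto
  show ?thesis
  proof (rule ext_formsI[of _ _ N])
    fix us u v ws assume "set us \<union> {u, v} \<union> set ws \<subseteq> fibre E z"
    then show "transport \<phi> x z \<alpha> (us @ vadd E u v # ws) =
        transport \<phi> x z \<alpha> (us @ u # ws) + transport \<phi> x z \<alpha> (us @ v # ws)"
      using ext_add[OF assms(4), of "map ?t us" "?t u" "?t v" "map ?t ws"] t[of "us @ u # v # ws"]
      by (simp add: transport_def vadd_closed triv_add[OF assms(1,3)] ls_add[OF assms(1,2)])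
  next
    fix us u a ws assume "set us \<union> {u} \<union> set ws \<subseteq> fibre E z"
    then show "transport \<phi> x z \<alpha> (us @ vscale E a u # ws) = a * transport \<phi> x z \<alpha> (us @ u # ws)"
      using ext_scale[OF assms(4), of "map ?t us" "?t u" "map ?t ws" a] t[of "us @ u # ws"]
      by (simp add: transport_def vscale_closed triv_scale[OF assms(1,3)] ls_scale[OF assms(1,2)])
  qed (simp_all add: transport_def N ext_alt[OF assms(4)])
qed

lemma transport_same:
  assumes "(U, \<phi>) \<in> trivs E" "x \<in> U" "\<alpha> \<in> ext_forms E x"
  shows "transport \<phi> x x \<alpha> = \<alpha>"
proof
  fix vs
  have "map (\<lambda>v. ls \<phi> (\<phi> v) x) vs = vs" if "set vs \<subseteq> fibre E x"
    using that ls_triv[OF assms(1,2)] by (induction vs) auto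
  then show "transport \<phi> x x \<alpha> vs = \<alpha> vs" by (simp add: transport_def ext_supp[OF assms(3)])
qed

text \<open>A bump function times the extension with constant coefficients. It lets interior
  products with global forms detect everything in a single fibre.\<close>

lemma form_through:
  assumes "\<alpha> \<in> ext_forms E x"
  obtains \<eta> where "\<eta> \<in> forms A E" "\<eta> x = \<alpha>"
proof -
  obtain U \<phi> where U: "(U, \<phi>) \<in> trivs E" "x \<in> U" by (rule triv_at)
  obtain \<beta> K M where K: "closed K" "K \<subseteq> U" "smooth \<beta>" "\<And>y. y \<notin> K \<Longrightarrow> \<beta> y = (0::real)"
    "x \<in> M" "\<And>y. y \<in> M \<Longrightarrow> \<beta> y = 1"
    by (rule bump_fun[OF triv_open[OF U(1)] U(2)]) blast
  obtain N where N: "\<And>vs. N < length vs \<Longrightarrow> \<alpha> vs = 0" using assms by (rule ext_forms_bounded) blast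
  define \<eta> where "\<eta> z = (if z \<in> U then (\<lambda>vs. \<beta> z * transport \<phi> x z \<alpha> vs) else (\<lambda>vs. 0))" for z
  \<comment> \<open>In another trivialisation the arguments become values of transition maps. As
    \<alpha> is fixed and multilinear, they are expanded one slot at a time, with \<open>ws\<close>
    collecting the treated slots.\<close>
  have mult: "smooth_fun A W (\<lambda>z. \<alpha> (map (\<lambda>w. ls \<phi> w x) ws @ map (\<lambda>u. ls \<phi> (u z) x) us))"
    if "open W" "\<And>u. u \<in> set us \<Longrightarrow> smooth_fun A W u" for W us ws
    using that(2)
  proof (induction us arbitrary: ws)
    case Nil
    then show ?case by (simp add: smooth_fun_const)
  next
    case (Cons u us)
    have "smooth_fun A W (\<lambda>z. \<Sum>b\<in>frame. coord b (u z) *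
        \<alpha> (map (\<lambda>w. ls \<phi> w x) (ws @ [b]) @ map (\<lambda>u. ls \<phi> (u z) x) us))"
      by (intro smooth_fun_sum smooth_fun_mult that(1) Cons.IH
          smooth_fun_linear[OF that(1) bounded_linear_coord[OF fibre_finite_dim]])
        (use Cons.prems in simp_all)
    moreover have "\<alpha> (map (\<lambda>w. ls \<phi> w x) ws @ ls \<phi> (u z) x # map (\<lambda>u. ls \<phi> (u z) x) us) =
      (\<Sum>b\<in>frame. coord b (\<phi> (ls \<phi> (u z) x)) *\<^sub>R
        \<alpha> (map (\<lambda>w. ls \<phi> w x) ws @ ls \<phi> b x # map (\<lambda>u. ls \<phi> (u z) x) us))" for z
      by (rule fibre_expansion[OF U ls_fibre[OF U]])
        (use ls_fibre[OF U] in \<open>auto simp: image_subset_iff ext_add[OF assms] ext_scale[OF assms]\<close>)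
    ultimately show ?case by (simp add: triv_ls[OF U])
  qed
  have "\<eta> \<in> forms A E"
  proof (rule formsI)
    show "\<eta> z \<in> ext_forms E z" for z
    proof (cases "z \<in> U")
      case True
      then show ?thesis
        using ext_combine[OF transport_ext[OF U True assms] ext_zero, of "\<beta> z" 0] by (simp add: \<eta>_def)
    qed (simp add: \<eta>_def ext_zero)
    show "N < length vs \<Longrightarrow> \<eta> z vs = 0" for z vs by (simp add: \<eta>_def transport_def N)
    fix V \<psi> and ws :: "'c list" assume V: "(V, \<psi>) \<in> trivs E"
    have o: "open (V \<inter> U)" using triv_open U(1) V by blast
    show "smooth_fun A V (\<lambda>z. \<eta> z (map (\<lambda>w. ls \<psi> w z) ws))"
    proof (rule smooth_fun_extend[OF triv_open[OF U(1)] K(1-4) triv_open[OF V]])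
      show "smooth_fun A (V \<inter> U) (\<lambda>z. \<alpha> (map (\<lambda>u. ls \<phi> (u z) x) (map (\<lambda>w z. \<phi> (ls \<psi> w z)) ws)))"
        using mult[OF o, of "map (\<lambda>w z. \<phi> (ls \<psi> w z)) ws" "[]"] triv_transition[OF V U(1)] by auto
      show "\<eta> y (map (\<lambda>w. ls \<psi> w y) ws) =
          \<beta> y *\<^sub>R \<alpha> (map (\<lambda>u. ls \<phi> (u y) x) (map (\<lambda>w z. \<phi> (ls \<psi> w z)) ws))" if "y \<in> V \<inter> U" for y
      proof -
        have "set (map (\<lambda>w. ls \<psi> w y) ws) \<subseteq> fibre E y" using ls_fibre[OF V] that by auto
        then show ?thesis using that by (simp add: \<eta>_def transport_def o_def)
      qed
    qed (auto simp: \<eta>_def)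
  qed
  moreover have "\<eta> x = \<alpha>" using U K(5,6) by (simp add: \<eta>_def transport_same[OF U assms])
  ultimately show ?thesis by (rule that)
qed

section \<open>Interior products\<close>

lemma ext_prefix:
  assumes "\<alpha> \<in> ext_forms E x" "set us \<subseteq> fibre E x"
  shows "(\<lambda>vs. \<alpha> (us @ vs)) \<in> ext_forms E x"
proof -
  obtain N where N: "\<And>vs. N < length vs \<Longrightarrow> \<alpha> vs = 0" using assms(1) by (rule ext_forms_bounded) blast
  show ?thesis
    by (rule ext_formsI[of _ _ N])
      (use assms(2) ext_add[OF assms(1), of "us @ ys" for ys] ext_scale[OF assms(1), of "us @ ys" for ys]
        ext_alt[OF assms(1), of "us @ ys" for ys] in \<open>auto simp: N ext_supp[OF assms(1)]\<close>)
qed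

lemma ext_sum_list:
  "(\<And>t. t \<in> set ts \<Longrightarrow> F t \<in> ext_forms E x) \<Longrightarrow> (\<lambda>vs. \<Sum>t\<leftarrow>ts. F t vs) \<in> ext_forms E x"
proof (induction ts)
  case (Cons t ts)
  then show ?case using ext_combine[of "F t" x "\<lambda>vs. \<Sum>t\<leftarrow>ts. F t vs" 1 1] by simp
qed (simp add: ext_zero)

lemma interior_product_local:
  assumes "(U, \<phi>) \<in> trivs E" "y \<in> U" "\<eta> \<in> forms A E"
    and "P y = (\<lambda>\<alpha>. \<Sum>(f, ws)\<leftarrow>ts. f y * wedge E y (map (\<lambda>w. ls \<phi> w y) ws) \<alpha>)"
  shows "interior_product P \<eta> y vs = (\<Sum>(f, ws)\<leftarrow>ts. f y * \<eta> y (map (\<lambda>w. ls \<phi> w y) (rev ws) @ vs))"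
  using ext_forms_rev_append[OF forms_ext[OF assms(3)]]
  by (simp add: interior_product_def assms(4) wedge_def rev_map)

lemma interior_product_forms:
  assumes "P \<in> multivectors A E p" "\<eta> \<in> forms A E"
  shows "interior_product P \<eta> \<in> forms A E"
proof -
  obtain N where N: "\<And>x vs. N < length vs \<Longrightarrow> \<eta> x vs = 0" using assms(2) by (rule forms_bounded) blast
  have ex: "\<exists>ts. (\<forall>(f, ws)\<in>set ts. smooth_fun A U f) \<and> (\<forall>y\<in>U. \<forall>vs. interior_product P \<eta> y vs =
      (\<Sum>(f, ws)\<leftarrow>ts. f y * \<eta> y (map (\<lambda>w. ls \<phi> w y) (rev ws) @ vs)))"
    if U: "(U, \<phi>) \<in> trivs E" for U \<phi>
  proof -
    obtain ts where ts: "\<forall>(f, ws)\<in>set ts. smooth_fun A U f \<and> int (length ws) = p"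
      "\<forall>x\<in>U. P x = (\<lambda>\<alpha>. \<Sum>(f, ws)\<leftarrow>ts. f x * wedge E x (map (\<lambda>w. ls \<phi> w x) ws) \<alpha>)"
      using assms(1) U unfolding multivectors_def by blast
    then show ?thesis
      using interior_product_local[OF U _ assms(2), of _ P ts] by (intro exI[of _ ts]) auto
  qed
  have "interior_product P \<eta> x \<in> ext_forms E x \<and> (\<forall>vs. N < length vs \<longrightarrow> interior_product P \<eta> x vs = 0)" for x
  proof -
    obtain U \<phi> where U: "(U, \<phi>) \<in> trivs E" "x \<in> U" by (rule triv_at)
    from ex[OF U(1)] U(2) obtain ts where ts: "interior_product P \<eta> x =
        (\<lambda>vs. \<Sum>t\<leftarrow>ts. fst t x * \<eta> x (map (\<lambda>w. ls \<phi> w x) (rev (snd t)) @ vs))"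
      by (force simp: case_prod_unfold)
    have "(\<lambda>vs. fst t x * \<eta> x (map (\<lambda>w. ls \<phi> w x) (rev (snd t)) @ vs)) \<in> ext_forms E x"
      for t :: "('m \<Rightarrow> real) \<times> 'c list"
    proof -
      have "set (map (\<lambda>w. ls \<phi> w x) (rev (snd t))) \<subseteq> fibre E x" using ls_fibre[OF U] by auto
      from ext_combine[OF ext_prefix[OF forms_ext[OF assms(2)] this] ext_zero, of "fst t x" 0]
      show ?thesis by simp
    qed
    then show ?thesis unfolding ts by (intro conjI ext_sum_list) (simp_all add: N)
  qed
  moreover have "smooth_fun A U (\<lambda>x. interior_product P \<eta> x (map (\<lambda>w. ls \<phi> w x) vs))"
    if U: "(U, \<phi>) \<in> trivs E" for U \<phi> vs
  proof -
    from ex[OF U] obtain ts where ts: "\<And>t. t \<in> set ts \<Longrightarrow> smooth_fun A U (fst t)"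
      "\<And>y vs. y \<in> U \<Longrightarrow> interior_product P \<eta> y vs =
        (\<Sum>t\<leftarrow>ts. fst t y * \<eta> y (map (\<lambda>w. ls \<phi> w y) (rev (snd t)) @ vs))"
      by (auto simp: case_prod_unfold)
    have "smooth_fun A U (\<lambda>y. \<eta> y (map (\<lambda>w. ls \<phi> w y) (rev (snd t) @ vs)))" for t :: "('m \<Rightarrow> real) \<times> 'c list"
      using forms_ls[OF assms(2) U] .
    then have "smooth_fun A U (\<lambda>y. \<Sum>t\<leftarrow>ts. fst t y * \<eta> y (map (\<lambda>w. ls \<phi> w y) (rev (snd t) @ vs)))"
      by (intro smooth_fun_sum_list smooth_fun_mult triv_open[OF U] ts)
    then show ?thesis
      by (rule smooth_fun_cong[OF triv_open[OF U], rotated]) (simp add: ts)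
  qed
  ultimately show ?thesis by (intro formsI[of _ N]) blast+
qed

end

section \<open>The differential\<close>

context lie_algebroid
begin

text \<open>Values on sections as functions of the point, so that they can be differentiated;
  contraction becomes prefixing the list, which drives the inductions below.\<close>

definition ev :: "('m \<Rightarrow> 'e list \<Rightarrow> real) \<Rightarrow> ('m \<Rightarrow> 'e) list \<Rightarrow> 'm \<Rightarrow> real" where
  "ev \<eta> Vs x = \<eta> x (map (\<lambda>V. V x) Vs)"

lemma ev_contract: "ev (contract V \<eta>) Vs = ev \<eta> (V # Vs)"
  by (simp add: ev_def contract_def fun_eq_iff)

lemma ev_smooth: "\<eta> \<in> forms A E \<Longrightarrow> set Vs \<subseteq> \<Gamma> \<Longrightarrow> smooth (ev \<eta> Vs)"
  using forms_smooth by (simp add: ev_def[abs_def])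

lemma set_fibre: "set Vs \<subseteq> \<Gamma> \<Longrightarrow> set (map (\<lambda>V. V x) Vs) \<subseteq> fibre E x"
  using sections_fibre by auto

lemma ev_add:
  assumes "\<eta> \<in> forms A E" "set us \<subseteq> \<Gamma>" "u \<in> \<Gamma>" "v \<in> \<Gamma>" "set ws \<subseteq> \<Gamma>"
  shows "ev \<eta> (us @ sec_add E u v # ws) x = ev \<eta> (us @ u # ws) x + ev \<eta> (us @ v # ws) x"
  using ext_add[OF forms_ext[OF assms(1), of x], of "map (\<lambda>V. V x) us" "u x" "v x" "map (\<lambda>V. V x) ws"]
    set_fibre[OF assms(2)] set_fibre[OF assms(5)] sections_fibre assms
  by (simp add: ev_def sec_add_def)

lemma ev_scale:
  assumes "\<eta> \<in> forms A E" "set us \<subseteq> \<Gamma>" "u \<in> \<Gamma>" "set ws \<subseteq> \<Gamma>"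
  shows "ev \<eta> (us @ sec_scale E f u # ws) x = f x * ev \<eta> (us @ u # ws) x"
  using ext_scale[OF forms_ext[OF assms(1), of x], of "map (\<lambda>V. V x) us" "u x" "map (\<lambda>V. V x) ws" "f x"]
    set_fibre[OF assms(2)] set_fibre[OF assms(4)] sections_fibre assms
  by (simp add: ev_def sec_scale_def)

lemma ev_alt: "\<eta> \<in> forms A E \<Longrightarrow> ev \<eta> (us @ v # vs @ v # ws) x = 0"
  by (simp add: ev_def ext_alt[OF forms_ext])

lemma ev_swap: "\<eta> \<in> forms A E \<Longrightarrow> ev \<eta> (us @ u # vs @ v # ws) x = - ev \<eta> (us @ v # vs @ u # ws) x"
  by (simp add: ev_def ext_swap[OF forms_ext, of _ x "map (\<lambda>V. V x) us" "u x"])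

lemma ev_move: "\<eta> \<in> forms A E \<Longrightarrow> ev \<eta> (us @ v # ws) x = (- 1) ^ length us * ev \<eta> (v # us @ ws) x"
  by (simp add: ev_def ext_move[OF forms_ext, of _ x "map (\<lambda>V. V x) us" "v x"])

lemma contract_swap:
  assumes "\<eta> \<in> forms A E"
  shows "contract V (contract W \<eta>) = (\<lambda>x vs. - 1 * contract W (contract V \<eta>) x vs)"
proof (intro ext)
  fix x vs
  show "contract V (contract W \<eta>) x vs = - 1 * contract W (contract V \<eta>) x vs"
    using ext_swap[OF forms_ext[OF assms, of x], of "[]" "W x" "[]" "V x" vs] by (simp add: contract_def)
qed

lemma contract_sec_add:
  assumes "\<eta> \<in> forms A E" "u \<in> \<Gamma>" "v \<in> \<Gamma>"
  shows "contract (sec_add E u v) \<eta> = (\<lambda>x vs. contract u \<eta> x vs + contract v \<eta> x vs)"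
proof (intro ext)
  fix x vs
  show "contract (sec_add E u v) \<eta> x vs = contract u \<eta> x vs + contract v \<eta> x vs"
    using ext_add[OF forms_ext[OF assms(1), of x], of "[]" "u x" "v x" vs] ext_supp[OF forms_ext[OF assms(1), of x]]
      sections_fibre[OF assms(2), of x] sections_fibre[OF assms(3), of x]
    by (cases "set vs \<subseteq> fibre E x") (simp_all add: contract_def sec_add_def)
qed

lemma contract_sec_scale:
  assumes "\<eta> \<in> forms A E" "u \<in> \<Gamma>"
  shows "contract (sec_scale E f u) \<eta> = (\<lambda>x vs. f x * contract u \<eta> x vs)"
proof (intro ext)
  fix x vs
  show "contract (sec_scale E f u) \<eta> x vs = f x * contract u \<eta> x vs"
    using ext_scale[OF forms_ext[OF assms(1), of x], of "[]" "u x" vs "f x"] ext_supp[OF forms_ext[OF assms(1), of x]]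
      sections_fibre[OF assms(2), of x]
    by (cases "set vs \<subseteq> fibre E x") (simp_all add: contract_def sec_scale_def)
qed

text \<open>The Leibniz rule is assumed in the second argument; antisymmetry carries it over and
  produces the minus sign.\<close>

lemma br_scale_head:
  assumes "s \<in> \<Gamma>" "t \<in> \<Gamma>" "smooth f"
  shows "br (sec_scale E f s) t = sec_add E (sec_scale E f (br s t)) (sec_scale E (\<lambda>x. - LD t f x) s)"
proof -
  have c: "br t s \<in> \<Gamma>" "br s t \<in> \<Gamma>" "smooth (LD t f)" "sec_scale E f s \<in> \<Gamma>"
    using assms by (simp_all add: br_closed LD_smooth sec_scale_closed)
  have "br (sec_scale E f s) t =
      sec_scale E (\<lambda>_. - 1) (sec_add E (sec_scale E f (br t s)) (sec_scale E (LD t f) s))"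
    using br_antisym[OF c(4) assms(2)] br_leibniz[OF assms(2,1,3)] by simp
  also have "\<dots> = sec_add E (sec_scale E f (sec_scale E (\<lambda>_. - 1) (br t s))) (sec_scale E (\<lambda>x. - LD t f x) s)"
    by (rule sec_eqI)
      (use sections_fibre[OF c(1)] sections_fibre[OF assms(1)] in
        \<open>simp_all add: sec_add_def sec_scale_def vadd_closed vscale_closed triv_add triv_scale\<close>)
  finally show ?thesis using br_antisym[OF assms(1,2)] by simp
qed

section \<open>Lie derivatives of forms, evaluated on sections\<close>

text \<open>The value of the Lie derivative of \<eta> along \<open>V\<close> on \<open>Vs\<close>,
  available before any differential is.\<close>

definition lie_on :: "('m \<Rightarrow> 'e list \<Rightarrow> real) \<Rightarrow> ('m \<Rightarrow> 'e) \<Rightarrow> ('m \<Rightarrow> 'e) list \<Rightarrow> 'm \<Rightarrow> real" where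
  "lie_on \<eta> V Vs x = LD V (ev \<eta> Vs) x - (\<Sum>k<length Vs. ev \<eta> (Vs[k := br V (Vs ! k)]) x)"

lemma lie_on_Nil: "lie_on \<eta> V [] x = LD V (ev \<eta> []) x"
  by (simp add: lie_on_def)

text \<open>The relation [L(V), i(W)] = i({V, W}) read on lists. Inductions over the arguments use
  it as their recursion, and it also settles the case of two sections in
  \<open>derived_generators\<close>.\<close>

lemma lie_on_Cons: "lie_on \<eta> V (W # Ws) x = lie_on (contract W \<eta>) V Ws x - ev \<eta> (br V W # Ws) x"
  by (simp only: lie_on_def ev_contract list.size sum.lessThan_Suc_shift add_Suc_right) simp

lemma lie_on_smooth: "\<eta> \<in> forms A E \<Longrightarrow> V \<in> \<Gamma> \<Longrightarrow> set Vs \<subseteq> \<Gamma> \<Longrightarrow> smooth (lie_on \<eta> V Vs)"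
proof (induction Vs arbitrary: \<eta>)
  case (Cons W Ws)
  then show ?case
    unfolding lie_on_Cons[abs_def]
    by (intro smooth_fun_diff open_UNIV Cons.IH ev_smooth forms_contract) (auto simp: br_closed)
qed (simp add: lie_on_Nil[abs_def] LD_smooth ev_smooth)

lemma lie_on_zero: "V \<in> \<Gamma> \<Longrightarrow> lie_on (\<lambda>x vs. 0) V Vs x = 0"
  using LD_const[of V 0] by (simp add: lie_on_def ev_def[abs_def])

lemma lie_on_add_form:
  assumes "\<eta> \<in> forms A E" "\<omega> \<in> forms A E" "V \<in> \<Gamma>" "set Vs \<subseteq> \<Gamma>"
  shows "lie_on (\<lambda>x vs. \<eta> x vs + \<omega> x vs) V Vs x = lie_on \<eta> V Vs x + lie_on \<omega> V Vs x"
proof -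
  have "ev (\<lambda>x vs. \<eta> x vs + \<omega> x vs) = (\<lambda>Vs x. ev \<eta> Vs x + ev \<omega> Vs x)" by (simp add: ev_def fun_eq_iff)
  then show ?thesis
    using LD_add[OF assms(3) ev_smooth[OF assms(1,4)] ev_smooth[OF assms(2,4)]]
    by (simp add: lie_on_def sum.distrib)
qed

lemma lie_on_scale_form:
  assumes "\<eta> \<in> forms A E" "smooth f" "V \<in> \<Gamma>" "set Vs \<subseteq> \<Gamma>"
  shows "lie_on (\<lambda>x vs. f x * \<eta> x vs) V Vs x = f x * lie_on \<eta> V Vs x + LD V f x * ev \<eta> Vs x"
proof -
  have "ev (\<lambda>x vs. f x * \<eta> x vs) = (\<lambda>Vs x. f x * ev \<eta> Vs x)" by (simp add: ev_def fun_eq_iff)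
  then show ?thesis
    using LD_mult[OF assms(3,2) ev_smooth[OF assms(1,4)]]
    by (simp add: lie_on_def sum_distrib_left algebra_simps)
qed

text \<open>
  \<open>d_on\<close> computes the differential through \<open>i(V) d = \<L>(V) - d i(V)\<close>, which makes its tensoriality
  amenable to induction on the list of sections; \<open>wedge_d Vs f \<eta>\<close> is the value of \<open>df \<and> \<eta>\<close>.
\<close>

primrec d_on :: "('m \<Rightarrow> 'e) list \<Rightarrow> ('m \<Rightarrow> 'e list \<Rightarrow> real) \<Rightarrow> 'm \<Rightarrow> real" where
  "d_on [] \<eta> x = 0"
| "d_on (V # Vs) \<eta> x = lie_on \<eta> V Vs x - d_on Vs (contract V \<eta>) x"

primrec wedge_d :: "('m \<Rightarrow> 'e) list \<Rightarrow> ('m \<Rightarrow> real) \<Rightarrow> ('m \<Rightarrow> 'e list \<Rightarrow> real) \<Rightarrow> 'm \<Rightarrow> real" where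
  "wedge_d [] f \<eta> x = 0"
| "wedge_d (V # Vs) f \<eta> x = LD V f x * ev \<eta> Vs x - wedge_d Vs f (contract V \<eta>) x"

text \<open>Cartan's formula, by splitting off index 0. The terms that neither differentiate along
  \<open>V\<close> nor bracket with it form the formula for \<open>contract V \<eta>\<close> with
  the opposite sign; the rest is the Lie derivative along \<open>V\<close>.\<close>

lemma d_formula_d_on:
  assumes "\<eta> \<in> forms A E" "set Vs \<subseteq> \<Gamma>"
  shows "d_formula A br \<rho> \<eta> Vs x = d_on Vs \<eta> x"
  using assms
proof (induction Vs arbitrary: \<eta>)
  case Nil
  then show ?case by (simp add: d_formula_def)
next
  case (Cons V Vs)
  have o: "omit 0 (V # Vs) = Vs" "omit (Suc i) (V # Vs) = V # omit i Vs" for i and V :: "'m \<Rightarrow> 'e" and Vs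
    by (simp_all add: omit_def)
  have e: "d_formula A br \<rho> \<eta> Vs x = (\<Sum>i<length Vs. (-1) ^ i * LD (Vs ! i) (ev \<eta> (omit i Vs)) x) +
     (\<Sum>j<length Vs. \<Sum>i<j. (-1) ^ (i + j) * ev \<eta> (br (Vs ! i) (Vs ! j) # omit i (omit j Vs)) x)" for \<eta> Vs
    by (simp add: d_formula_def ev_def[abs_def])
  \<comment> \<open>Moving the bracket from the front to the place of the omitted section costs
    \<open>j\<close> transpositions.\<close>
  have 1: "(-1) ^ j * ev \<eta> (br V (Vs ! j) # omit j Vs) x = ev \<eta> (Vs[j := br V (Vs ! j)]) x"
    if "j < length Vs" for j
    using that ev_move[OF Cons.prems(1), of "take j Vs" "br V (Vs ! j)" "drop (Suc j) Vs" x]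
    by (simp add: omit_def upd_conv_take_nth_drop)
  \<comment> \<open>Shifting both indices by one keeps the parity of \<open>i + j\<close>; the sign
    comes from moving \<open>V\<close> in front of the bracket.\<close>
  have 2: "ev \<eta> (W # V # Ws) x = - ev (contract V \<eta>) (W # Ws) x" for W Ws
    using ev_swap[OF Cons.prems(1), of "[]" W "[]" V Ws x] by (simp add: ev_contract)
  have "d_formula A br \<rho> \<eta> (V # Vs) x =
      LD V (ev \<eta> Vs) x - (\<Sum>i<length Vs. (-1) ^ i * LD (Vs ! i) (ev (contract V \<eta>) (omit i Vs)) x) -
      (\<Sum>j<length Vs. (-1) ^ j * ev \<eta> (br V (Vs ! j) # omit j Vs) x +
        (\<Sum>i<j. (-1) ^ (i + j) * ev (contract V \<eta>) (br (Vs ! i) (Vs ! j) # omit i (omit j Vs)) x))"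
    unfolding e
    by (simp add: sum.lessThan_Suc_shift o ev_contract 2 sum_negf sum.distrib sum_subtractf del: sum.lessThan_Suc)
  also have "\<dots> = lie_on \<eta> V Vs x - d_formula A br \<rho> (contract V \<eta>) Vs x"
    by (simp add: e lie_on_def 1 sum.distrib)
  also have "d_formula A br \<rho> (contract V \<eta>) Vs x = d_on Vs (contract V \<eta>) x"
    using Cons by (simp add: forms_contract)
  finally show ?case by simp
qed

lemma d_on_smooth: "\<eta> \<in> forms A E \<Longrightarrow> set Vs \<subseteq> \<Gamma> \<Longrightarrow> smooth (d_on Vs \<eta>)"
proof (induction Vs arbitrary: \<eta>)
  case Nil
  have "d_on [] \<eta> = (\<lambda>x. 0)" by (simp add: fun_eq_iff)
  then show ?case by (simp add: smooth_fun_const)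
next
  case (Cons V Vs)
  then have "smooth (\<lambda>x. lie_on \<eta> V Vs x - d_on Vs (contract V \<eta>) x)"
    by (intro smooth_fun_diff lie_on_smooth open_UNIV) (simp_all add: forms_contract)
  moreover have "d_on (V # Vs) \<eta> = (\<lambda>x. lie_on \<eta> V Vs x - d_on Vs (contract V \<eta>) x)" by (simp add: fun_eq_iff)
  ultimately show ?case by simp
qed

lemma d_on_zero: "set Vs \<subseteq> \<Gamma> \<Longrightarrow> d_on Vs (\<lambda>x vs. 0) x = 0"
  by (induction Vs) (simp_all add: lie_on_zero contract_def)

lemma d_on_add_form:
  assumes "\<eta> \<in> forms A E" "\<omega> \<in> forms A E" "set Vs \<subseteq> \<Gamma>"
  shows "d_on Vs (\<lambda>x vs. \<eta> x vs + \<omega> x vs) x = d_on Vs \<eta> x + d_on Vs \<omega> x"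
  using assms
proof (induction Vs arbitrary: \<eta> \<omega>)
  case (Cons V Vs)
  have "contract V (\<lambda>x vs. \<eta> x vs + \<omega> x vs) = (\<lambda>x vs. contract V \<eta> x vs + contract V \<omega> x vs)"
    by (simp add: contract_def)
  then show ?case using Cons by (simp add: lie_on_add_form forms_contract)
qed simp

text \<open>The Leibniz rule d(f \<eta>) = f d\<eta> + df \<and> \<eta>; its last term has to cancel
  in \<open>d_on_scale\<close>.\<close>

lemma d_on_scale_form:
  assumes "\<eta> \<in> forms A E" "smooth f" "set Vs \<subseteq> \<Gamma>"
  shows "d_on Vs (\<lambda>x vs. f x * \<eta> x vs) x = f x * d_on Vs \<eta> x + wedge_d Vs f \<eta> x"
  using assms
proof (induction Vs arbitrary: \<eta>)
  case (Cons V Vs)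
  have "contract V (\<lambda>x vs. f x * \<eta> x vs) = (\<lambda>x vs. f x * contract V \<eta> x vs)"
    by (simp add: contract_def)
  then show ?case using Cons by (simp add: lie_on_scale_form forms_contract algebra_simps)
qed simp

lemma wedge_d_scale_form: "wedge_d Vs f (\<lambda>x vs. g x * \<eta> x vs) x = g x * wedge_d Vs f \<eta> x"
proof (induction Vs arbitrary: \<eta>)
  case (Cons V Vs)
  have "contract V (\<lambda>x vs. g x * \<eta> x vs) = (\<lambda>x vs. g x * contract V \<eta> x vs)"
    by (simp add: contract_def)
  then show ?case using Cons by (simp add: ev_def algebra_simps)
qed simp

lemma lie_on_add_head:
  assumes "\<eta> \<in> forms A E" "u \<in> \<Gamma>" "v \<in> \<Gamma>" "set Ws \<subseteq> \<Gamma>"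
  shows "lie_on \<eta> (sec_add E u v) Ws x = lie_on \<eta> u Ws x + lie_on \<eta> v Ws x"
  using assms
proof (induction Ws arbitrary: \<eta>)
  case (Cons W Ws)
  then show ?case
    using ev_add[of \<eta> "[]" "br u W" "br v W" Ws x]
    by (simp add: lie_on_Cons forms_contract br_add_left br_closed)
qed (simp add: lie_on_Nil LD_sec_add ev_smooth)

text \<open>Replacing \<open>V\<close> by f V adds df \<and> i(V)\<eta>, because the extra term of
  \<open>br_scale_head\<close> for each argument \<open>W\<close> puts \<open>V\<close> in its slot.
  In the differential this cancels against \<open>d_on_scale_form\<close>.\<close>

lemma lie_on_scale_head:
  assumes "\<eta> \<in> forms A E" "V \<in> \<Gamma>" "smooth f" "set Ws \<subseteq> \<Gamma>"
  shows "lie_on \<eta> (sec_scale E f V) Ws x = f x * lie_on \<eta> V Ws x + wedge_d Ws f (contract V \<eta>) x"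
  using assms
proof (induction Ws arbitrary: \<eta>)
  case (Cons W Ws)
  have W: "W \<in> \<Gamma>" "set Ws \<subseteq> \<Gamma>" using Cons.prems by simp_all
  have "ev \<eta> (br (sec_scale E f V) W # Ws) x = f x * ev \<eta> (br V W # Ws) x - LD W f x * ev \<eta> (V # Ws) x"
    using ev_add[OF Cons.prems(1), of "[]" "sec_scale E f (br V W)" "sec_scale E (\<lambda>x. - LD W f x) V" Ws x]
      ev_scale[OF Cons.prems(1), of "[]" "br V W" Ws f x]
      ev_scale[OF Cons.prems(1), of "[]" V Ws "\<lambda>x. - LD W f x" x] W Cons.prems
      smooth_fun_mult[OF open_UNIV smooth_fun_const[of _ "-1"] LD_smooth[OF W(1) Cons.prems(3)]]
    by (simp add: br_scale_head br_closed sec_scale_closed)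
  moreover have "wedge_d Ws f (contract V (contract W \<eta>)) x = - wedge_d Ws f (contract W (contract V \<eta>)) x"
    using wedge_d_scale_form[of Ws f "\<lambda>_. -1" "contract W (contract V \<eta>)" x]
    by (simp add: contract_swap[OF Cons.prems(1), of V W])
  ultimately show ?case
    using Cons.IH[OF forms_contract[OF Cons.prems(1) W(1)] Cons.prems(2,3) W(2)]
    by (simp add: lie_on_Cons ev_contract algebra_simps)
qed (simp add: lie_on_Nil LD_sec_scale ev_smooth)

lemma lie_on_add_tail:
  assumes "\<eta> \<in> forms A E" "U \<in> \<Gamma>" "set us \<subseteq> \<Gamma>" "u \<in> \<Gamma>" "v \<in> \<Gamma>" "set ws \<subseteq> \<Gamma>"
  shows "lie_on \<eta> U (us @ sec_add E u v # ws) x = lie_on \<eta> U (us @ u # ws) x + lie_on \<eta> U (us @ v # ws) x"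
  using assms
proof (induction us arbitrary: \<eta>)
  case Nil
  then show ?case
    using ev_add[of \<eta> "[]" "br U u" "br U v" ws x]
    by (simp add: lie_on_Cons contract_sec_add lie_on_add_form forms_contract br_add_right br_closed)
next
  case (Cons c us)
  then show ?case
    using ev_add[of \<eta> "br U c # us" u v ws x] by (simp add: lie_on_Cons forms_contract br_closed)
qed

text \<open>The derivative of \<open>f\<close> arising from the Lie derivative of the value cancels
  against that in the Leibniz rule for the bracket with the scaled argument.\<close>

lemma lie_on_scale_tail:
  assumes "\<eta> \<in> forms A E" "U \<in> \<Gamma>" "set us \<subseteq> \<Gamma>" "u \<in> \<Gamma>" "smooth f" "set ws \<subseteq> \<Gamma>"
  shows "lie_on \<eta> U (us @ sec_scale E f u # ws) x = f x * lie_on \<eta> U (us @ u # ws) x"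
  using assms
proof (induction us arbitrary: \<eta>)
  case Nil
  then show ?case
    using ev_add[of \<eta> "[]" "sec_scale E f (br U u)" "sec_scale E (LD U f) u" ws x]
      ev_scale[of \<eta> "[]" "br U u" ws f x] ev_scale[of \<eta> "[]" u ws "LD U f" x]
    by (simp add: lie_on_Cons contract_sec_scale lie_on_scale_form forms_contract br_leibniz br_closed
        sec_scale_closed LD_smooth ev_contract algebra_simps)
next
  case (Cons c us)
  then show ?case
    using ev_scale[of \<eta> "br U c # us" u ws f x]
    by (simp add: lie_on_Cons forms_contract br_closed ev_contract algebra_simps)
qed

text \<open>If \<omega> vanishes as soon as \<open>v\<close> is an argument, only the summand whose
  bracket replaces \<open>v\<close> survives. Meant for \<omega> = i(v)\<eta>.\<close>

lemma lie_on_kill: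
  assumes "\<And>us ws x. ev \<omega> (us @ v # ws) x = 0" "U \<in> \<Gamma>"
  shows "lie_on \<omega> U (vs @ v # ws) x = - ev \<omega> (vs @ br U v # ws) x"
  using assms(1)
proof (induction vs arbitrary: \<omega>)
  case Nil
  have "ev (contract v \<omega>) Vs x = 0" for Vs x using Nil[of "[]" Vs x] by (simp add: ev_contract)
  then have "lie_on (contract v \<omega>) U ws x = lie_on (\<lambda>x vs. 0) U ws x" unfolding lie_on_def by (simp add: ev_def[abs_def])
  then show ?case by (simp add: lie_on_Cons lie_on_zero[OF assms(2)])
next
  case (Cons c vs)
  have "ev (contract c \<omega>) (us @ v # ws) x = 0" for us ws x
    using Cons.prems[of "c # us"] by (simp add: ev_contract)
  from Cons.IH[OF this] show ?case
    using Cons.prems[of "br U c # vs"] by (simp add: lie_on_Cons ev_contract)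
qed

text \<open>The value itself is zero, the brackets with other arguments keep the repetition, and the
  two brackets hitting the copies of \<open>v\<close> cancel by antisymmetry.\<close>

lemma lie_on_alt:
  assumes "\<eta> \<in> forms A E" "U \<in> \<Gamma>" "set us \<subseteq> \<Gamma>"
  shows "lie_on \<eta> U (us @ v # vs @ v # ws) x = 0"
  using assms(1,3)
proof (induction us arbitrary: \<eta>)
  case Nil
  have "ev (contract v \<eta>) (us @ v # ws) x = 0" for us ws x
    using ev_alt[OF Nil(1), of "[]" v us ws x] by (simp add: ev_contract)
  from lie_on_kill[OF this assms(2)] show ?case
    using ev_swap[OF Nil(1), of "[]" v vs "br U v" ws x] by (simp add: lie_on_Cons ev_contract)
next
  case (Cons c us)
  then show ?case
    using ev_alt[OF Cons.prems(1), of "br U c # us" v vs ws x] by (simp add: lie_on_Cons forms_contract)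
qed

section \<open>Tensoriality of the differential\<close>

lemma d_on_add:
  assumes "\<eta> \<in> forms A E" "set us \<subseteq> \<Gamma>" "u \<in> \<Gamma>" "v \<in> \<Gamma>" "set ws \<subseteq> \<Gamma>"
  shows "d_on (us @ sec_add E u v # ws) \<eta> x = d_on (us @ u # ws) \<eta> x + d_on (us @ v # ws) \<eta> x"
  using assms
  by (induction us arbitrary: \<eta>)
    (simp_all add: lie_on_add_head lie_on_add_tail contract_sec_add d_on_add_form forms_contract)

text \<open>If the scaled section comes first, the terms with df from
  \<open>lie_on_scale_head\<close> and \<open>d_on_scale_form\<close> cancel; further to the right
  \<open>lie_on_scale_tail\<close> and induction apply.\<close>

lemma d_on_scale:
  assumes "\<eta> \<in> forms A E" "set us \<subseteq> \<Gamma>" "u \<in> \<Gamma>" "smooth f" "set ws \<subseteq> \<Gamma>"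
  shows "d_on (us @ sec_scale E f u # ws) \<eta> x = f x * d_on (us @ u # ws) \<eta> x"
  using assms
  by (induction us arbitrary: \<eta>)
    (simp_all add: lie_on_scale_head lie_on_scale_tail contract_sec_scale d_on_scale_form forms_contract algebra_simps)

text \<open>After unfolding twice, the two Lie derivatives along \<open>V\<close> of i(V)\<eta>
  cancel; left are the value on the bracket of \<open>V\<close> with itself and the differential of
  i(V)i(V)\<eta>, both zero.\<close>

lemma d_on_repeat:
  assumes "\<eta> \<in> forms A E" "V \<in> \<Gamma>" "set Us \<subseteq> \<Gamma>"
  shows "d_on (V # V # Us) \<eta> x = 0"
proof -
  have "ev \<eta> (br V V # Us) x = ev \<eta> ([] @ sec_scale E (\<lambda>_. - 1) (br V V) # Us) x"
    using br_antisym[OF assms(2,2)] by simp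
  also have "\<dots> = - ev \<eta> (br V V # Us) x"
    using ev_scale[OF assms(1), of "[]" "br V V" Us "\<lambda>_. - 1" x] assms by (simp add: br_closed)
  finally have "ev \<eta> (br V V # Us) x = 0" by simp
  moreover have "contract V (contract V \<eta>) = (\<lambda>x vs. 0)"
    using ext_alt[OF forms_ext[OF assms(1)], of _ "[]" _ "[]"] by (simp add: contract_def)
  ultimately show ?thesis by (simp add: lie_on_Cons d_on_zero[OF assms(3)])
qed

lemma d_on_swap:
  assumes "\<eta> \<in> forms A E" "V \<in> \<Gamma>" "W \<in> \<Gamma>" "set Us \<subseteq> \<Gamma>"
  shows "d_on (V # W # Us) \<eta> x = - d_on (W # V # Us) \<eta> x"
proof -
  have VW: "sec_add E V W \<in> \<Gamma>" using assms by (simp add: sec_add_closed)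
  have "0 = d_on (sec_add E V W # sec_add E V W # Us) \<eta> x"
    using d_on_repeat[OF assms(1) VW assms(4)] by simp
  also have "\<dots> = d_on (V # V # Us) \<eta> x + d_on (V # W # Us) \<eta> x + (d_on (W # V # Us) \<eta> x + d_on (W # W # Us) \<eta> x)"
    using d_on_add[OF assms(1), of "[]" V W "sec_add E V W # Us" x] d_on_add[OF assms(1), of "[V]" V W Us x]
      d_on_add[OF assms(1), of "[W]" V W Us x] assms VW by (simp del: d_on.simps)
  finally show ?thesis using d_on_repeat[OF assms(1)] assms by (simp del: d_on.simps)
qed

lemma d_on_alt:
  assumes "\<eta> \<in> forms A E" "set us \<subseteq> \<Gamma>" "v \<in> \<Gamma>" "set vs \<subseteq> \<Gamma>" "set ws \<subseteq> \<Gamma>"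
  shows "d_on (us @ v # vs @ v # ws) \<eta> x = 0"
  using assms(1,2)
proof (induction us arbitrary: \<eta>)
  case Nil
  show ?case using assms(4) Nil(1)
  proof (induction vs arbitrary: \<eta>)
    case Nil
    then show ?case using d_on_repeat[of \<eta> v ws x] assms by simp
  next
    case (Cons w vs)
    \<comment> \<open>The first copy of \<open>v\<close> is moved past \<open>w\<close>; unfolding
      at \<open>w\<close> then leaves a Lie derivative on arguments with a repetition and a shorter
      instance.\<close>
    have "d_on ([] @ v # (w # vs) @ v # ws) \<eta> x = - d_on (w # v # vs @ v # ws) \<eta> x"
      using d_on_swap[of \<eta> v w "vs @ v # ws" x] Cons.prems assms by (simp del: d_on.simps)
    also have "\<dots> = d_on (v # vs @ v # ws) (contract w \<eta>) x"
      using lie_on_alt[of \<eta> w "[]" v vs ws x] Cons.prems by simp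
    also have "\<dots> = 0" using Cons.IH[of "contract w \<eta>"] Cons.prems by (simp add: forms_contract)
    finally show ?case .
  qed
next
  case (Cons c us)
  then show ?case by (simp add: lie_on_alt forms_contract)
qed

text \<open>Degree count: the differential raises the degree by at most one, so vanishing from
  length \<open>N\<close> on becomes vanishing beyond \<open>N\<close>.\<close>

lemma d_on_bound:
  assumes "\<And>x vs. N \<le> length vs \<Longrightarrow> \<eta> x vs = 0" "N < length Vs" "set Vs \<subseteq> \<Gamma>"
  shows "d_on Vs \<eta> x = 0"
  using assms
proof (induction Vs arbitrary: \<eta> N)
  case (Cons V Vs)
  have "ev \<eta> Vs' y = 0" if "length Vs' = length Vs" for Vs' y
    using Cons.prems(1,2) that by (simp add: ev_def)
  then have "lie_on \<eta> V Vs x = lie_on (\<lambda>x vs. 0) V Vs x" by (simp add: lie_on_def ev_def[abs_def])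
  moreover have "d_on Vs (contract V \<eta>) x = 0"
  \<comment> \<open>A contraction lowers the bound to \<open>N - 1\<close>; the truncated
    subtraction is harmless when the remaining list is nonempty.\<close>
  proof (cases Vs)
    case (Cons W Ws)
    show ?thesis
      by (rule Cons.IH[of "N - 1"]) (use Cons.prems Cons in \<open>auto simp: contract_def\<close>)
  qed simp
  ultimately show ?case using Cons.prems(3) by (simp add: lie_on_zero)
qed simp

abbreviation "D \<equiv> d_rho A E br \<rho>"

text \<open>Justifies the \<open>THE\<close>: existence is \<open>form_of_tensor\<close>, uniqueness
  that a form is known from its values on global sections. From here on only these two facts about
  \<open>d_rho\<close> enter.\<close>

lemma d_rho_spec:
  assumes "\<eta> \<in> forms A E"
  shows D_forms: "D \<eta> \<in> forms A E"
    and D_ev: "set Vs \<subseteq> \<Gamma> \<Longrightarrow> ev (D \<eta>) Vs x = d_on Vs \<eta> x"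
proof -
  obtain N where N: "\<And>x vs. N < length vs \<Longrightarrow> \<eta> x vs = 0" using assms by (rule forms_bounded) blast
  obtain \<omega> where \<omega>: "\<omega> \<in> forms A E" "\<And>Vs x. set Vs \<subseteq> \<Gamma> \<Longrightarrow> \<omega> x (map (\<lambda>V. V x) Vs) = d_on Vs \<eta> x"
  proof (rule form_of_tensor[of "\<lambda>Vs. d_on Vs \<eta>" "Suc N"])
    show "d_on Vs \<eta> x = 0" if "set Vs \<subseteq> \<Gamma>" "Suc N < length Vs" for Vs x
      by (rule d_on_bound[of "Suc N"]) (use that N in auto)
  qed (use assms in \<open>simp_all add: d_on_add d_on_scale d_on_alt d_on_smooth\<close>)
  let ?P = "\<lambda>\<omega>. \<omega> \<in> forms A E \<and>
     (\<forall>Vs x. set Vs \<subseteq> sections A E \<longrightarrow> \<omega> x (map (\<lambda>V. V x) Vs) = d_formula A br \<rho> \<eta> Vs x)"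
  have "\<exists>!\<omega>. ?P \<omega>"
  proof (rule ex1I)
    show "?P \<omega>" using \<omega> d_formula_d_on[OF assms] by simp
    show "\<omega>' = \<omega>" if "?P \<omega>'" for \<omega>'
      by (rule forms_eqI) (use that \<omega> d_formula_d_on[OF assms] in auto)
  qed
  from theI'[OF this] have D: "?P (D \<eta>)" unfolding d_rho_def .
  then show "D \<eta> \<in> forms A E" by blast
  show "ev (D \<eta>) Vs x = d_on Vs \<eta> x" if "set Vs \<subseteq> \<Gamma>"
    using D that d_formula_d_on[OF assms that] by (simp add: ev_def)
qed

lemma d_on_local:
  assumes "\<eta> \<in> forms A E" "\<omega> \<in> forms A E" "open N" "x \<in> N" "\<And>y. y \<in> N \<Longrightarrow> \<eta> y = \<omega> y" "set Vs \<subseteq> \<Gamma>"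
  shows "d_on Vs \<eta> x = d_on Vs \<omega> x"
  using assms(1,2,5,6)
proof (induction Vs arbitrary: \<eta> \<omega>)
  case (Cons V Vs)
  have "lie_on \<eta> V Vs x = lie_on \<omega> V Vs x"
    using LD_cong[OF _ ev_smooth ev_smooth assms(3,4), of V \<eta> Vs \<omega> Vs] Cons.prems assms(4)
    by (simp add: lie_on_def ev_def)
  moreover have "d_on Vs (contract V \<eta>) x = d_on Vs (contract V \<omega>) x"
    by (rule Cons.IH) (use Cons.prems in \<open>simp_all add: forms_contract, simp add: contract_def\<close>)
  ultimately show ?case by simp
qed simp

text \<open>Locality of the differential, which allows the operators around it to be replaced near a
  point.\<close>

lemma D_local:
  assumes "\<eta> \<in> forms A E" "\<omega> \<in> forms A E" "open N" "x \<in> N" "\<And>y. y \<in> N \<Longrightarrow> \<eta> y = \<omega> y"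
  shows "D \<eta> x = D \<omega> x"
proof
  fix vs
  show "D \<eta> x vs = D \<omega> x vs"
  proof (cases "set vs \<subseteq> fibre E x")
    case True
    then obtain Vs where "set Vs \<subseteq> \<Gamma>" "map (\<lambda>V. V x) Vs = vs" by (rule sections_through)
    then show ?thesis using D_ev[of _ Vs x] d_on_local[OF assms] assms by (metis ev_def)
  qed (simp add: ext_supp[OF forms_ext[OF D_forms]] assms)
qed

end

section \<open>Graded brackets of interior products\<close>

text \<open>Degrees may be negative, so signs are integer powers; sign identities are then decided
  by parity.\<close>

lemma sgn_powi: "(- 1 :: real) powi n = (if even n then 1 else - 1)"
  by (auto simp: power_int_def even_nat_iff)

context lie_algebroid
begin

type_synonym ('x, 'y) form_op = "('x \<Rightarrow> 'y list \<Rightarrow> real) \<Rightarrow> 'x \<Rightarrow> 'y list \<Rightarrow> real"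

text \<open>Linearity over the reals only, since \<open>D\<close> is not linear over functions; it
  is asserted on forms, the arguments for which \<open>d_rho\<close> has been characterised.\<close>

definition linear_op :: "('m, 'e) form_op \<Rightarrow> bool" where
  "linear_op T \<longleftrightarrow> (\<forall>\<eta>\<in>forms A E. T \<eta> \<in> forms A E \<and> (\<forall>\<omega>\<in>forms A E. \<forall>c.
     T (\<lambda>x vs. \<eta> x vs + c * \<omega> x vs) = (\<lambda>x vs. T \<eta> x vs + c * T \<omega> x vs)))"

lemma linear_op_forms: "linear_op T \<Longrightarrow> \<eta> \<in> forms A E \<Longrightarrow> T \<eta> \<in> forms A E"
  by (simp add: linear_op_def)

lemma linear_op_combine:
  "linear_op T \<Longrightarrow> \<eta> \<in> forms A E \<Longrightarrow> \<omega> \<in> forms A E \<Longrightarrow>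
    T (\<lambda>x vs. \<eta> x vs + c * \<omega> x vs) = (\<lambda>x vs. T \<eta> x vs + c * T \<omega> x vs)"
  by (simp add: linear_op_def)

lemma linear_op_diff:
  "linear_op T \<Longrightarrow> \<eta> \<in> forms A E \<Longrightarrow> \<omega> \<in> forms A E \<Longrightarrow>
    T (\<lambda>x vs. \<eta> x vs - c * \<omega> x vs) = (\<lambda>x vs. T \<eta> x vs - c * T \<omega> x vs)"
  using linear_op_combine[of T \<eta> \<omega> "- c"] by simp

lemma linear_op_zero: "linear_op T \<Longrightarrow> T (\<lambda>x vs. 0) = (\<lambda>x vs. 0)"
  using linear_op_combine[of T "\<lambda>x vs. 0" "\<lambda>x vs. 0" "- 1"] by (simp add: forms_zero)

lemma linear_op_cmult:
  "linear_op T \<Longrightarrow> \<eta> \<in> forms A E \<Longrightarrow> T (\<lambda>x vs. c * \<eta> x vs) = (\<lambda>x vs. c * T \<eta> x vs)"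
  using linear_op_combine[of T "\<lambda>x vs. 0" \<eta> c] by (simp add: forms_zero linear_op_zero)

lemma linear_op_add:
  "linear_op T \<Longrightarrow> \<eta> \<in> forms A E \<Longrightarrow> \<omega> \<in> forms A E \<Longrightarrow>
    T (\<lambda>x vs. \<eta> x vs + \<omega> x vs) = (\<lambda>x vs. T \<eta> x vs + T \<omega> x vs)"
  using linear_op_combine[of T \<eta> \<omega> 1] by simp

lemma linear_op_comp: "linear_op F \<Longrightarrow> linear_op G \<Longrightarrow> linear_op (\<lambda>\<eta>. F (G \<eta>))"
  by (simp add: linear_op_def)

lemma linear_op_plus:
  assumes "linear_op F" "linear_op G"
  shows "linear_op (\<lambda>\<eta> x vs. F \<eta> x vs + G \<eta> x vs)"
  unfolding linear_op_def[of "\<lambda>\<eta> x vs. F \<eta> x vs + G \<eta> x vs"]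
  by (intro ballI conjI allI)
    (simp_all add: forms_add linear_op_forms[OF assms(1)] linear_op_forms[OF assms(2)]
      linear_op_combine[OF assms(1)] linear_op_combine[OF assms(2)] algebra_simps)

lemma linear_op_graded_bracket:
  assumes "linear_op F" "linear_op G"
  shows "linear_op (graded_bracket k F l G)"
  using linear_op_comp[OF assms] linear_op_comp[OF assms(2,1)]
  unfolding linear_op_def graded_bracket_def
  by (auto simp: forms_diff) (auto simp: algebra_simps)

lemma linear_op_D: "linear_op D"
proof -
  have "D (\<lambda>x vs. \<eta> x vs + c * \<omega> x vs) = (\<lambda>x vs. D \<eta> x vs + c * D \<omega> x vs)"
    if "\<eta> \<in> forms A E" "\<omega> \<in> forms A E" for \<eta> \<omega> c
  proof (rule forms_eqI)
    have c\<omega>: "(\<lambda>x vs. c * \<omega> x vs) \<in> forms A E" by (rule forms_scale[OF that(2) smooth_fun_const])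
    have c: "(\<lambda>x vs. \<eta> x vs + c * \<omega> x vs) \<in> forms A E" by (rule forms_add[OF that(1) c\<omega>])
    show "D (\<lambda>x vs. \<eta> x vs + c * \<omega> x vs) \<in> forms A E" by (rule D_forms[OF c])
    show "(\<lambda>x vs. D \<eta> x vs + c * D \<omega> x vs) \<in> forms A E"
      by (intro forms_add forms_scale smooth_fun_const D_forms that)
    fix Vs x assume Vs: "set Vs \<subseteq> \<Gamma>"
    \<comment> \<open>A constant has zero derivative, so the Leibniz defect disappears.\<close>
    have "wedge_d Vs (\<lambda>_. c) \<omega> x = 0" for \<omega>
      using Vs by (induction Vs arbitrary: \<omega>) (simp_all add: LD_const)
    then have "d_on Vs (\<lambda>x vs. \<eta> x vs + c * \<omega> x vs) x = d_on Vs \<eta> x + c * d_on Vs \<omega> x"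
      using d_on_add_form[OF that(1) c\<omega> Vs] d_on_scale_form[OF that(2) smooth_fun_const Vs, of c] by simp
    then show "D (\<lambda>x vs. \<eta> x vs + c * \<omega> x vs) x (map (\<lambda>V. V x) Vs) =
        D \<eta> x (map (\<lambda>V. V x) Vs) + c * D \<omega> x (map (\<lambda>V. V x) Vs)"
      using D_ev[OF _ Vs, unfolded ev_def] that c by simp
  qed
  then show ?thesis by (simp add: linear_op_def D_forms)
qed

section \<open>Sums of contractions\<close>

text \<open>The interior product by a sum of multivectors f V_1 \<and> ... \<and> V_p with globally
  defined factors.\<close>

definition contract_sum :: "(('m \<Rightarrow> real) \<times> ('m \<Rightarrow> 'e) list) list \<Rightarrow> ('m, 'e) form_op" where
  "contract_sum ts \<eta> = (\<lambda>x vs. \<Sum>(f, Vs)\<leftarrow>ts. f x * foldr contract Vs \<eta> x vs)"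

lemma contract_sum_Nil: "contract_sum [] = (\<lambda>\<eta> x vs. 0)"
  by (simp add: contract_sum_def fun_eq_iff)

lemma contract_sum_Cons:
  "contract_sum ((f, Vs) # ts) = (\<lambda>\<eta> x vs. f x * foldr contract Vs \<eta> x vs + contract_sum ts \<eta> x vs)"
  by (simp add: contract_sum_def fun_eq_iff)

definition contract_terms :: "int \<Rightarrow> (('m \<Rightarrow> real) \<times> ('m \<Rightarrow> 'e) list) list \<Rightarrow> bool" where
  "contract_terms n ts \<longleftrightarrow> (\<forall>(f, Vs)\<in>set ts. smooth f \<and> set Vs \<subseteq> \<Gamma> \<and> int (length Vs) = n)"

text \<open>\<open>T\<close> is the interior product by some such sum of degree \<open>n\<close>;
  agreement is required on forms only, where the operator identities hold. For negative
  \<open>n\<close> only an operator that is zero on forms qualifies.\<close>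

definition contraction :: "int \<Rightarrow> ('m, 'e) form_op \<Rightarrow> bool" where
  "contraction n T \<longleftrightarrow> (\<exists>ts. contract_terms n ts \<and> (\<forall>\<eta>\<in>forms A E. T \<eta> = contract_sum ts \<eta>))"

lemma contraction_cong: "contraction n T \<Longrightarrow> (\<And>\<eta>. \<eta> \<in> forms A E \<Longrightarrow> T' \<eta> = T \<eta>) \<Longrightarrow> contraction n T'"
  by (auto simp: contraction_def)

lemma contraction_zero: "contraction n (\<lambda>\<eta> x vs. 0)"
  unfolding contraction_def by (rule exI[of _ "[]"]) (simp add: contract_terms_def contract_sum_def)

lemma contraction_id: "contraction 0 (\<lambda>\<eta>. \<eta>)"
  unfolding contraction_def
  by (rule exI[of _ "[(\<lambda>_. 1, [])]"]) (simp add: contract_terms_def contract_sum_def smooth_fun_const)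

lemma contraction_add: "contraction n T \<Longrightarrow> contraction n T' \<Longrightarrow> contraction n (\<lambda>\<eta> x vs. T \<eta> x vs + T' \<eta> x vs)"
proof -
  assume "contraction n T" "contraction n T'"
  then obtain ts ts' where "contract_terms n ts" "contract_terms n ts'" "\<forall>\<eta>\<in>forms A E. T \<eta> = contract_sum ts \<eta>"
    "\<forall>\<eta>\<in>forms A E. T' \<eta> = contract_sum ts' \<eta>" by (auto simp: contraction_def)
  then show ?thesis unfolding contraction_def by (intro exI[of _ "ts @ ts'"]) (auto simp: contract_terms_def contract_sum_def)
qed

lemma contraction_map:
  assumes "contraction n T"
    and "\<And>f Vs. smooth f \<Longrightarrow> set Vs \<subseteq> \<Gamma> \<Longrightarrow> int (length Vs) = n \<Longrightarrow>
      smooth (fst (h f Vs)) \<and> set (snd (h f Vs)) \<subseteq> \<Gamma> \<and> int (length (snd (h f Vs))) = m"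
    and "\<And>ts \<eta>. \<eta> \<in> forms A E \<Longrightarrow> contract_terms n ts \<Longrightarrow> T \<eta> = contract_sum ts \<eta> \<Longrightarrow>
      T' \<eta> = contract_sum (map (\<lambda>(f, Vs). h f Vs) ts) \<eta>"
  shows "contraction m T'"
proof -
  obtain ts where ts: "contract_terms n ts" "\<forall>\<eta>\<in>forms A E. T \<eta> = contract_sum ts \<eta>" using assms(1) by (auto simp: contraction_def)
  show ?thesis unfolding contraction_def
  proof (intro exI conjI ballI)
    show "contract_terms m (map (\<lambda>(f, Vs). h f Vs) ts)"
      unfolding contract_terms_def
    proof
      fix t assume "t \<in> set (map (\<lambda>(f, Vs). h f Vs) ts)"
      then obtain f Vs where t: "(f, Vs) \<in> set ts" "t = h f Vs" by auto
      then have "smooth f" "set Vs \<subseteq> \<Gamma>" "int (length Vs) = n" using ts(1) by (auto simp: contract_terms_def)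
      from assms(2)[OF this]
      show "case t of (f, Vs) \<Rightarrow> smooth f \<and> set Vs \<subseteq> \<Gamma> \<and> int (length Vs) = m"
        by (simp add: case_prod_unfold t(2))
    qed
    show "T' \<eta> = contract_sum (map (\<lambda>(f, Vs). h f Vs) ts) \<eta>" if "\<eta> \<in> forms A E" for \<eta>
      using assms(3)[OF that ts(1)] ts(2) that by blast
  qed
qed

lemma contraction_scale:
  assumes "smooth g" "contraction n T"
  shows "contraction n (\<lambda>\<eta> x vs. g x * T \<eta> x vs)"
  by (rule contraction_map[OF assms(2), where h = "\<lambda>f Vs. (\<lambda>x. g x * f x, Vs)"])
    (use assms(1) in \<open>simp_all add: smooth_fun_mult contract_sum_def case_prod_unfold o_def mult.assoc flip: sum_list_const_mult\<close>)

lemma contraction_contract: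
  assumes "V \<in> \<Gamma>" "contraction n T"
  shows "contraction (n + 1) (\<lambda>\<eta>. contract V (T \<eta>))"
  by (rule contraction_map[OF assms(2), where h = "\<lambda>f Vs. (f, V # Vs)"])
    (use assms(1) in \<open>simp_all add: contract_sum_def case_prod_unfold o_def contract_def\<close>)

lemma foldr_contract: "foldr contract Vs \<eta> x ws = \<eta> x (rev (map (\<lambda>V. V x) Vs) @ ws)"
  by (induction Vs arbitrary: ws) (simp_all add: contract_def)

text \<open>In a \<open>foldr\<close> the innermost contraction comes last in the list, so
  \<open>V\<close> is appended.\<close>

lemma contraction_contract_right:
  assumes "V \<in> \<Gamma>" "contraction n T"
  shows "contraction (n + 1) (\<lambda>\<eta>. T (contract V \<eta>))"
proof -
  obtain ts where ts: "contract_terms n ts" "\<forall>\<eta>\<in>forms A E. T \<eta> = contract_sum ts \<eta>" using assms(2) by (auto simp: contraction_def)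
  let ?ts = "map (\<lambda>(f, Vs). (f, Vs @ [V])) ts"
  have "contract_terms (n + 1) ?ts" using ts(1) assms(1) by (fastforce simp: contract_terms_def)
  moreover have "T (contract V \<eta>) = contract_sum ?ts \<eta>" if "\<eta> \<in> forms A E" for \<eta>
    using ts(2) forms_contract[OF that assms(1)] by (simp add: contract_sum_def case_prod_unfold o_def)
  ultimately show ?thesis unfolding contraction_def by blast
qed

lemma contraction_scale_right:
  assumes "smooth g" "contraction n T"
  shows "contraction n (\<lambda>\<eta>. T (\<lambda>x vs. g x * \<eta> x vs))"
proof -
  obtain ts where ts: "contract_terms n ts" "\<forall>\<eta>\<in>forms A E. T \<eta> = contract_sum ts \<eta>" using assms(2) by (auto simp: contraction_def)
  let ?ts = "map (\<lambda>(f, Vs). (\<lambda>x. f x * g x, Vs)) ts"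
  have "contract_terms n ?ts" using ts(1) assms(1) by (auto simp: contract_terms_def intro: smooth_fun_mult)
  moreover have "T (\<lambda>x vs. g x * \<eta> x vs) = contract_sum ?ts \<eta>" if "\<eta> \<in> forms A E" for \<eta>
    using ts(2) forms_scale[OF that assms(1)]
    by (simp add: contract_sum_def case_prod_unfold o_def foldr_contract mult.assoc)
  ultimately show ?thesis unfolding contraction_def by blast
qed

section \<open>Words in functions and contractions\<close>

inductive generator :: "int \<Rightarrow> ('m, 'e) form_op \<Rightarrow> bool" where
  gen_fun: "smooth f \<Longrightarrow> generator 0 (\<lambda>\<eta> x vs. f x * \<eta> x vs)"
| gen_sec: "V \<in> \<Gamma> \<Longrightarrow> generator 1 (contract V)"

text \<open>Monomials as iterated compositions, to have an induction principle for the Leibniz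
  arguments; the index is the degree of the multivector, opposite to that of the operator.\<close>

inductive word :: "int \<Rightarrow> ('m, 'e) form_op \<Rightarrow> bool" where
  word_id: "word 0 (\<lambda>\<eta>. \<eta>)"
| word_generator: "generator k G \<Longrightarrow> word n T \<Longrightarrow> word (k + n) (\<lambda>\<eta>. G (T \<eta>))"

lemma linear_op_generator: "generator k G \<Longrightarrow> linear_op G"
proof (induction rule: generator.induct)
  case (gen_fun f)
  then show ?case by (simp add: linear_op_def forms_scale algebra_simps)
next
  case (gen_sec V)
  then show ?case by (simp add: linear_op_def forms_contract) (simp add: contract_def)
qed

lemma linear_op_word: "word n T \<Longrightarrow> linear_op T"
  by (induction rule: word.induct) (simp_all add: linear_op_comp linear_op_generator, simp add: linear_op_def)

lemma contraction_generator_left: "generator k G \<Longrightarrow> contraction n T \<Longrightarrow> contraction (k + n) (\<lambda>\<eta>. G (T \<eta>))"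
  by (induction rule: generator.induct) (simp_all add: contraction_scale contraction_contract add.commute[of 1])

lemma contraction_generator_right: "generator k G \<Longrightarrow> contraction n T \<Longrightarrow> contraction (n + k) (\<lambda>\<eta>. T (G \<eta>))"
  by (induction rule: generator.induct) (simp_all add: contraction_scale_right contraction_contract_right)

lemma contraction_word_right: "word m T' \<Longrightarrow> contraction n T \<Longrightarrow> contraction (n + m) (\<lambda>\<eta>. T (T' \<eta>))"
proof (induction arbitrary: n T rule: word.induct)
  case (word_generator k G m T')
  then show ?case using word_generator.IH[OF contraction_generator_right[OF word_generator.hyps(1) word_generator.prems]]
    by (simp add: add.assoc)
qed simp

lemma contraction_cmult: "contraction n T \<Longrightarrow> contraction n (\<lambda>\<eta> x vs. c * T \<eta> x vs)"
  by (rule contraction_scale[OF smooth_fun_const])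

text \<open>The sign is trivial unless both generators are contractions, and these anticommute
  because forms alternate.\<close>

lemma generator_commute:
  assumes "generator k G" "generator l H" "\<eta> \<in> forms A E"
  shows "G (H \<eta>) = (\<lambda>x vs. (- 1) powi (k * l) * H (G \<eta>) x vs)"
  using assms(1)
proof cases
  case G: (gen_fun f)
  from assms(2) show ?thesis
    by cases (simp_all add: G mult.left_commute contract_def)
next
  case G: (gen_sec V)
  from assms(2) show ?thesis
  proof cases
    case (gen_sec W)
    show ?thesis using contract_swap[OF assms(3), of V W] by (simp add: G gen_sec)
  qed (simp add: G contract_def)
qed

lemma generator_word_commute:
  assumes "word n T" "generator k G" "\<eta> \<in> forms A E"
  shows "T (G \<eta>) = (\<lambda>x vs. (- 1) powi (n * k) * G (T \<eta>) x vs)"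
  using assms(1)
proof induction
  case (word_generator l H m T)
  note f = linear_op_forms[OF linear_op_word[OF word_generator.hyps(2)] assms(3)]
  have "H (T (G \<eta>)) = (\<lambda>x vs. (- 1) powi (m * k) * H (G (T \<eta>)) x vs)"
    unfolding word_generator.IH by (rule linear_op_cmult[OF linear_op_generator[OF word_generator.hyps(1)]
        linear_op_forms[OF linear_op_generator[OF assms(2)] f]])
  then show ?case
    by (simp add: generator_commute[OF word_generator.hyps(1) assms(2) f] sgn_powi)
qed simp

lemma word_commute:
  assumes "word n T" "word m T'" "\<eta> \<in> forms A E"
  shows "T (T' \<eta>) = (\<lambda>x vs. (- 1) powi (n * m) * T' (T \<eta>) x vs)"
  using assms(2)
proof induction
  case (word_generator l H m T')
  note f = linear_op_forms[OF linear_op_word[OF word_generator.hyps(2)] assms(3)]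
  note g = linear_op_forms[OF linear_op_word[OF assms(1)] assms(3)]
  have "H (T (T' \<eta>)) = (\<lambda>x vs. (- 1) powi (n * m) * H (T' (T \<eta>)) x vs)"
    unfolding word_generator.IH by (rule linear_op_cmult[OF linear_op_generator[OF word_generator.hyps(1)]
        linear_op_forms[OF linear_op_word[OF word_generator.hyps(2)] g]])
  then show ?case
    by (simp add: generator_word_commute[OF assms(1) word_generator.hyps(1) f] sgn_powi)
qed simp

section \<open>Derived brackets\<close>

text \<open>The brackets receive the degrees of the operators: -p for an interior product, 1 for
  \<open>D\<close>, their sum for the inner bracket; \<open>p\<close> and \<open>q\<close>
  themselves are multivector degrees.\<close>

abbreviation "derived p P q Q \<equiv> graded_bracket (- p + 1) (graded_bracket (- p) P 1 D) (- q) Q"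

lemma linear_op_derived: "linear_op P \<Longrightarrow> linear_op Q \<Longrightarrow> linear_op (derived p P q Q)"
  by (intro linear_op_graded_bracket linear_op_D)

lemma derived_generators:
  assumes "generator k G" "generator l H"
  shows "contraction (k + l - 1) (derived k G l H)"
proof -
  have eqI: "derived k G l H \<eta> = \<omega>" if "\<eta> \<in> forms A E" "\<omega> \<in> forms A E"
    "\<And>Vs x. set Vs \<subseteq> \<Gamma> \<Longrightarrow> ev (derived k G l H \<eta>) Vs x = ev \<omega> Vs x" for \<eta> \<omega>
    by (rule forms_eqI[OF linear_op_forms[OF linear_op_derived that(1)]])
      (use assms that in \<open>simp_all add: linear_op_generator ev_def\<close>)
  \<comment> \<open>[f, d] is minus the product with df, by the Leibniz rule.\<close>
  have lD: "ev (graded_bracket 0 (\<lambda>\<eta> x vs. f x * \<eta> x vs) 1 D \<eta>) Vs x = - wedge_d Vs f \<eta> x"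
    if "smooth f" "\<eta> \<in> forms A E" "set Vs \<subseteq> \<Gamma>" for f \<eta> Vs x
    using that D_ev[OF that(2,3), of x] D_ev[OF forms_scale[OF that(2,1)] that(3), of x]
      d_on_scale_form[OF that(2,1,3), of x]
    by (simp add: graded_bracket_def ev_def)
  \<comment> \<open>[i(V), d] is the Lie derivative along \<open>V\<close>, by the recursion
    defining \<open>d_on\<close>.\<close>
  have LV: "ev (graded_bracket (- 1) (contract V) 1 D \<eta>) Vs x = lie_on \<eta> V Vs x"
    if "V \<in> \<Gamma>" "\<eta> \<in> forms A E" "set Vs \<subseteq> \<Gamma>" for V \<eta> Vs x
    using that D_ev[OF that(2), of "V # Vs" x] D_ev[OF forms_contract[OF that(2,1)] that(3), of x]
    by (simp add: graded_bracket_def ev_def contract_def)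
  from assms(1) show ?thesis
  proof cases
    case k: (gen_fun f)
    from assms(2) show ?thesis
    proof cases
      case l: (gen_fun g)
      \<comment> \<open>Two functions have target degree -1, for which only zero is
        available.\<close>
      have "derived k G l H \<eta> = (\<lambda>x vs. 0)" if \<eta>: "\<eta> \<in> forms A E" for \<eta>
      proof (rule eqI[OF \<eta> forms_zero])
        fix Vs x assume "set Vs \<subseteq> \<Gamma>"
        from lD[OF k(3) \<eta> this, of x] lD[OF k(3) forms_scale[OF \<eta> l(3)] this, of x]
        show "ev (derived k G l H \<eta>) Vs x = ev (\<lambda>x vs. 0) Vs x"
          by (simp add: k l graded_bracket_def[of _ _ 0] ev_def wedge_d_scale_form)
      qed
      then show ?thesis by (rule contraction_cong[OF contraction_zero])
    next
      case l: (gen_sec W)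
      have s: "smooth (\<lambda>x. - 1 * LD W f x)"
        by (intro smooth_fun_mult smooth_fun_const LD_smooth k l) simp
      have "derived k G l H \<eta> = (\<lambda>x vs. (- 1 * LD W f x) * \<eta> x vs)" if \<eta>: "\<eta> \<in> forms A E" for \<eta>
      proof (rule eqI[OF \<eta> forms_scale[OF \<eta> s]])
        fix Vs x assume Vs: "set Vs \<subseteq> \<Gamma>"
        from lD[OF k(3) forms_contract[OF \<eta> l(3)] Vs, of x] lD[OF k(3) \<eta>, of "W # Vs" x] l(3) Vs
        show "ev (derived k G l H \<eta>) Vs x = ev (\<lambda>x vs. (- 1 * LD W f x) * \<eta> x vs) Vs x"
          by (simp add: k l graded_bracket_def[of 1] ev_def contract_def)
      qed
      from contraction_cong[OF contraction_generator_left[OF gen_fun[OF s] contraction_id] this] show ?thesis by (simp add: k l)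
    qed
  next
    case k: (gen_sec V)
    from assms(2) show ?thesis
    proof cases
      case l: (gen_fun g)
      have s: "smooth (LD V g)" by (rule LD_smooth[OF k(3) l(3)])
      have "derived k G l H \<eta> = (\<lambda>x vs. LD V g x * \<eta> x vs)" if \<eta>: "\<eta> \<in> forms A E" for \<eta>
      proof (rule eqI[OF \<eta> forms_scale[OF \<eta> s]])
        fix Vs x assume Vs: "set Vs \<subseteq> \<Gamma>"
        from LV[OF k(3) \<eta> Vs, of x] LV[OF k(3) forms_scale[OF \<eta> l(3)] Vs, of x]
          lie_on_scale_form[OF \<eta> l(3) k(3) Vs, of x]
        show "ev (derived k G l H \<eta>) Vs x = ev (\<lambda>x vs. LD V g x * \<eta> x vs) Vs x"
          by (simp add: k l graded_bracket_def[of 0] ev_def)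
      qed
      from contraction_cong[OF contraction_generator_left[OF gen_fun[OF s] contraction_id] this] show ?thesis by (simp add: k l)
    next
      case l: (gen_sec W)
      have b: "br V W \<in> \<Gamma>" by (rule br_closed[OF k(3) l(3)])
      have "derived k G l H \<eta> = contract (br V W) \<eta>" if \<eta>: "\<eta> \<in> forms A E" for \<eta>
      proof (rule eqI[OF \<eta> forms_contract[OF \<eta> b]])
        fix Vs x assume Vs: "set Vs \<subseteq> \<Gamma>"
        from LV[OF k(3) forms_contract[OF \<eta> l(3)] Vs, of x] LV[OF k(3) \<eta>, of "W # Vs" x] l(3) Vs
        show "ev (derived k G l H \<eta>) Vs x = ev (contract (br V W) \<eta>) Vs x"
          by (simp add: k l graded_bracket_def[of 0] ev_def contract_def lie_on_Cons)
      qed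
      from contraction_cong[OF contraction_generator_left[OF gen_sec[OF b] contraction_id] this] show ?thesis by (simp add: k l)
    qed
  qed
qed

text \<open>A graded bracket is a graded derivation in its second argument; the mixed terms G F H
  cancel.\<close>

lemma graded_bracket_comp:
  assumes "linear_op F" "linear_op G" "linear_op H" "\<eta> \<in> forms A E"
  shows "graded_bracket k F (- (l + m)) (\<lambda>\<eta>. G (H \<eta>)) \<eta> =
    (\<lambda>x vs. graded_bracket k F (- l) G (H \<eta>) x vs +
      (- 1) powi (k * l) * G (graded_bracket k F (- m) H \<eta>) x vs)"
proof -
  have "G (graded_bracket k F (- m) H \<eta>) =
      (\<lambda>x vs. G (F (H \<eta>)) x vs - (- 1) powi (k * (- m)) * G (H (F \<eta>)) x vs)"
    unfolding graded_bracket_def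
    by (intro linear_op_diff assms linear_op_forms[OF assms(1)] linear_op_forms[OF assms(3)])
  then show ?thesis by (auto simp: fun_eq_iff graded_bracket_def sgn_powi)
qed

lemma derived_generator_word:
  assumes "generator k G" "word m T"
  shows "contraction (k + m - 1) (derived k G m T)"
  using assms(2)
proof induction
  case word_id
  show ?case by (rule contraction_cong[OF contraction_zero]) (simp add: graded_bracket_def[of _ _ 0])
next
  case (word_generator l H m T)
  let ?F = "graded_bracket (- k) G 1 D"
  have F: "linear_op ?F" by (intro linear_op_graded_bracket linear_op_D linear_op_generator[OF assms(1)])
  have 1: "contraction (k + l - 1 + m) (\<lambda>\<eta>. derived k G l H (T \<eta>))"
    by (rule contraction_word_right[OF word_generator.hyps(2) derived_generators[OF assms(1) word_generator.hyps(1)]])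
  have 2: "contraction (l + (k + m - 1)) (\<lambda>\<eta> x vs. (- 1) powi ((- k + 1) * l) * H (derived k G m T \<eta>) x vs)"
    by (rule contraction_cmult[OF contraction_generator_left[OF word_generator.hyps(1) word_generator.IH]])
  have "contraction (k + (l + m) - 1) (\<lambda>\<eta> x vs. derived k G l H (T \<eta>) x vs +
      (- 1) powi ((- k + 1) * l) * H (derived k G m T \<eta>) x vs)"
    using contraction_add[OF 1, of "\<lambda>\<eta> x vs. (- 1) powi ((- k + 1) * l) * H (derived k G m T \<eta>) x vs"] 2
    by (simp add: algebra_simps)
  then show ?case
    by (rule contraction_cong)
      (rule graded_bracket_comp[OF F linear_op_generator[OF word_generator.hyps(1)] linear_op_word[OF word_generator.hyps(2)]])
qed

text \<open>In the first argument the Leibniz rule is less direct, since \<open>D\<close> sits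
  inside: [G P, d] is split first, and then \<open>Q\<close> has to pass \<open>G\<close> and
  \<open>P\<close>. This is where graded commutativity of words enters: the graded brackets of
  \<open>Q\<close> with \<open>G\<close> and with \<open>P\<close> are zero.\<close>

lemma derived_words:
  assumes "word n P" "word q Q"
  shows "contraction (n + q - 1) (derived n P q Q)"
  using assms(1)
proof induction
  case word_id
  have "graded_bracket 0 (\<lambda>\<eta>. \<eta>) 1 D = (\<lambda>\<eta> x vs. 0)" by (simp add: graded_bracket_def fun_eq_iff)
  then show ?case
    by (intro contraction_cong[OF contraction_zero])
      (simp add: graded_bracket_def[of 1] linear_op_zero[OF linear_op_word[OF assms(2)]])
next
  case (word_generator k G n P)
  note lG = linear_op_generator[OF word_generator.hyps(1)] and lP = linear_op_word[OF word_generator.hyps(2)]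
    and lQ = linear_op_word[OF assms(2)]
  let ?a = "graded_bracket (- k) G 1 D" and ?b = "graded_bracket (- n) P 1 D"
  have la: "linear_op ?a" and lb: "linear_op ?b" by (intro linear_op_graded_bracket linear_op_D lG lP)+
  have 1: "contraction (k + (n + q - 1)) (\<lambda>\<eta>. G (derived n P q Q \<eta>))"
    by (rule contraction_generator_left[OF word_generator.hyps(1) word_generator.IH])
  have 2: "contraction (k + q - 1 + n) (\<lambda>\<eta> x vs. (- 1) powi (n + n * q) * derived k G q Q (P \<eta>) x vs)"
    by (rule contraction_cmult[OF contraction_word_right[OF word_generator.hyps(2) derived_generator_word[OF word_generator.hyps(1) assms(2)]]])
  have "contraction (k + n + q - 1) (\<lambda>\<eta> x vs. G (derived n P q Q \<eta>) x vs +
      (- 1) powi (n + n * q) * derived k G q Q (P \<eta>) x vs)"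
    using contraction_add[OF 1, of "\<lambda>\<eta> x vs. (- 1) powi (n + n * q) * derived k G q Q (P \<eta>) x vs"] 2
    by (simp add: algebra_simps)
  then show ?case
  proof (rule contraction_cong)
    fix \<eta> assume \<eta>: "\<eta> \<in> forms A E"
    note f = linear_op_forms[OF _ \<eta>]
    have c: "graded_bracket (- (k + n)) (\<lambda>\<eta>. G (P \<eta>)) 1 D \<omega> =
        (\<lambda>x vs. G (?b \<omega>) x vs + (- 1) powi n * ?a (P \<omega>) x vs)" if \<omega>: "\<omega> \<in> forms A E" for \<omega>
    proof -
      have "G (?b \<omega>) = (\<lambda>x vs. G (P (D \<omega>)) x vs - (- 1) powi (- n * 1) * G (D (P \<omega>)) x vs)"
        unfolding graded_bracket_def[of _ P]
        by (intro linear_op_diff lG linear_op_forms[OF lP] linear_op_forms[OF linear_op_D] \<omega>)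
      then show ?thesis by (auto simp: fun_eq_iff graded_bracket_def sgn_powi)
    qed
    have Gdgb: "G (derived n P q Q \<eta>) = (\<lambda>x vs. G (?b (Q \<eta>)) x vs - (- 1) powi ((- n + 1) * (- q)) * G (Q (?b \<eta>)) x vs)"
      unfolding graded_bracket_def[of _ ?b]
      by (intro linear_op_diff lG linear_op_forms[OF lb] linear_op_forms[OF lQ] \<eta>)
    have QG: "Q (G (?b \<eta>)) = (\<lambda>x vs. (- 1) powi (q * k) * G (Q (?b \<eta>)) x vs)"
      by (rule generator_word_commute[OF assms(2) word_generator.hyps(1) f[OF lb]])
    have "?a (P (Q \<eta>)) = ?a (\<lambda>x vs. (- 1) powi (n * q) * Q (P \<eta>) x vs)"
      by (simp add: word_commute[OF word_generator.hyps(2) assms(2) \<eta>])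
    also have "\<dots> = (\<lambda>x vs. (- 1) powi (n * q) * ?a (Q (P \<eta>)) x vs)"
      by (rule linear_op_cmult[OF la linear_op_forms[OF lQ f[OF lP]]])
    finally have aPQ: "?a (P (Q \<eta>)) = (\<lambda>x vs. (- 1) powi (n * q) * ?a (Q (P \<eta>)) x vs)" .
    have Qc: "Q (graded_bracket (- (k + n)) (\<lambda>\<eta>. G (P \<eta>)) 1 D \<eta>) =
        (\<lambda>x vs. Q (G (?b \<eta>)) x vs + (- 1) powi n * Q (?a (P \<eta>)) x vs)"
      unfolding c[OF \<eta>]
      by (intro linear_op_combine lQ linear_op_forms[OF lG] linear_op_forms[OF la] linear_op_forms[OF lb] f[OF lP] \<eta>)
    have "derived (k + n) (\<lambda>\<eta>. G (P \<eta>)) q Q \<eta> =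
      (\<lambda>x vs. G (?b (Q \<eta>)) x vs + (- 1) powi n * ?a (P (Q \<eta>)) x vs -
        (- 1) powi ((- (k + n) + 1) * (- q)) * (Q (G (?b \<eta>)) x vs + (- 1) powi n * Q (?a (P \<eta>)) x vs))"
      unfolding graded_bracket_def[of "- (k + n) + 1"] Qc c[OF f[OF lQ]] by simp
    also have "\<dots> = (\<lambda>x vs. G (derived n P q Q \<eta>) x vs + (- 1) powi (n + n * q) * derived k G q Q (P \<eta>) x vs)"
      unfolding Gdgb QG aPQ graded_bracket_def[of "- k + 1"]
      by (cases "even k"; cases "even n"; cases "even q") (simp_all add: sgn_powi algebra_simps)
    finally show "derived (k + n) (\<lambda>\<eta>. G (P \<eta>)) q Q \<eta> =
      (\<lambda>x vs. G (derived n P q Q \<eta>) x vs + (- 1) powi (n + n * q) * derived k G q Q (P \<eta>) x vs)" .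
  qed
qed

lemma word_monomial:
  assumes "smooth f" "set Vs \<subseteq> \<Gamma>"
  shows "word (int (length Vs)) (\<lambda>\<eta> x vs. f x * foldr contract Vs \<eta> x vs)"
proof -
  have "word (int (length Vs)) (foldr contract Vs)"
    using assms(2)
  proof (induction Vs)
    case Nil
    then show ?case using word_id by (simp add: id_def)
  next
    case (Cons V Vs)
    then show ?case using word_generator[OF gen_sec, of V "int (length Vs)" "foldr contract Vs"]
      by (simp add: o_def)
  qed
  from word_generator[OF gen_fun[OF assms(1)] this] show ?thesis by simp
qed

lemma linear_op_contract_sum:
  assumes "contract_terms n ts"
  shows "linear_op (contract_sum ts)"
  using assms
proof (induction ts)
  case Nil
  then show ?case by (simp add: linear_op_def contract_sum_def forms_zero)
next
  case (Cons t ts)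
  obtain f Vs where t: "t = (f, Vs)" by fastforce
  have 1: "linear_op (\<lambda>\<eta> x vs. f x * foldr contract Vs \<eta> x vs)"
    using Cons.prems by (intro linear_op_word[OF word_monomial]) (auto simp: contract_terms_def t)
  have 2: "linear_op (contract_sum ts)" using Cons by (simp add: contract_terms_def)
  show ?case unfolding t contract_sum_Cons by (rule linear_op_plus[OF 1 2])
qed

lemma derived_add_left:
  assumes "linear_op P1" "linear_op P2" "linear_op Q" "\<eta> \<in> forms A E"
  shows "derived p (\<lambda>\<eta> x vs. P1 \<eta> x vs + P2 \<eta> x vs) q Q \<eta> = (\<lambda>x vs. derived p P1 q Q \<eta> x vs + derived p P2 q Q \<eta> x vs)"
proof -
  let ?c = "\<lambda>P. graded_bracket (- p) P 1 D"
  have c: "?c (\<lambda>\<eta> x vs. P1 \<eta> x vs + P2 \<eta> x vs) \<omega> = (\<lambda>x vs. ?c P1 \<omega> x vs + ?c P2 \<omega> x vs)"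
    if "\<omega> \<in> forms A E" for \<omega>
    using linear_op_add[OF linear_op_D linear_op_forms[OF assms(1) that] linear_op_forms[OF assms(2) that]]
    by (simp add: graded_bracket_def algebra_simps)
  have l: "linear_op (?c P1)" "linear_op (?c P2)" by (intro linear_op_graded_bracket linear_op_D assms)+
  show ?thesis
    using linear_op_add[OF assms(3) linear_op_forms[OF l(1) assms(4)] linear_op_forms[OF l(2) assms(4)]]
    unfolding graded_bracket_def[of "- p + 1"]
    by (simp add: c linear_op_forms[OF assms(3)] assms(4) algebra_simps)
qed

lemma derived_add_right:
  assumes "linear_op Q1" "linear_op Q2" "linear_op P" "\<eta> \<in> forms A E"
  shows "derived p P q (\<lambda>\<eta> x vs. Q1 \<eta> x vs + Q2 \<eta> x vs) \<eta> = (\<lambda>x vs. derived p P q Q1 \<eta> x vs + derived p P q Q2 \<eta> x vs)"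
proof -
  have l: "linear_op (graded_bracket (- p) P 1 D)" by (intro linear_op_graded_bracket linear_op_D assms)
  show ?thesis
    using linear_op_add[OF l linear_op_forms[OF assms(1,4)] linear_op_forms[OF assms(2,4)]]
    unfolding graded_bracket_def[of "- p + 1"] by (simp add: algebra_simps)
qed

lemma derived_contract_sum:
  assumes "contract_terms p ts" "contract_terms q us"
  shows "contraction (p + q - 1) (derived p (contract_sum ts) q (contract_sum us))"
  using assms(1)
proof (induction ts)
  case Nil
  have "graded_bracket (- p) (contract_sum []) 1 D = (\<lambda>\<eta> x vs. 0)"
    by (simp add: graded_bracket_def contract_sum_Nil linear_op_zero[OF linear_op_D] fun_eq_iff)
  then show ?case
    by (intro contraction_cong[OF contraction_zero], unfold graded_bracket_def[of "- p + 1"])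
      (simp add: linear_op_zero[OF linear_op_contract_sum[OF assms(2)]])
next
  case (Cons t ts)
  obtain f Vs where t: "t = (f, Vs)" by fastforce
  let ?m = "\<lambda>\<eta> x vs. f x * foldr contract Vs \<eta> x vs"
  have f: "smooth f" "set Vs \<subseteq> \<Gamma>" "int (length Vs) = p" and ts: "contract_terms p ts"
    using Cons.prems by (auto simp: contract_terms_def t)
  have w: "word p ?m" using word_monomial[OF f(1,2)] f(3) by simp
  have "contraction (p + q - 1) (derived p ?m q (contract_sum us))"
    using assms(2)
  proof (induction us)
    case Nil
    show ?case
      by (intro contraction_cong[OF contraction_zero], unfold graded_bracket_def[of "- p + 1"] contract_sum_Nil)
        (simp add: linear_op_zero[OF linear_op_graded_bracket[OF linear_op_word[OF w] linear_op_D]])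
  next
    case (Cons u us)
    obtain g Ws where u: "u = (g, Ws)" by fastforce
    let ?n = "\<lambda>\<eta> x vs. g x * foldr contract Ws \<eta> x vs"
    have g: "smooth g" "set Ws \<subseteq> \<Gamma>" "int (length Ws) = q" and us: "contract_terms q us"
      using Cons.prems by (auto simp: contract_terms_def u)
    have w': "word q ?n" using word_monomial[OF g(1,2)] g(3) by simp
    show ?case unfolding u contract_sum_Cons
      by (rule contraction_cong[OF contraction_add[OF derived_words[OF w w'] Cons.IH[OF us]]])
        (rule derived_add_right[OF linear_op_word[OF w'] linear_op_contract_sum[OF us] linear_op_word[OF w]])
  qed
  from contraction_add[OF this Cons.IH[OF ts]] show ?case unfolding t contract_sum_Cons
    by (rule contraction_cong)
      (rule derived_add_left[OF linear_op_word[OF w] linear_op_contract_sum[OF ts] linear_op_contract_sum[OF assms(2)]])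
qed

end

section \<open>The Schouten-Nijenhuis bracket\<close>

text \<open>
  The points \<open>\<kappa>\<close> and the functions \<open>H\<close> replace a dual basis, without requiring the family \<open>F\<close> to be
  linearly independent.
\<close>

lemma finite_evaluation:
  fixes F :: "'j \<Rightarrow> 'x \<Rightarrow> real"
  assumes "finite J"
  shows "\<exists>ks. (\<forall>(\<kappa>, H)\<in>set ks. \<kappa> \<in> X \<and> (\<exists>g. \<forall>\<xi>. H \<xi> = (\<Sum>j\<in>J. g j * F j \<xi>))) \<and>
    (\<forall>j\<in>J. \<forall>\<xi>\<in>X. F j \<xi> = (\<Sum>(\<kappa>, H)\<leftarrow>ks. F j \<kappa> * H \<xi>))"
  using assms
proof (induction J)
  case empty
  show ?case by (rule exI[of _ "[]"]) simp
next
  case (insert j0 J)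
  then obtain ks where ks: "\<And>\<kappa> H. (\<kappa>, H) \<in> set ks \<Longrightarrow> \<kappa> \<in> X"
    "\<And>\<kappa> H. (\<kappa>, H) \<in> set ks \<Longrightarrow> \<exists>g. \<forall>\<xi>. H \<xi> = (\<Sum>j\<in>J. g j * F j \<xi>)"
    "\<And>j \<xi>. j \<in> J \<Longrightarrow> \<xi> \<in> X \<Longrightarrow> F j \<xi> = (\<Sum>(\<kappa>, H)\<leftarrow>ks. F j \<kappa> * H \<xi>)" by blast
  \<comment> \<open>Membership in the span of the family. Each \<open>H\<close> has to stay in it,
    since it is later read as a combination of values on frame vectors.\<close>
  define sp where "sp H \<longleftrightarrow> (\<exists>g. \<forall>\<xi>. H \<xi> = (\<Sum>j\<in>insert j0 J. g j * F j \<xi>))" for H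
  have sp_sub: "sp (\<lambda>\<xi>. H \<xi> - c * H' \<xi>)" if H: "sp H" "sp H'" for H H' c
  proof -
    obtain g g' where "\<forall>\<xi>. H \<xi> = (\<Sum>j\<in>insert j0 J. g j * F j \<xi>)"
      "\<forall>\<xi>. H' \<xi> = (\<Sum>j\<in>insert j0 J. g' j * F j \<xi>)" using H unfolding sp_def by blast
    then have "\<forall>\<xi>. H \<xi> - c * H' \<xi> = (\<Sum>j\<in>insert j0 J. (g j - c * g' j) * F j \<xi>)"
      by (simp only: sum_distrib_left left_diff_distrib sum_subtractf mult.assoc) simp
    then show ?thesis unfolding sp_def by (rule exI[of _ "\<lambda>j. g j - c * g' j"])
  qed
  have sp_old: "sp H" if k: "(\<kappa>, H) \<in> set ks" for \<kappa> H
  proof -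
    obtain g where g: "\<forall>\<xi>. H \<xi> = (\<Sum>j\<in>J. g j * F j \<xi>)" using ks(2)[OF k] by blast
    have "(\<Sum>j\<in>insert j0 J. (g(j0 := 0)) j * F j \<xi>) = (\<Sum>j\<in>J. g j * F j \<xi>)" for \<xi>
      using insert.hyps by (auto intro!: sum.cong)
    then show ?thesis using g unfolding sp_def by (intro exI[of _ "g(j0 := 0)"]) simp
  qed
  have sp_F: "sp (F j0)"
  proof -
    have "F j0 \<xi> = (\<Sum>j\<in>insert j0 J. (if j = j0 then 1 else 0) * F j \<xi>)" for \<xi>
      using insert.hyps by (simp add: sum.neutral)
    then show ?thesis unfolding sp_def by (intro exI[of _ "\<lambda>j. if j = j0 then 1 else 0"] allI)
  qed
  \<comment> \<open>The part of \<open>F j0\<close> that the present points fail to reproduce. If it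
    vanishes on \<open>X\<close>, the same points still suffice.\<close>
  define r where "r \<xi> = F j0 \<xi> - (\<Sum>(\<kappa>, H)\<leftarrow>ks. F j0 \<kappa> * H \<xi>)" for \<xi>
  have "sp (\<lambda>\<xi>. F j0 \<xi> - (\<Sum>(\<kappa>, H)\<leftarrow>ls. F j0 \<kappa> * H \<xi>))" if "set ls \<subseteq> set ks" for ls
    using that
  proof (induction ls)
    case (Cons l ls)
    obtain \<kappa> H where l: "l = (\<kappa>, H)" by fastforce
    from Cons have "sp (\<lambda>\<xi>. F j0 \<xi> - (\<Sum>(\<kappa>, H)\<leftarrow>ls. F j0 \<kappa> * H \<xi>))" "sp H"
      using sp_old[of \<kappa> H] l by auto
    from sp_sub[OF this, of "F j0 \<kappa>"] show ?case by (simp add: l algebra_simps)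
  qed (simp add: sp_F)
  then have sp_r: "sp r" by (simp add: r_def[abs_def])
  show ?case
  proof (cases "\<forall>\<xi>\<in>X. r \<xi> = 0")
    case True
    then show ?thesis using ks sp_old unfolding sp_def r_def
      by (intro exI[of _ ks]) auto
  next
    case False
    then obtain \<xi>0 where \<xi>0: "\<xi>0 \<in> X" "r \<xi>0 \<noteq> 0" by blast
    \<comment> \<open>\<open>r\<close> normalised to 1 at the new point, written as a difference so
      that \<open>sp_sub\<close> applies.\<close>
    define G where "G \<xi> = 0 - (- inverse (r \<xi>0)) * r \<xi>" for \<xi>
    have Gr: "G \<xi> = r \<xi> / r \<xi>0" for \<xi> by (simp add: G_def divide_inverse)
    have "sp (\<lambda>\<xi>. F j0 \<xi> - 1 * F j0 \<xi>)" by (rule sp_sub[OF sp_F sp_F])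
    from sp_sub[OF this sp_r, of "- inverse (r \<xi>0)"] have sp_G: "sp G" by (simp add: G_def[abs_def])
    \<comment> \<open>Subtracting a multiple of \<open>G\<close> makes the old functions vanish at
      the new point, as in a dual basis.\<close>
    define h where "h = (\<lambda>(\<kappa> :: 'x, H). (\<kappa>, \<lambda>\<xi>. H \<xi> - H \<xi>0 * G \<xi>))"
    have sum_h: "(\<Sum>(\<kappa>, H)\<leftarrow>map h ls. a \<kappa> * H \<xi>) =
        (\<Sum>(\<kappa>, H)\<leftarrow>ls. a \<kappa> * H \<xi>) - (\<Sum>(\<kappa>, H)\<leftarrow>ls. a \<kappa> * H \<xi>0) * G \<xi>" for a \<xi> ls
      by (induction ls) (auto simp: h_def algebra_simps)
    show ?thesis
    proof (intro exI[of _ "(\<xi>0, G) # map h ks"] conjI)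
      show "\<forall>(\<kappa>, H)\<in>set ((\<xi>0, G) # map h ks). \<kappa> \<in> X \<and> (\<exists>g. \<forall>\<xi>. H \<xi> = (\<Sum>j\<in>insert j0 J. g j * F j \<xi>))"
        using \<xi>0 ks(1) sp_G sp_sub[OF sp_old sp_G] unfolding sp_def[symmetric]
        by (auto simp: h_def)
      show "\<forall>j\<in>insert j0 J. \<forall>\<xi>\<in>X. F j \<xi> = (\<Sum>(\<kappa>, H)\<leftarrow>(\<xi>0, G) # map h ks. F j \<kappa> * H \<xi>)"
      proof (intro ballI)
        fix j \<xi> assume j: "j \<in> insert j0 J" and \<xi>: "\<xi> \<in> X"
        have e: "(\<Sum>(\<kappa>, H)\<leftarrow>(\<xi>0, G) # map h ks. F j \<kappa> * H \<xi>) = F j \<xi>0 * G \<xi> +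
          ((\<Sum>(\<kappa>, H)\<leftarrow>ks. F j \<kappa> * H \<xi>) - (\<Sum>(\<kappa>, H)\<leftarrow>ks. F j \<kappa> * H \<xi>0) * G \<xi>)"
          unfolding list.map sum_list.Cons using sum_h[of "F j" \<xi> ks] by simp
        show "F j \<xi> = (\<Sum>(\<kappa>, H)\<leftarrow>(\<xi>0, G) # map h ks. F j \<kappa> * H \<xi>)"
        proof (cases "j \<in> J")
          case True
          then show ?thesis unfolding e using ks(3)[OF True \<xi>] ks(3)[OF True \<xi>0(1)] by simp
        next
          case False
          then have j: "j = j0" using j by simp
          have "F j0 \<xi>0 * G \<xi> - (\<Sum>(\<kappa>, H)\<leftarrow>ks. F j0 \<kappa> * H \<xi>0) * G \<xi> = r \<xi>0 * G \<xi>"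
            by (simp add: r_def[of \<xi>0] left_diff_distrib)
          also have "\<dots> = r \<xi>" using \<xi>0 by (simp add: Gr)
          finally show ?thesis unfolding e unfolding j by (simp add: r_def)
        qed
      qed
    qed
  qed
qed

context vector_bundle
begin

text \<open>All lists over the frame, not just increasing ones: this keeps the slotwise recursion
  simple, and the linear dependence among the products is absorbed by
  \<open>finite_evaluation\<close>.\<close>

definition multi_indices :: "nat \<Rightarrow> 'c list set" where
  "multi_indices m = {ws. set ws \<subseteq> frame \<and> length ws = m}"

lemma finite_multi_indices: "finite (multi_indices m)"
  unfolding multi_indices_def by (rule finite_lists_length_eq[OF finite_frame[OF fibre_finite_dim]])

lemma sum_multi_indices_Suc:
  "(\<Sum>ws\<in>multi_indices (Suc m). h ws) = (\<Sum>b\<in>frame. \<Sum>ws\<in>multi_indices m. h (b # ws) :: real)"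
proof -
  have "(\<Sum>ws\<in>multi_indices (Suc m). h ws) = (\<Sum>(ws, b)\<in>multi_indices m \<times> frame. h (b # ws))"
    unfolding multi_indices_def lists_length_Suc_eq
    by (subst sum.reindex) (auto simp: inj_on_def case_prod_unfold)
  also have "\<dots> = (\<Sum>ws\<in>multi_indices m. \<Sum>b\<in>frame. h (b # ws))" by (simp add: sum.cartesian_product)
  finally show ?thesis by (simp add: sum.swap[of _ frame])
qed

text \<open>The coefficients depend on the point and not on \<alpha>, so they can become
  coefficients of a multivector.\<close>

lemma multi_expansion:
  assumes "(U, \<phi>) \<in> trivs E" "open W" "W \<subseteq> U" "\<And>u. u \<in> set us \<Longrightarrow> local_sec \<phi> W u"
  shows "\<exists>e. (\<forall>ws. smooth_fun A W (e ws)) \<and> (\<forall>y\<in>W. \<forall>\<alpha>\<in>ext_forms E y.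
    \<alpha> (map (\<lambda>u. u y) us) = (\<Sum>ws\<in>multi_indices (length us). e ws y * \<alpha> (map (\<lambda>w. ls \<phi> w y) ws)))"
  using assms(4)
proof (induction us)
  case Nil
  have "multi_indices 0 = {[]}" by (auto simp: multi_indices_def)
  then show ?case by (intro exI[of _ "\<lambda>_ _. 1"]) (simp add: smooth_fun_const)
next
  case (Cons u us)
  then have "\<And>u. u \<in> set us \<Longrightarrow> local_sec \<phi> W u" by simp
  from Cons.IH[OF this] obtain e where e: "\<And>ws. smooth_fun A W (e ws)" "\<And>y \<alpha>. y \<in> W \<Longrightarrow> \<alpha> \<in> ext_forms E y \<Longrightarrow>
    \<alpha> (map (\<lambda>u. u y) us) = (\<Sum>ws\<in>multi_indices (length us). e ws y * \<alpha> (map (\<lambda>w. ls \<phi> w y) ws))"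
    by blast
  have u: "\<And>y. y \<in> W \<Longrightarrow> u y \<in> fibre E y" "smooth_fun A W (\<lambda>y. \<phi> (u y))"
    using Cons.prems[of u] by (simp_all add: local_sec_def)
  have us: "set (map (\<lambda>u. u y) us) \<subseteq> fibre E y" if "y \<in> W" for y
    using Cons.prems that by (auto simp: local_sec_def)
  \<comment> \<open>The first index belongs to \<open>u\<close>, the rest to \<open>us\<close>; only
    nonempty lists occur in the sum, so \<open>hd\<close> is meaningful there.\<close>
  let ?e = "\<lambda>ws y. coord (hd ws) (\<phi> (u y)) * e (tl ws) y"
  show ?case
  proof (intro exI[of _ ?e] conjI allI ballI)
    show "smooth_fun A W (?e ws)" for ws
      by (intro smooth_fun_mult assms(2) e
          smooth_fun_linear[OF assms(2) bounded_linear_coord[OF fibre_finite_dim] u(2)])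
    fix y \<alpha> assume y: "y \<in> W" and \<alpha>: "\<alpha> \<in> ext_forms E y"
    have yU: "y \<in> U" using y assms(3) by blast
    have "\<alpha> (u y # map (\<lambda>u. u y) us) =
        (\<Sum>b\<in>frame. coord b (\<phi> (u y)) *\<^sub>R \<alpha> (ls \<phi> b y # map (\<lambda>u. u y) us))"
      by (rule fibre_expansion[OF assms(1) yU u(1)[OF y]])
        (use us[OF y] ext_add[OF \<alpha>, of "[]"] ext_scale[OF \<alpha>, of "[]"] in simp_all)
    also have "\<dots> = (\<Sum>b\<in>frame. coord b (\<phi> (u y)) *
        (\<Sum>ws\<in>multi_indices (length us). e ws y * \<alpha> (ls \<phi> b y # map (\<lambda>w. ls \<phi> w y) ws)))"
    proof (rule sum.cong[OF refl])
      fix b :: 'c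
      \<comment> \<open>The local expansion of \<open>us\<close> is applied to the form with its
        first slot filled.\<close>
      have "(\<lambda>vs. \<alpha> ([ls \<phi> b y] @ vs)) \<in> ext_forms E y"
        by (rule ext_prefix[OF \<alpha>]) (use ls_fibre[OF assms(1) yU] in simp)
      from e(2)[OF y this]
      show "coord b (\<phi> (u y)) *\<^sub>R \<alpha> (ls \<phi> b y # map (\<lambda>u. u y) us) = coord b (\<phi> (u y)) *
        (\<Sum>ws\<in>multi_indices (length us). e ws y * \<alpha> (ls \<phi> b y # map (\<lambda>w. ls \<phi> w y) ws))"
        by simp
    qed
    finally show "\<alpha> (map (\<lambda>u. u y) (u # us)) =
        (\<Sum>ws\<in>multi_indices (length (u # us)). ?e ws y * \<alpha> (map (\<lambda>w. ls \<phi> w y) ws))"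
      by (simp add: sum_multi_indices_Suc sum_distrib_left mult.assoc)
  qed
qed

end

context lie_algebroid
begin

section \<open>Localisation\<close>

lemma multivector_local:
  assumes "P \<in> multivectors A E p"
  obtains ts N where "open N" "x \<in> N" "contract_terms p ts"
    "\<And>\<eta> y. \<eta> \<in> forms A E \<Longrightarrow> y \<in> N \<Longrightarrow> interior_product P \<eta> y = contract_sum ts \<eta> y"
proof -
  obtain U \<phi> where U: "(U, \<phi>) \<in> trivs E" "x \<in> U" by (rule triv_at)
  obtain \<beta> K N where K: "closed K" "K \<subseteq> U" "smooth \<beta>" "\<And>y. y \<notin> K \<Longrightarrow> \<beta> y = (0::real)"
    "open N" "x \<in> N" "N \<subseteq> U" "\<And>y. y \<in> N \<Longrightarrow> \<beta> y = 1"
    by (rule bump_fun[OF triv_open[OF U(1)] U(2)]) blast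
  obtain ts where ts: "\<forall>(f, ws)\<in>set ts. smooth_fun A U f \<and> int (length ws) = p"
    "\<forall>x\<in>U. P x = (\<lambda>\<alpha>. \<Sum>(f, ws)\<leftarrow>ts. f x * wedge E x (map (\<lambda>w. ls \<phi> w x) ws) \<alpha>)"
    using assms U(1) unfolding multivectors_def by blast
  \<comment> \<open>Where \<beta> is 1, the cut-off coefficients and sections coincide with the
    given ones.\<close>
  define h where "h = (\<lambda>(f, ws). (\<lambda>y. if y \<in> U then \<beta> y * f y else (0::real), map (cutoff U \<phi> \<beta>) ws))"
  have ext: "smooth (\<lambda>y. if y \<in> U then \<beta> y * f y else 0)" if "smooth_fun A U f" for f :: "'m \<Rightarrow> real"
    by (rule smooth_fun_extend[OF triv_open[OF U(1)] K(1-4) open_UNIV, of f]) (use that in auto)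
  have "contract_terms p (map h ts)"
    unfolding contract_terms_def
  proof
    fix t assume "t \<in> set (map h ts)"
    then obtain f ws where t: "(f, ws) \<in> set ts" "t = h (f, ws)" by auto
    then have "smooth_fun A U f" "int (length ws) = p" using ts(1) by auto
    then show "case t of (f, Vs) \<Rightarrow> smooth f \<and> set Vs \<subseteq> \<Gamma> \<and> int (length Vs) = p"
      using ext cutoff_section[OF U(1) K(1-4)] by (auto simp: t(2) h_def)
  qed
  moreover have "interior_product P \<eta> y = contract_sum (map h ts) \<eta> y" if "\<eta> \<in> forms A E" "y \<in> N" for \<eta> y
  proof
    fix vs
    have y: "y \<in> U" using that(2) K(7) by blast
    show "interior_product P \<eta> y vs = contract_sum (map h ts) \<eta> y vs"
      unfolding interior_product_local[of _ _ _ _ P ts, OF U(1) y that(1) ts(2)[rule_format, OF y]]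
      by (simp add: contract_sum_def h_def case_prod_unfold o_def y K(8)[OF that(2)] foldr_contract
          cutoff_eq[OF U(1) y] rev_map)
  qed
  ultimately show ?thesis using that[OF K(5,6)] by blast
qed

text \<open>Combines equality of \<open>F\<close> and \<open>F'\<close> over \<open>N\<close> with
  their locality. Since outputs are compared on all of \<open>N\<close>, the relation passes through
  compositions, and so to brackets with \<open>D\<close>, which depends on more than the value of a
  form at one point.\<close>

definition agree :: "'m set \<Rightarrow> ('m, 'e) form_op \<Rightarrow> ('m, 'e) form_op \<Rightarrow> bool" where
  "agree N F F' \<longleftrightarrow> (\<forall>\<eta>\<in>forms A E. \<forall>\<omega>\<in>forms A E. (\<forall>y\<in>N. \<eta> y = \<omega> y) \<longrightarrow> (\<forall>y\<in>N. F \<eta> y = F' \<omega> y))"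

lemma agree_graded_bracket:
  assumes "agree N F F'" "agree N G G'"
    and "\<And>\<eta>. \<eta> \<in> forms A E \<Longrightarrow> F \<eta> \<in> forms A E \<and> F' \<eta> \<in> forms A E \<and> G \<eta> \<in> forms A E \<and> G' \<eta> \<in> forms A E"
  shows "agree N (graded_bracket k F l G) (graded_bracket k F' l G')"
  unfolding agree_def
proof (intro ballI impI)
  fix \<eta> \<omega> y assume *: "\<eta> \<in> forms A E" "\<omega> \<in> forms A E" "\<forall>y\<in>N. \<eta> y = \<omega> y" "y \<in> N"
  have "\<forall>y\<in>N. F \<eta> y = F' \<omega> y" "\<forall>y\<in>N. G \<eta> y = G' \<omega> y" using * assms(1,2) unfolding agree_def by blast+
  then have "F (G \<eta>) y = F' (G' \<omega>) y" "G (F \<eta>) y = G' (F' \<omega>) y"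
    using assms * unfolding agree_def by blast+
  then show "graded_bracket k F l G \<eta> y = graded_bracket k F' l G' \<omega> y"
    by (simp add: graded_bracket_def)
qed

lemma agree_D: "open N \<Longrightarrow> agree N D D"
  unfolding agree_def using D_local by blast

lemma derived_local:
  assumes "P \<in> multivectors A E p" "Q \<in> multivectors A E q"
  obtains ts N where "open N" "x \<in> N" "contract_terms (p + q - 1) ts"
    "\<And>\<eta> y. \<eta> \<in> forms A E \<Longrightarrow> y \<in> N \<Longrightarrow>
      derived p (interior_product P) q (interior_product Q) \<eta> y = contract_sum ts \<eta> y"
proof -
  obtain ts1 N1 where 1: "open N1" "x \<in> N1" "contract_terms p ts1"
    "\<And>\<eta> y. \<eta> \<in> forms A E \<Longrightarrow> y \<in> N1 \<Longrightarrow> interior_product P \<eta> y = contract_sum ts1 \<eta> y"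
    by (rule multivector_local[OF assms(1), of x]) blast
  obtain ts2 N2 where 2: "open N2" "x \<in> N2" "contract_terms q ts2"
    "\<And>\<eta> y. \<eta> \<in> forms A E \<Longrightarrow> y \<in> N2 \<Longrightarrow> interior_product Q \<eta> y = contract_sum ts2 \<eta> y"
    by (rule multivector_local[OF assms(2), of x]) blast
  obtain ts where ts: "contract_terms (p + q - 1) ts"
    "\<forall>\<eta>\<in>forms A E. derived p (contract_sum ts1) q (contract_sum ts2) \<eta> = contract_sum ts \<eta>"
    using derived_contract_sum[OF 1(3) 2(3)] by (auto simp: contraction_def)
  let ?N = "N1 \<inter> N2"
  have N: "open ?N" "x \<in> ?N" using 1 2 by auto
  have ip: "interior_product P \<eta> y = interior_product P \<omega> y" if "\<eta> y = \<omega> y" for P \<eta> \<omega> and y :: 'm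
    using that by (simp add: interior_product_def)
  have P: "agree ?N (interior_product P) (contract_sum ts1)" "agree ?N (interior_product Q) (contract_sum ts2)"
    unfolding agree_def using 1(4) 2(4) ip by (metis IntD1, metis IntD2)
  note f = interior_product_forms[OF assms(1)] interior_product_forms[OF assms(2)]
    linear_op_forms[OF linear_op_contract_sum[OF 1(3)]] linear_op_forms[OF linear_op_contract_sum[OF 2(3)]] D_forms
  have c: "graded_bracket k F 1 D \<eta> \<in> forms A E"
    if "\<And>\<eta>. \<eta> \<in> forms A E \<Longrightarrow> F \<eta> \<in> forms A E" "\<eta> \<in> forms A E" for k F \<eta>
    unfolding graded_bracket_def by (intro forms_diff that D_forms)
  have "agree ?N (derived p (interior_product P) q (interior_product Q)) (derived p (contract_sum ts1) q (contract_sum ts2))"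
    by (intro agree_graded_bracket P agree_D N(1) conjI c f)
  then have "derived p (interior_product P) q (interior_product Q) \<eta> y = contract_sum ts \<eta> y"
    if "\<eta> \<in> forms A E" "y \<in> ?N" for \<eta> y
    using that ts(2) unfolding agree_def by metis
  then show ?thesis using that[OF N ts(1)] by blast
qed

section \<open>Determining and glueing multivectors\<close>

text \<open>Equality of multivectors is equality of functions on all arguments, including those that
  are not forms, where \<open>wedge\<close> is 0.\<close>

lemma multivector_off_ext_forms:
  assumes "R \<in> multivectors A E n"
  shows "\<alpha> \<notin> ext_forms E x \<Longrightarrow> R x \<alpha> = 0"
proof -
  obtain U \<phi> where U: "(U, \<phi>) \<in> trivs E" "x \<in> U" by (rule triv_at)
  obtain ts where "\<forall>x\<in>U. R x = (\<lambda>\<alpha>. \<Sum>(f, ws)\<leftarrow>ts. f x * wedge E x (map (\<lambda>w. ls \<phi> w x) ws) \<alpha>)"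
    using assms U(1) unfolding multivectors_def by blast
  then show "R x \<alpha> = 0" if "\<alpha> \<notin> ext_forms E x" using U(2) that by (simp add: wedge_def case_prod_unfold)
qed

text \<open>Reversing the arguments undoes the reversal in \<open>interior_product\<close>; on the
  empty list the contraction is complete and returns the value of the multivector.\<close>

lemma rev_form:
  assumes "\<alpha> \<in> ext_forms E x"
  obtains \<eta> where "\<eta> \<in> forms A E" "\<And>vs. \<eta> x vs = \<alpha> (rev vs)"
    "\<And>R. interior_product R \<eta> x [] = R x \<alpha>"
proof -
  have "(\<lambda>vs. \<alpha> (rev vs)) \<in> ext_forms E x" using ext_forms_rev_append[OF assms, of "[]"] by simp
  then obtain \<eta> where \<eta>: "\<eta> \<in> forms A E" "\<eta> x = (\<lambda>vs. \<alpha> (rev vs))" by (rule form_through)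
  then show ?thesis using that[of \<eta>] by (simp add: interior_product_def)
qed

lemma multivector_eqI:
  assumes "R \<in> multivectors A E n" "R' \<in> multivectors A E n"
    and "\<And>\<eta>. \<eta> \<in> forms A E \<Longrightarrow> interior_product R \<eta> = interior_product R' \<eta>"
  shows "R = R'"
proof (intro ext)
  fix x \<alpha>
  show "R x \<alpha> = R' x \<alpha>"
  proof (cases "\<alpha> \<in> ext_forms E x")
    case True
    then show ?thesis using rev_form[OF True] assms(3) by metis
  next
    case False
    then show ?thesis using multivector_off_ext_forms[OF assms(1)] multivector_off_ext_forms[OF assms(2)] by simp
  qed
qed

text \<open>The lists \<open>ts\<close> differ from point to point, whereas a multivector needs one
  finite sum over each trivialising set. The coefficients are therefore produced from values of
  \<open>R\<close> itself, on test forms carried over from one fibre.\<close>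

lemma multivector_of_local:
  assumes "\<And>x. \<exists>ts N. open N \<and> x \<in> N \<and> contract_terms n ts \<and> (\<forall>\<eta>\<in>forms A E. \<forall>y\<in>N. T \<eta> y = contract_sum ts \<eta> y)"
  obtains R where "R \<in> multivectors A E n" "\<And>\<eta>. \<eta> \<in> forms A E \<Longrightarrow> interior_product R \<eta> = T \<eta>"
proof -
  from assms have "\<forall>x. \<exists>p. open (snd p) \<and> x \<in> snd p \<and> contract_terms n (fst p) \<and>
      (\<forall>\<eta>\<in>forms A E. \<forall>y\<in>snd p. T \<eta> y = contract_sum (fst p) \<eta> y)" by simp
  then obtain p where p: "\<And>x. open (snd (p x))" "\<And>x. x \<in> snd (p x)" "\<And>x. contract_terms n (fst (p x))"
      "\<And>x \<eta> y. \<eta> \<in> forms A E \<Longrightarrow> y \<in> snd (p x) \<Longrightarrow> T \<eta> y = contract_sum (fst (p x)) \<eta> y" by metis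
  define N where "N x = snd (p x)" for x
  define ts where "ts x = fst (p x)" for x
  note N = p(1,2)[folded N_def] and ts = p(3)[folded ts_def] and T = p(4)[folded N_def ts_def]
  \<comment> \<open>Each point uses its own list; \<open>Rloc\<close> shows that the list of a
    neighbour gives the same value, as both compute \<open>T\<close>.\<close>
  define R where "R x \<alpha> = (if \<alpha> \<in> ext_forms E x
    then \<Sum>(f, Vs)\<leftarrow>ts x. f x * \<alpha> (map (\<lambda>V. V x) Vs) else 0)" for x \<alpha>
  have RT: "interior_product R \<eta> = T \<eta>" if "\<eta> \<in> forms A E" for \<eta>
  proof (intro ext)
    fix x vs
    show "interior_product R \<eta> x vs = T \<eta> x vs"
      using ext_forms_rev_append[OF forms_ext[OF that]] T[OF that N(2)]
      by (simp add: interior_product_def R_def contract_sum_def foldr_contract)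
  qed
  have Rloc: "R y \<alpha> = (\<Sum>(f, Vs)\<leftarrow>ts x. f y * \<alpha> (map (\<lambda>V. V y) Vs))"
    if "y \<in> N x" and \<alpha>: "\<alpha> \<in> ext_forms E y" for x y \<alpha>
  proof -
    from \<alpha> obtain \<eta> where \<eta>: "\<eta> \<in> forms A E" "\<And>vs. \<eta> y vs = \<alpha> (rev vs)" "interior_product R \<eta> y [] = R y \<alpha>"
      by (rule rev_form) blast
    then show ?thesis using RT[OF \<eta>(1)] T[OF \<eta>(1) that(1)] by (simp add: contract_sum_def foldr_contract)
  qed
  have "\<exists>us. (\<forall>(f, ws)\<in>set us. smooth_fun A U f \<and> int (length ws) = n) \<and>
      (\<forall>x\<in>U. R x = (\<lambda>\<alpha>. \<Sum>(f, ws)\<leftarrow>us. f x * wedge E x (map (\<lambda>w. ls \<phi> w x) ws) \<alpha>))"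
    if U: "(U, \<phi>) \<in> trivs E" for U \<phi>
  \<comment> \<open>An empty set offers no base point, and a negative \<open>n\<close> forces every
    \<open>ts x\<close> to be empty.\<close>
  proof (cases "U = {} \<or> n < 0")
    case True
    have "R x \<alpha> = 0" if "x \<in> U" for x \<alpha>
    proof -
      have "ts x = []" using ts[of x] True that by (cases "ts x") (auto simp: contract_terms_def)
      then show ?thesis by (simp add: R_def)
    qed
    then show ?thesis by (intro exI[of _ "[]"]) (simp add: fun_eq_iff)
  next
    case False
    then obtain x0 where x0: "x0 \<in> U" and n: "0 \<le> n" by auto
    let ?J = "multi_indices (nat n)"
    \<comment> \<open>Evaluation on frame vectors over the base point;
      \<open>finite_evaluation\<close> picks the test forms \<kappa> there.\<close>
    let ?F = "\<lambda>ws \<xi>. \<xi> (map (\<lambda>w. ls \<phi> w x0) ws) :: real"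
    obtain ks where ks: "\<And>\<kappa> H. (\<kappa>, H) \<in> set ks \<Longrightarrow> \<kappa> \<in> ext_forms E x0"
      "\<And>\<kappa> H. (\<kappa>, H) \<in> set ks \<Longrightarrow> \<exists>g. \<forall>\<xi>. H \<xi> = (\<Sum>ws\<in>?J. g ws * ?F ws \<xi>)"
      "\<And>ws \<xi>. ws \<in> ?J \<Longrightarrow> \<xi> \<in> ext_forms E x0 \<Longrightarrow> ?F ws \<xi> = (\<Sum>(\<kappa>, H)\<leftarrow>ks. ?F ws \<kappa> * H \<xi>)"
      using finite_evaluation[OF finite_multi_indices[of "nat n"], of "ext_forms E x0" ?F] by blast
    have "\<forall>k\<in>set ks. \<exists>g. \<forall>\<xi>. snd k \<xi> = (\<Sum>ws\<in>?J. g ws * ?F ws \<xi>)" using ks(2) by force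
    then obtain g where g: "\<And>k \<xi>. k \<in> set ks \<Longrightarrow> snd k \<xi> = (\<Sum>ws\<in>?J. g k ws * ?F ws \<xi>)"
      by (metis (no_types) bchoice)
    \<comment> \<open>Independent of the local expressions, hence defined on all of
      \<open>U\<close>; smoothness is then checked near each point with a local expression.\<close>
    define c where "c \<kappa> y = R y (transport \<phi> x0 y \<kappa>)" for \<kappa> y
    \<comment> \<open>A local expansion of \<open>R\<close> along the frame. Its coefficients
      \<open>a\<close> are not unique and need not match from one neighbourhood to the next.\<close>
    have loc: "\<exists>W a. open W \<and> x \<in> W \<and> W \<subseteq> U \<and> (\<forall>ws. smooth_fun A W (a ws)) \<and>
        (\<forall>y\<in>W. \<forall>\<alpha>\<in>ext_forms E y. R y \<alpha> = (\<Sum>ws\<in>?J. a ws y * \<alpha> (map (\<lambda>w. ls \<phi> w y) ws)))"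
      if x: "x \<in> U" for x
    proof -
      let ?W = "U \<inter> N x"
      have W: "open ?W" "x \<in> ?W" "?W \<subseteq> U" using triv_open[OF U] N x by auto
      have "\<exists>a. (\<forall>ws. smooth_fun A ?W (a ws)) \<and> (\<forall>y\<in>?W. \<forall>\<alpha>\<in>ext_forms E y.
          (\<Sum>(f, Vs)\<leftarrow>us. f y * \<alpha> (map (\<lambda>V. V y) Vs)) = (\<Sum>ws\<in>?J. a ws y * \<alpha> (map (\<lambda>w. ls \<phi> w y) ws)))"
        if "contract_terms n us" for us
        using that
      proof (induction us)
        case Nil
        show ?case by (rule exI[of _ "\<lambda>_ _. 0"]) (simp add: smooth_fun_const)
      next
        case (Cons u us)
        obtain f Vs where u: "u = (f, Vs)" by fastforce
        have f: "smooth f" "set Vs \<subseteq> \<Gamma>" "length Vs = nat n" "contract_terms n us"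
          using Cons.prems by (auto simp: contract_terms_def u)
        from Cons.IH[OF f(4)] obtain a where a: "\<And>ws. smooth_fun A ?W (a ws)"
          "\<And>y \<alpha>. y \<in> ?W \<Longrightarrow> \<alpha> \<in> ext_forms E y \<Longrightarrow>
          (\<Sum>(f, Vs)\<leftarrow>us. f y * \<alpha> (map (\<lambda>V. V y) Vs)) = (\<Sum>ws\<in>?J. a ws y * \<alpha> (map (\<lambda>w. ls \<phi> w y) ws))"
          by blast
        have "local_sec \<phi> ?W V" if "V \<in> set Vs" for V
          using local_sec_section[OF U W(3)] f(2) that by blast
        from multi_expansion[OF U W(1,3), of Vs, OF this]
        obtain e where e: "\<And>ws. smooth_fun A ?W (e ws)" "\<And>y \<alpha>. y \<in> ?W \<Longrightarrow> \<alpha> \<in> ext_forms E y \<Longrightarrow>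
          \<alpha> (map (\<lambda>u. u y) Vs) = (\<Sum>ws\<in>?J. e ws y * \<alpha> (map (\<lambda>w. ls \<phi> w y) ws))"
          unfolding f(3) by blast
        show ?case
        proof (intro exI[of _ "\<lambda>ws y. f y * e ws y + a ws y"] conjI allI ballI)
          show "smooth_fun A ?W (\<lambda>y. f y * e ws y + a ws y)" for ws
            by (intro smooth_fun_add smooth_fun_mult W a e smooth_fun_subset[OF f(1)]) simp
          show "(\<Sum>(f, Vs)\<leftarrow>u # us. f y * \<alpha> (map (\<lambda>V. V y) Vs)) =
              (\<Sum>ws\<in>?J. (f y * e ws y + a ws y) * \<alpha> (map (\<lambda>w. ls \<phi> w y) ws))"
            if "y \<in> ?W" "\<alpha> \<in> ext_forms E y" for y \<alpha>
            using a(2)[OF that] e(2)[OF that]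
            by (simp add: u distrib_right sum.distrib sum_distrib_left mult.assoc)
        qed
      qed
      from this[OF ts[of x]] obtain a where "\<And>ws. smooth_fun A ?W (a ws)" "\<And>y \<alpha>. y \<in> ?W \<Longrightarrow> \<alpha> \<in> ext_forms E y \<Longrightarrow>
          (\<Sum>(f, Vs)\<leftarrow>ts x. f y * \<alpha> (map (\<lambda>V. V y) Vs)) = (\<Sum>ws\<in>?J. a ws y * \<alpha> (map (\<lambda>w. ls \<phi> w y) ws))" by blast
      then show ?thesis using W Rloc[of _ x] by (intro exI[of _ ?W] exI[of _ a]) simp
    qed
    have c_eq: "c \<kappa> y = (\<Sum>ws\<in>?J. a ws * ?F ws \<kappa>)"
      if "y \<in> U" "\<kappa> \<in> ext_forms E x0"
        "\<And>\<alpha>. \<alpha> \<in> ext_forms E y \<Longrightarrow> R y \<alpha> = (\<Sum>ws\<in>?J. a ws * \<alpha> (map (\<lambda>w. ls \<phi> w y) ws))" for \<kappa> y a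
      unfolding c_def that(3)[OF transport_ext[OF U x0 that(1,2)]] by (simp only: transport_ls[OF U that(1)])
    have c: "smooth_fun A U (c \<kappa>)" if \<kappa>: "\<kappa> \<in> ext_forms E x0" for \<kappa>
    proof (rule smooth_fun_local[OF triv_open[OF U]])
      fix x assume "x \<in> U"
      from loc[OF this] obtain W a where W: "open W" "x \<in> W" "W \<subseteq> U" "\<And>ws. smooth_fun A W (a ws)"
        "\<And>y \<alpha>. y \<in> W \<Longrightarrow> \<alpha> \<in> ext_forms E y \<Longrightarrow> R y \<alpha> = (\<Sum>ws\<in>?J. a ws y * \<alpha> (map (\<lambda>w. ls \<phi> w y) ws))" by blast
      have "smooth_fun A W (\<lambda>y. \<Sum>ws\<in>?J. a ws y * ?F ws \<kappa>)"
        by (intro smooth_fun_sum smooth_fun_mult smooth_fun_const W)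
      then have "smooth_fun A W (c \<kappa>)"
        by (rule smooth_fun_cong[OF W(1), rotated]) (use c_eq[OF _ \<kappa> W(5)] W(3) in auto)
      then show "\<exists>T. open T \<and> x \<in> T \<and> T \<subseteq> U \<and> smooth_fun A T (c \<kappa>)" using W by blast
    qed
    obtain js where js: "set js = ?J" "distinct js"
      using finite_distinct_list[OF finite_multi_indices] by blast
    \<comment> \<open>The coefficient of \<open>ws\<close> collects the values on the test forms,
      weighted by the expansion of the functions \<open>snd k\<close> in frame evaluations.\<close>
    define co where "co ws y = (\<Sum>k\<leftarrow>ks. c (fst k) y * g k ws)" for ws y
    have R: "R y \<alpha> = (\<Sum>ws\<in>?J. co ws y * \<alpha> (map (\<lambda>w. ls \<phi> w y) ws))"
      if y: "y \<in> U" and \<alpha>: "\<alpha> \<in> ext_forms E y" for y \<alpha>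
    proof -
      from loc[OF y] obtain a where a:
        "\<And>\<alpha>. \<alpha> \<in> ext_forms E y \<Longrightarrow> R y \<alpha> = (\<Sum>ws\<in>?J. a ws y * \<alpha> (map (\<lambda>w. ls \<phi> w y) ws))" by blast
      \<comment> \<open>\<alpha> is carried to the base fibre, where its frame values are the same
        and the test forms apply.\<close>
      let ?\<xi> = "transport \<phi> y x0 \<alpha>"
      have \<xi>: "?\<xi> \<in> ext_forms E x0" by (rule transport_ext[OF U y x0 \<alpha>])
      have F\<xi>: "?F ws ?\<xi> = \<alpha> (map (\<lambda>w. ls \<phi> w y) ws)" for ws by (rule transport_ls[OF U x0])
      have swap: "(\<Sum>ws\<in>?J. b ws * (\<Sum>k\<leftarrow>ls. d k ws)) = (\<Sum>k\<leftarrow>ls. \<Sum>ws\<in>?J. b ws * d k ws)"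
        for b :: "'c list \<Rightarrow> real" and ls and d :: "('e list \<Rightarrow> real) \<times> (('e list \<Rightarrow> real) \<Rightarrow> real) \<Rightarrow> 'c list \<Rightarrow> real"
        by (induction ls) (simp_all add: distrib_left sum.distrib)
      have "R y \<alpha> = (\<Sum>ws\<in>?J. a ws y * (\<Sum>k\<leftarrow>ks. ?F ws (fst k) * snd k ?\<xi>))"
        unfolding a[OF \<alpha>]
        by (rule sum.cong[OF refl]) (use ks(3)[OF _ \<xi>] in \<open>simp add: F\<xi> case_prod_unfold\<close>)
      also have "\<dots> = (\<Sum>k\<leftarrow>ks. (\<Sum>ws\<in>?J. a ws y * ?F ws (fst k)) * snd k ?\<xi>)"
        by (simp add: swap sum_distrib_right mult.assoc)
      also have "\<dots> = (\<Sum>k\<leftarrow>ks. c (fst k) y * (\<Sum>ws\<in>?J. g k ws * \<alpha> (map (\<lambda>w. ls \<phi> w y) ws)))"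
      proof (intro arg_cong[of _ _ sum_list] map_cong[OF refl])
        fix k assume k: "k \<in> set ks"
        then have "fst k \<in> ext_forms E x0" using ks(1)[of "fst k" "snd k"] by simp
        from c_eq[OF y this a] g[OF k, of ?\<xi>]
        show "(\<Sum>ws\<in>?J. a ws y * ?F ws (fst k)) * snd k ?\<xi> =
            c (fst k) y * (\<Sum>ws\<in>?J. g k ws * \<alpha> (map (\<lambda>w. ls \<phi> w y) ws))" by (simp add: F\<xi>)
      qed
      also have "\<dots> = (\<Sum>ws\<in>?J. \<alpha> (map (\<lambda>w. ls \<phi> w y) ws) * co ws y)"
        unfolding co_def swap by (simp add: sum_distrib_left ac_simps)
      finally show ?thesis by (simp add: mult.commute)
    qed
    show ?thesis
    proof (intro exI[of _ "map (\<lambda>ws. (co ws, ws)) js"] conjI ballI)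
      fix t assume "t \<in> set (map (\<lambda>ws. (co ws, ws)) js)"
      then obtain ws where t: "t = (co ws, ws)" "ws \<in> ?J" using js by auto
      have "smooth_fun A U (co ws)" unfolding co_def[abs_def]
        using ks(1) by (intro smooth_fun_sum_list smooth_fun_mult smooth_fun_const triv_open[OF U] c) auto
      then show "case t of (f, ws) \<Rightarrow> smooth_fun A U f \<and> int (length ws) = n"
        using t n by (simp add: multi_indices_def)
    next
      fix y assume y: "y \<in> U"
      show "R y = (\<lambda>\<alpha>. \<Sum>(f, ws)\<leftarrow>map (\<lambda>ws. (co ws, ws)) js. f y * wedge E y (map (\<lambda>w. ls \<phi> w y) ws) \<alpha>)"
      proof
        fix \<alpha>
        show "R y \<alpha> = (\<Sum>(f, ws)\<leftarrow>map (\<lambda>ws. (co ws, ws)) js. f y * wedge E y (map (\<lambda>w. ls \<phi> w y) ws) \<alpha>)"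
        proof (cases "\<alpha> \<in> ext_forms E y")
          case True
          then show ?thesis using js
            by (simp add: R[OF y] wedge_def o_def sum_list_distinct_conv_sum_set)
        qed (simp add: R_def wedge_def o_def)
      qed
    qed
  qed
  then have "R \<in> multivectors A E n" by (auto simp: multivectors_def)
  then show ?thesis using RT by (rule that)
qed

end

theorem theorem5p4p3:
  fixes A :: "('m::{t2_space, second_countable_topology}, 'b::real_inner) chart set"
    and E :: "('m, 'e, 'c::real_inner) vbundle"
    and br :: "('m \<Rightarrow> 'e) \<Rightarrow> ('m \<Rightarrow> 'e) \<Rightarrow> ('m \<Rightarrow> 'e)"
    and \<rho> :: "'e \<Rightarrow> ('m, 'b) tvec"
    and p q :: int
    and P Q :: "'m \<Rightarrow> ('e list \<Rightarrow> real) \<Rightarrow> real"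
  assumes "lie_algebroid A E br \<rho>"
    and "P \<in> multivectors A E p"
    and "Q \<in> multivectors A E q"
  shows "\<exists>!R. R \<in> multivectors A E (p + q - 1) \<and>
    (\<forall>\<eta>\<in>forms A E. interior_product R \<eta> =
       graded_bracket (- p + 1) (graded_bracket (- p) (interior_product P) 1 (d_rho A E br \<rho>))
         (- q) (interior_product Q) \<eta>)"
proof -
  interpret lie_algebroid A E br \<rho> by (rule assms(1))
  let ?T = "derived p (interior_product P) q (interior_product Q)"
  have "\<exists>ts N. open N \<and> x \<in> N \<and> contract_terms (p + q - 1) ts \<and> (\<forall>\<eta>\<in>forms A E. \<forall>y\<in>N. ?T \<eta> y = contract_sum ts \<eta> y)" for x
    using derived_local[OF assms(2,3), of x] by metis
  then obtain R where R: "R \<in> multivectors A E (p + q - 1)"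
    "\<And>\<eta>. \<eta> \<in> forms A E \<Longrightarrow> interior_product R \<eta> = ?T \<eta>"
    by (rule multivector_of_local) blast
  show ?thesis
  proof (rule ex1I)
    show "R \<in> multivectors A E (p + q - 1) \<and> (\<forall>\<eta>\<in>forms A E. interior_product R \<eta> = ?T \<eta>)" using R by blast
    show "R' = R" if "R' \<in> multivectors A E (p + q - 1) \<and> (\<forall>\<eta>\<in>forms A E. interior_product R' \<eta> = ?T \<eta>)" for R'
      using that R by (intro multivector_eqI[of R' _ R]) auto
  qed
qed

end
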